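(* Let $L,T>0$ and let $n\ge 1$ be an integer. Let $\phi\in\mathcal{A}$ with $\phi=\nabla\Phi$ (as in the definition of $\mathcal{A}$), let $F,G\in\mathcal{B}$ and let $H\in C^1(\mathbf{R}^n)$ be real-valued. Assume that: $(a_1)$ there exists $q>0$ such that $$\lim_{|x|\to+\infty}\frac{\inf_{t\in[0,T]}F(t,x)}{|x|^q}=+\infty$$ and $$\limsup_{|x|\to+\infty}\frac{\sup_{t\in[0,T]}|G(t,x)|+|H(x)|}{|x|^q}<+\infty;$$ $(a_2)$ there are $\gamma\in\{\inf_{\mathbf{R}^n}H,\ \sup_{\mathbf{R}^n}H\}$, with $H^{-1}(\gamma)$ at most countable, and $v,w\in H^{-1}(\gamma)$ such that $$\int_0^TG(t,v)\,dt\neq\int_0^TG(t,w)\,dt.$$ Then, for each $\alpha\in L^\infty([0,T])$ having a constant sign and with $\mathrm{meas}(\alpha^{-1}(0))=0$, there exists $(\tilde\lambda,\tilde\mu)\in\mathbf{R}^2$ such that the problem $$\begin{cases}(\phi(u'))'=\nabla_x\big(F(t,u)+\tilde\lambda G(t,u)+\tilde\mu\,\alpha(t)H(u)\big) & \text{in }[0,T]\\ u(0)=u(T),\quad u'(0)=u'(T)\end{cases}$$ has at least two (distinct) solutions which are global minima in $K$ of the functional $$u\mapsto\int_0^T\big(\Phi(u'(t))+F(t,u(t))+\tilde\lambda G(t,u(t))+\tilde\mu\,\alpha(t)H(u(t))\big)\,dt.$$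
   Context: $L,T$ are fixed positive numbers, $|\cdot|$ is the Euclidean norm on $\mathbf{R}^n$, $B_r=\{x\in\mathbf{R}^n:|x|<r\}$ for $r>0$, and $\overline{B_r}$ is the closure of $B_r$. $\mathcal{A}$ is the family of all homeomorphisms $\phi$ from $B_L$ onto $\mathbf{R}^n$ such that $\phi(0)=0$ and $\phi=\nabla\Phi$, where $\Phi:\overline{B_L}\to\,]-\infty,0]$ is continuous and strictly convex in $\overline{B_L}$, and of class $C^1$ in $B_L$. $\mathcal{B}$ is the family of all functions $F:[0,T]\times\mathbf{R}^n\to\mathbf{R}$ which are measurable in $[0,T]$ (i.e. $F(\cdot,x)$ is measurable for each $x$), of class $C^1$ in $\mathbf{R}^n$ (i.e. $F(t,\cdot)$ is $C^1$ for each $t$), and such that $\nabla_xF$ is measurable in $[0,T]$, $\sup_{x\in B_r}|\nabla_xF(\cdot,x)|\in L^1([0,T])$ for each $r>0$, and $F(\cdot,0)\in L^1([0,T])$. Here $\nabla_x$ denotes the gradient with respect to $x\in\mathbf{R}^n$. $K=\{u\in\mathrm{Lip}([0,T],\mathbf{R}^n):|u'(t)|\le L\text{ for a.e. }t\in[0,T],\ u(0)=u(T)\}$, where $\mathrm{Lip}([0,T],\mathbf{R}^n)$ is the space of all Lipschitzian functions from $[0,T]$ into $\mathbf{R}^n$. Given $\phi\in\mathcal{A}$ and $P\in\mathcal{B}$, a solution of the problem $(\phi(u'))'=\nabla_xP(t,u)$ in $[0,T]$, $u(0)=u(T)$, $u'(0)=u'(T)$, is any function $u:[0,T]\to\mathbf{R}^n$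 of class $C^1$, with $u'([0,T])\subset B_L$, $u(0)=u(T)$, $u'(0)=u'(T)$, such that $\phi\circ u'$ is absolutely continuous in $[0,T]$ and $(\phi\circ u')'(t)=\nabla_xP(t,u(t))$ for a.e. $t\in[0,T]$. In the claim this is applied with $P(t,x)=F(t,x)+\tilde\lambda G(t,x)+\tilde\mu\,\alpha(t)H(x)$. "$\alpha$ has a constant sign" means that either $\alpha\ge0$ or $\alpha\le0$ (a.e.) in $[0,T]$; $\mathrm{meas}$ is Lebesgue measure. *)

theory Defs
  imports "HOL-Analysis.Analysis"
begin

text \<open>
  Functions on \<open>[0,T]\<close>, on \<open>[0,T] \<times> \<real>\<^sup>n\<close> or on a ball are represented by total functions.  All
  notions below depend only on their values on the intended domain; derivatives in time are
  taken within \<open>{0..T}\<close>, hence are one-sided at the endpoints.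
\<close>

definition gradient :: "('a::real_inner \<Rightarrow> real) \<Rightarrow> 'a \<Rightarrow> 'a" where
  "gradient f x = (THE D. GDERIV f x :> D)"

lemma gradient_eqI:
  assumes "GDERIV f x :> D"
  shows "gradient f x = D"
  unfolding gradient_def
proof (rule the_equality)
  show "GDERIV f x :> D" by fact
next
  fix E assume "GDERIV f x :> E"
  then have "(\<lambda>h. h \<bullet> E) = (\<lambda>h. h \<bullet> D)"
    using assms unfolding gderiv_def by (rule has_derivative_unique)
  then have "\<forall>h. h \<bullet> E = h \<bullet> D"
    by (rule fun_cong[THEN allI])
  then show "E = D"
    by (simp only: vector_eq_ldot)
qed

lemma GDERIV_gradient:
  fixes f :: "'a::euclidean_space \<Rightarrow> real"
  assumes "f differentiable (at x)"
  shows "GDERIV f x :> gradient f x"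
proof -
  obtain f' where f': "(f has_derivative f') (at x)"
    using assms unfolding differentiable_def by blast
  then interpret bounded_linear f' by (rule has_derivative_bounded_linear)
  have eq: "f' h = h \<bullet> (\<Sum>b\<in>Basis. f' b *\<^sub>R b)" for h
  proof -
    have "f' h = f' (\<Sum>b\<in>Basis. (h \<bullet> b) *\<^sub>R b)"
      by (simp add: euclidean_representation)
    also have "\<dots> = (\<Sum>b\<in>Basis. (h \<bullet> b) * f' b)"
      by (simp add: sum scaleR)
    also have "\<dots> = h \<bullet> (\<Sum>b\<in>Basis. f' b *\<^sub>R b)"
      by (simp add: inner_sum_right mult.commute)
    finally show ?thesis .
  qed
  have "f' = (\<lambda>h. h \<bullet> (\<Sum>b\<in>Basis. f' b *\<^sub>R b))"
    by (rule ext) (rule eq)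
  with f' have "GDERIV f x :> (\<Sum>b\<in>Basis. f' b *\<^sub>R b)"
    unfolding gderiv_def by (rule has_derivative_eq_rhs)
  then show ?thesis
    by (simp only: gradient_eqI)
qed

text \<open>Intended for open \<open>S\<close>.\<close>

definition C1_on :: "'a::real_inner set \<Rightarrow> ('a \<Rightarrow> real) \<Rightarrow> bool" where
  "C1_on S f \<longleftrightarrow> (\<forall>x\<in>S. f differentiable (at x)) \<and> continuous_on S (gradient f)"

definition strictly_convex_on :: "'a::real_vector set \<Rightarrow> ('a \<Rightarrow> real) \<Rightarrow> bool" where
  "strictly_convex_on S f \<longleftrightarrow> convex S \<and>
     (\<forall>x\<in>S. \<forall>y\<in>S. \<forall>s. x \<noteq> y \<and> 0 < s \<and> s < 1 \<longrightarrow>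
        f ((1 - s) *\<^sub>R x + s *\<^sub>R y) < (1 - s) * f x + s * f y)"

definition abs_continuous_on :: "real set \<Rightarrow> (real \<Rightarrow> 'a::real_normed_vector) \<Rightarrow> bool" where
  "abs_continuous_on S f \<longleftrightarrow>
     (\<forall>\<epsilon>>0. \<exists>\<delta>>0. \<forall>\<D> A. \<D> division_of A \<and> A \<subseteq> S \<and> (\<Sum>I\<in>\<D>. measure lborel I) < \<delta> \<longrightarrow>
        (\<Sum>I\<in>\<D>. norm (f (Sup I) - f (Inf I))) < \<epsilon>)"

definition is_potential :: "real \<Rightarrow> (real^'n \<Rightarrow> real^'n) \<Rightarrow> (real^'n \<Rightarrow> real) \<Rightarrow> bool" where
  "is_potential L \<phi> \<Phi> \<longleftrightarrow>
     (\<forall>x\<in>cball 0 L. \<Phi> x \<le> 0) \<and>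
     continuous_on (cball 0 L) \<Phi> \<and>
     strictly_convex_on (cball 0 L) \<Phi> \<and>
     C1_on (ball 0 L) \<Phi> \<and>
     (\<forall>x\<in>ball 0 L. \<phi> x = gradient \<Phi> x)"

definition class_A :: "real \<Rightarrow> (real^'n \<Rightarrow> real^'n) set" where
  "class_A L = {\<phi>. (\<exists>\<psi>. homeomorphism (ball 0 L) UNIV \<phi> \<psi>) \<and> \<phi> 0 = 0 \<and> (\<exists>\<Phi>. is_potential L \<phi> \<Phi>)}"

text \<open>
  The supremum of \<open>\<bar>\<nabla>\<^sub>x F(t, \<cdot>)\<bar>\<close> over a ball is a genuine real supremum, since the gradient is
  continuous and therefore bounded on the closed ball.
\<close>

definition class_B :: "real \<Rightarrow> (real \<Rightarrow> real^'n \<Rightarrow> real) set" where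
  "class_B T = {F.
     (\<forall>x. (\<lambda>t. F t x) \<in> borel_measurable (lebesgue_on {0..T})) \<and>
     (\<forall>t\<in>{0..T}. C1_on UNIV (F t)) \<and>
     (\<forall>x. (\<lambda>t. gradient (F t) x) \<in> borel_measurable (lebesgue_on {0..T})) \<and>
     (\<forall>r>0. integrable (lebesgue_on {0..T}) (\<lambda>t. SUP x\<in>ball 0 r. norm (gradient (F t) x))) \<and>
     integrable (lebesgue_on {0..T}) (\<lambda>t. F t 0)}"

definition Linfty :: "real \<Rightarrow> (real \<Rightarrow> real) set" where
  "Linfty T = {\<alpha>. \<alpha> \<in> borel_measurable (lebesgue_on {0..T}) \<and>
     (\<exists>C. AE t in lebesgue_on {0..T}. \<bar>\<alpha> t\<bar> \<le> C)}"

definition constant_sign :: "real \<Rightarrow> (real \<Rightarrow> real) \<Rightarrow> bool" where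
  "constant_sign T \<alpha> \<longleftrightarrow>
     (AE t in lebesgue_on {0..T}. \<alpha> t \<ge> 0) \<or> (AE t in lebesgue_on {0..T}. \<alpha> t \<le> 0)"

abbreviation tderiv :: "real \<Rightarrow> (real \<Rightarrow> 'a::real_normed_vector) \<Rightarrow> real \<Rightarrow> 'a" where
  "tderiv T u t \<equiv> vector_derivative u (at t within {0..T})"

definition K_set :: "real \<Rightarrow> real \<Rightarrow> (real \<Rightarrow> real^'n) set" where
  "K_set L T = {u. (\<exists>C. C-lipschitz_on {0..T} u) \<and>
     (AE t in lebesgue_on {0..T}. u differentiable (at t within {0..T}) \<and> norm (tderiv T u t) \<le> L) \<and>
     u 0 = u T}"

definition is_solution ::
  "real \<Rightarrow> real \<Rightarrow> (real^'n \<Rightarrow> real^'n) \<Rightarrow> (real \<Rightarrow> real^'n \<Rightarrow> real) \<Rightarrow> (real \<Rightarrow> real^'n) \<Rightarrow> bool" where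
  "is_solution L T \<phi> P u \<longleftrightarrow>
     (\<forall>t\<in>{0..T}. u differentiable (at t within {0..T})) \<and>
     continuous_on {0..T} (tderiv T u) \<and>
     tderiv T u ` {0..T} \<subseteq> ball 0 L \<and>
     u 0 = u T \<and> tderiv T u 0 = tderiv T u T \<and>
     abs_continuous_on {0..T} (\<phi> \<circ> tderiv T u) \<and>
     (AE t in lebesgue_on {0..T}.
        ((\<phi> \<circ> tderiv T u) has_vector_derivative gradient (P t) (u t)) (at t within {0..T}))"

definition energy ::
  "real \<Rightarrow> (real^'n \<Rightarrow> real) \<Rightarrow> (real \<Rightarrow> real^'n \<Rightarrow> real) \<Rightarrow> (real \<Rightarrow> real^'n) \<Rightarrow> real" where
  "energy T \<Phi> P u = (LINT t|lebesgue_on {0..T}. \<Phi> (tderiv T u t) + P t (u t))"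

definition is_global_min_on :: "('a \<Rightarrow> real) \<Rightarrow> 'a set \<Rightarrow> 'a \<Rightarrow> bool" where
  "is_global_min_on J S u \<longleftrightarrow> u \<in> S \<and> (\<forall>v\<in>S. J u \<le> J v)"

end

theory Submission
  imports Defs "HOL-Complex_Analysis.Great_Picard"
begin

text \<open>
  Choose the sign of the weight so that the penalty \<open>\<psi> u = \<integral> \<beta> (H u - \<gamma>)\<close>, with \<open>\<beta> = \<plusminus>\<alpha>\<close>, is
  nonnegative, and write \<open>I u = \<integral> \<Phi> u' + F(t, u)\<close> and \<open>g u = \<integral> G(t, u)\<close>.  A curve in \<open>K\<close> with
  \<open>\<psi> u = 0\<close> runs inside the countable set \<open>H\<^sup>-\<^sup>1(\<gamma>)\<close> and is therefore constant, by connectedness.  So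
  \<open>g\<close> takes only countably many values on \<open>{\<psi> = 0}\<close>, and at least two, at \<open>v\<close> and at \<open>w\<close>.  Fix a
  number \<open>c\<close> strictly between \<open>g v\<close> and \<open>g w\<close> that is none of these values.

  For fixed \<open>\<mu> > 0\<close> consider the minimizers of \<open>I + \<mu> \<psi> + l (g - c)\<close> on \<open>K\<close> as \<open>l\<close> varies.  The set of
  \<open>l\<close> having a minimizer with \<open>g \<le> c\<close> and the set of those having one with \<open>g \<ge> c\<close> are closed, nonempty
  and cover the line, so they meet (\<open>two_sided_minimizers\<close>): for some \<open>l\<close> there is a minimizer on
  either side of the level \<open>c\<close>.  If for some \<open>\<mu>\<close> these two are different curves, they are the two
  global minima sought.  Otherwise every \<open>\<mu>\<close> yields a single minimizer \<open>u\<close> with \<open>g u = c\<close>, and comparing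
  it with the constant \<open>v\<close> or \<open>w\<close>, according to the sign of \<open>l\<close>, gives
  \<open>I u + \<mu> \<psi> u \<le> max (I v) (I w)\<close>.  As \<open>\<mu>\<close> grows, a limit curve satisfies \<open>\<psi> = 0\<close> and \<open>g = c\<close>, against
  the choice of \<open>c\<close> (\<open>two_minimizers\<close>).

  This needs compactness of sublevel sets in \<open>K\<close>: the growth assumptions bound the curves, the
  Arzela-Ascoli theorem provides uniform limits, and the convex kinetic part is lower semicontinuous
  (\<open>kinetic_lower_semicontinuous\<close>).

  It remains to see that a global minimum \<open>u\<close> on \<open>K\<close> solves the equation, although the constraint
  \<open>norm u' \<le> L\<close> could be active (\<open>minimizer_is_solution\<close>).  By convexity of \<open>\<Phi>\<close>, \<open>u\<close> also minimizes the
  functional in which the potential is replaced by its linearization \<open>z \<mapsto> \<integral> e \<bullet> z\<close> at \<open>u\<close>, where \<open>e\<close> is the gradient of the potential along \<open>u\<close>.  For this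
  functional a minimizer \<open>w\<close> can be written down: integrate \<open>\<phi> w' = E + a\<close>, where \<open>E\<close> is a
  primitive of \<open>e\<close> and the vector \<open>a\<close> is chosen, by Brouwer's theorem, so that \<open>w\<close> is periodic.  Strict
  convexity forces \<open>u' = w'\<close>, so \<open>u'\<close> is continuous with values in the open ball and \<open>\<phi> u'\<close> is a
  primitive of \<open>e\<close>.
\<close>


section \<open>Differentiation of Lipschitz functions and of integrals\<close>

lemma AE_lebesgue_on_iff_negligible:
  fixes T :: real
  shows "(AE t in lebesgue_on {0..T}. P t) \<longleftrightarrow> (\<exists>N. negligible N \<and> (\<forall>t\<in>{0..T} - N. P t))"
proof -
  have "(AE t in lebesgue_on {0..T}. P t) \<longleftrightarrow> (AE t in lebesgue. t \<in> {0..T} \<longrightarrow> P t)"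
    by (rule AE_restrict_space_iff) simp
  also have "\<dots> \<longleftrightarrow> (\<exists>N\<in>null_sets lebesgue. {t. \<not> (t \<in> {0..T} \<longrightarrow> P t)} \<subseteq> N)"
    by (simp add: eventually_ae_filter)
  also have "\<dots> \<longleftrightarrow> (\<exists>N. negligible N \<and> (\<forall>t\<in>{0..T} - N. P t))"
    unfolding negligible_iff_null_sets by blast
  finally show ?thesis .
qed

lemma AE_lebesgue_on_mem: "(AE t in lebesgue_on {0..T::real}. t \<in> {0..T})"
  by (rule AE_I2) simp

text \<open>
  Almost everywhere the averages of \<open>f\<close> over \<open>[x, x + h]\<close> converge to \<open>f x\<close>, which is the derivative
  from the right; the same statement for \<open>t \<mapsto> f (-t)\<close> is the derivative from the left.
\<close>

lemma lebesgue_differentiation: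
  fixes f :: "real \<Rightarrow> 'a::euclidean_space"
  assumes f: "\<And>a b. f integrable_on {a..b}"
  obtains N where "negligible N"
    "\<And>a x. x \<notin> N \<Longrightarrow> a < x \<Longrightarrow> ((\<lambda>s. integral {a..s} f) has_vector_derivative f x) (at x)"
proof -
  obtain N1 where N1: "negligible N1"
    "\<And>x e. \<lbrakk>x \<notin> N1; 0 < e\<rbrakk> \<Longrightarrow> \<exists>d>0. \<forall>h. 0 < h \<and> h < d \<longrightarrow>
        norm (integral {x..x+h} f /\<^sub>R h - f x) < e"
    using integrable_ccontinuous_explicit[of f] f by (auto simp: cbox_interval)
  have refl: "(\<lambda>t. f (-t)) integrable_on {a..b}" for a b
    using Henstock_Kurzweil_Integration.integrable_reflect_real[where f=f and b="-a" and a="-b"] f[of "-b" "-a"] by simp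
  obtain N2 where N2: "negligible N2"
    "\<And>x e. \<lbrakk>x \<notin> N2; 0 < e\<rbrakk> \<Longrightarrow> \<exists>d>0. \<forall>h. 0 < h \<and> h < d \<longrightarrow>
        norm (integral {x..x+h} (\<lambda>t. f (-t)) /\<^sub>R h - f (-x)) < e"
    using integrable_ccontinuous_explicit[of "\<lambda>t. f (-t)"] refl by (auto simp: cbox_interval)
  have neg: "negligible (N1 \<union> uminus ` N2)"
    using N1(1) N2(1)
    by (intro negligible_Un negligible_differentiable_image_negligible)
      (auto intro!: derivative_intros simp: differentiable_on_def)
  show thesis
  proof (rule that[OF neg])
    fix a x :: real
    assume x: "x \<notin> N1 \<union> uminus ` N2" and ax: "a < x"
    have x1: "x \<notin> N1" and x2: "-x \<notin> N2"
      using x by (auto simp: image_iff dest: spec[of _ "-x"])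
    show "((\<lambda>s. integral {a..s} f) has_vector_derivative f x) (at x)"
      unfolding has_vector_derivative_def has_derivative_at_alt
    proof (intro conjI allI impI)
      show "bounded_linear (\<lambda>h. h *\<^sub>R f x)"
        by (rule bounded_linear_scaleR_left)
      fix e :: real assume e: "e > 0"
      obtain d1 where d1: "d1 > 0" "\<And>h. 0 < h \<Longrightarrow> h < d1 \<Longrightarrow> norm (integral {x..x+h} f /\<^sub>R h - f x) < e"
        using N1(2)[OF x1 e] by blast
      obtain d2 where d2: "d2 > 0" "\<And>h. 0 < h \<Longrightarrow> h < d2 \<Longrightarrow>
          norm (integral {-x..-x+h} (\<lambda>t. f (-t)) /\<^sub>R h - f x) < e"
        using N2(2)[OF x2 e] by auto
      define d where "d = min (min d1 d2) (x - a)"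
      have key: "norm (v - h *\<^sub>R f x) \<le> e * h" if "0 < h" "norm (v /\<^sub>R h - f x) < e" for v and h :: real
      proof -
        have "v - h *\<^sub>R f x = h *\<^sub>R (v /\<^sub>R h - f x)" using that by (simp add: algebra_simps)
        then have "norm (v - h *\<^sub>R f x) = h * norm (v /\<^sub>R h - f x)" using that by simp
        then show ?thesis using that by (simp add: mult.commute)
      qed
      show "\<exists>d>0. \<forall>y. norm (y - x) < d \<longrightarrow>
          norm (integral {a..y} f - integral {a..x} f - (y - x) *\<^sub>R f x) \<le> e * norm (y - x)"
      proof (intro exI[of _ d] conjI allI impI)
        show "d > 0" using d1 d2 ax by (simp add: d_def)
        fix y assume y: "norm (y - x) < d"
        consider "y = x" | "y > x" | "y < x" by linarith
        then show "norm (integral {a..y} f - integral {a..x} f - (y - x) *\<^sub>R f x) \<le> e * norm (y - x)"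
        proof cases
          case 1 then show ?thesis by simp
        next
          case 2
          have "integral {a..x} f + integral {x..y} f = integral {a..y} f"
            using 2 ax f by (intro Henstock_Kurzweil_Integration.integral_combine) auto
          then have "integral {a..y} f - integral {a..x} f = integral {x..x+(y-x)} f"
            by (simp add: algebra_simps)
          moreover have "norm (integral {x..x+(y-x)} f - (y-x) *\<^sub>R f x) \<le> e * (y - x)"
            using 2 y by (intro key d1(2)) (auto simp: d_def)
          ultimately show ?thesis using 2 by (simp only: real_norm_def abs_of_pos diff_gt_0_iff_gt)
        next
          case 3
          have "integral {a..y} f + integral {y..x} f = integral {a..x} f"
            using 3 y ax f by (intro Henstock_Kurzweil_Integration.integral_combine) (auto simp: d_def)
          then have "integral {y..x} f = integral {a..x} f - integral {a..y} f"
            by (simp add: algebra_simps)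
          moreover have "norm (integral {-x..-x+(x-y)} (\<lambda>t. f (-t)) - (x-y) *\<^sub>R f x) \<le> e * (x - y)"
            using 3 y by (intro key d2(2)) (auto simp: d_def)
          moreover have "integral {-x..-x+(x-y)} (\<lambda>t. f (-t)) = integral {y..x} f"
            using integral_reflect_real[of y x f] by simp
          ultimately have "norm (integral {a..x} f - integral {a..y} f - (x-y) *\<^sub>R f x) \<le> e * (x - y)"
            by simp
          moreover have "integral {a..y} f - integral {a..x} f - (y-x) *\<^sub>R f x
              = - (integral {a..x} f - integral {a..y} f - (x-y) *\<^sub>R f x)"
            by (simp add: algebra_simps)
          ultimately show ?thesis using 3 by (metis abs_minus_commute abs_of_pos diff_gt_0_iff_gt norm_minus_cancel real_norm_def)
        qed
      qed
    qed
  qed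
qed

text \<open>
  Adding \<open>(C + 1) t\<close> turns \<open>f\<close> into an increasing bi-Lipschitz bijection \<open>g\<close> of the line.  The image of
  Lebesgue measure under the inverse of \<open>g\<close> gives \<open>[a, b]\<close> the mass \<open>g b - g a\<close>, and it is absolutely
  continuous because Lipschitz maps preserve null sets.  Its Radon-Nikodym density is what has to be
  integrated to recover \<open>g\<close>.
\<close>

lemma lipschitz_real_is_integral:
  fixes f :: "real \<Rightarrow> real"
  assumes lip: "C-lipschitz_on UNIV f"
  obtains d where "\<And>a b. a \<le> b \<Longrightarrow> (d has_integral (f b - f a)) {a..b}"
proof -
  define g where "g t = f t + (C + 1) * t" for t
  have C: "C \<ge> 0" using lip lipschitz_on_nonneg by blast
  have lipf: "\<bar>f x - f y\<bar> \<le> C * \<bar>x - y\<bar>" for x y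
    using lipschitz_onD[OF lip, of x y] by (simp add: dist_real_def)
  have grow: "b - a \<le> g b - g a" if "a \<le> b" for a b
    using lipf[of b a] that by (simp add: g_def algebra_simps)
  have smono: "strict_mono g"
  proof (rule strict_monoI)
    fix x y :: real assume "x < y" then show "g x < g y" using grow[of x y] by simp
  qed
  then have injg: "inj g" by (rule strict_mono_imp_inj_on)
  have contg: "continuous_on A g" for A
    unfolding g_def
    using lipschitz_on_continuous_on[OF lip] by (intro continuous_intros) (auto intro: continuous_on_subset)
  have surjg: "surj g"
  proof (unfold surj_def, intro allI)
    fix y
    define b where "b = \<bar>y - g 0\<bar>"
    have "g (-b) \<le> y" "y \<le> g b" using grow[of 0 b] grow[of "-b" 0] by (auto simp: b_def)
    then obtain x where "g x = y"
      using IVT'[of g "-b" y b] contg by (auto simp: b_def)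
    then show "\<exists>x. y = g x" by blast
  qed
  define h where "h = inv g"
  have hg: "h (g x) = x" for x using injg by (simp add: h_def)
  have gh: "g (h x) = x" for x using surjg by (simp add: h_def surj_f_inv_f)
  have "mono h"
  proof (rule monoI)
    fix x y :: real assume "x \<le> y"
    then show "h x \<le> h y" using smono gh by (metis not_le strict_mono_less)
  qed
  then have hm[measurable]: "h \<in> borel_measurable borel" by (rule borel_measurable_mono)
  have vim: "h -` A = g ` A" for A
    using hg gh by (auto simp: image_iff) metis
  \<comment> \<open>\<open>M A\<close> is the Lebesgue measure of \<open>g ` A\<close>.\<close>
  define M where "M = distr lborel borel h"
  have sM: "sets M = sets lborel" by (simp add: M_def)
  have eM: "emeasure M A = emeasure lborel (g ` A)" if "A \<in> sets borel" for A
    using that by (simp add: M_def emeasure_distr vim)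
  have ac: "absolutely_continuous lborel M"
    unfolding absolutely_continuous_def
  proof
    fix A assume A: "A \<in> null_sets (lborel :: real measure)"
    then have Ab: "A \<in> sets borel" by auto
    have "negligible A" using A by (simp add: negligible_iff_null_sets null_sets_completionI)
    have lg: "\<bar>g y - g x\<bar> \<le> (2 * C + 1) * \<bar>y - x\<bar>" for x y
    proof -
      have "g y - g x = (f y - f x) + (C+1) * (y - x)" by (simp add: g_def algebra_simps)
      then have "\<bar>g y - g x\<bar> \<le> \<bar>f y - f x\<bar> + \<bar>(C+1) * (y - x)\<bar>" by linarith
      also have "\<dots> \<le> C * \<bar>y - x\<bar> + (C+1) * \<bar>y - x\<bar>" using lipf[of y x] C by (simp add: abs_mult)
      finally show ?thesis by (simp add: algebra_simps)
    qed
    have "negligible (g ` A)"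
    proof (rule negligible_locally_Lipschitz_image[OF _ \<open>negligible A\<close>])
      fix x assume "x \<in> A"
      show "\<exists>T B. open T \<and> x \<in> T \<and> (\<forall>y\<in>A \<inter> T. norm (g y - g x) \<le> B * norm (y - x))"
        using lg by (intro exI[of _ UNIV] exI[of _ "2*C+1"]) auto
    qed simp
    moreover have "g ` A \<in> sets borel"
      using measurable_sets[OF hm Ab] by (simp add: vim)
    ultimately have "emeasure lborel (g ` A) = 0"
      by (simp add: negligible_iff_null_sets null_sets_completion_iff null_sets_def)
    then show "A \<in> null_sets M" using eM[OF Ab] Ab sM by (auto simp: null_sets_def)
  qed
  obtain q where q[measurable]: "q \<in> borel_measurable lborel" and qM: "density lborel q = M"
    using sigma_finite_measure.Radon_Nikodym[OF sigma_finite_lborel ac sM] by blast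
  have gI: "g ` {a..b} = {g a..g b}" for a b
  proof
    show "g ` {a..b} \<subseteq> {g a..g b}" using smono by (auto simp: strict_mono_less_eq)
    show "{g a..g b} \<subseteq> g ` {a..b}"
      using smono gh by (auto simp: image_iff) (metis strict_mono_less_eq atLeastAtMost_iff)
  qed
  have qint: "(\<integral>\<^sup>+x. q x * indicator {a..b} x \<partial>lborel) = ennreal (g b - g a)" if "a \<le> b" for a b
  proof -
    have "(\<integral>\<^sup>+x. q x * indicator {a..b} x \<partial>lborel) = emeasure M {a..b}"
      unfolding qM[symmetric] by (subst emeasure_density) auto
    also have "\<dots> = ennreal (g b - g a)"
      using grow[OF that] that by (simp add: eM gI)
    finally show ?thesis .
  qed
  have "AE x in lborel. \<forall>n::nat. q x * indicator {-real n..real n} x \<noteq> \<infinity>"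
    unfolding AE_all_countable
  proof
    fix n :: nat
    show "AE x in lborel. q x * indicator {-real n..real n} x \<noteq> \<infinity>"
      by (rule nn_integral_PInf_AE) (auto simp: qint)
  qed
  then have fin: "AE x in lborel. q x \<noteq> \<infinity>"
  proof (rule eventually_mono)
    fix x :: real assume *: "\<forall>n::nat. q x * indicator {-real n..real n} x \<noteq> \<infinity>"
    obtain n where "\<bar>x\<bar> \<le> real n" using real_arch_simple by blast
    then have "x \<in> {-real n..real n}" by auto
    then show "q x \<noteq> \<infinity>" using *[rule_format, of n] by simp
  qed
  define d where "d x = enn2real (q x)" for x
  have dm[measurable]: "d \<in> borel_measurable borel" unfolding d_def by measurable
  have dint: "(d has_integral (g b - g a)) {a..b}" if "a \<le> b" for a b
  proof -
    have "(\<integral>\<^sup>+x. ennreal (indicator {a..b} x * d x) \<partial>lborel) = (\<integral>\<^sup>+x. q x * indicator {a..b} x \<partial>lborel)"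
      using fin by (intro nn_integral_cong_AE)
        (auto simp: d_def indicator_def less_top elim!: eventually_mono)
    then have "((\<lambda>x. indicator {a..b} x * d x) has_integral (g b - g a)) UNIV"
      using grow[OF that] that qint[OF that] by (intro nn_integral_has_integral) (auto simp: d_def)
    moreover have "(\<lambda>x. indicator {a..b} x * d x) = (\<lambda>x. if x \<in> {a..b} then d x else 0)"
      by (auto simp: indicator_def)
    ultimately show ?thesis by (simp only: has_integral_restrict_UNIV)
  qed
  show thesis
  proof (rule that)
    fix a b :: real assume ab: "a \<le> b"
    have "((\<lambda>x. d x - (C + 1)) has_integral (g b - g a - (b - a) * (C + 1))) {a..b}"
      using has_integral_diff[OF dint[OF ab] has_integral_const_real[of "C+1" a b]] ab by simp
    moreover have "g b - g a - (b - a) * (C + 1) = f b - f a"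
      by (simp add: g_def algebra_simps)
    ultimately show "((\<lambda>x. d x - (C + 1)) has_integral (f b - f a)) {a..b}" by simp
  qed
qed

text \<open>
  The one-dimensional Rademacher theorem together with the fundamental theorem of calculus: each
  coordinate is an indefinite integral, and indefinite integrals are differentiated by
  \<open>lebesgue_differentiation\<close>.
\<close>

theorem lipschitz_differentiable_ae:
  fixes u :: "real \<Rightarrow> 'a::euclidean_space"
  assumes T: "T > 0" and lip: "C-lipschitz_on {0..T} u"
  shows "AE t in lebesgue_on {0..T}. u differentiable (at t within {0..T})"
    and "\<And>a b. 0 \<le> a \<Longrightarrow> a \<le> b \<Longrightarrow> b \<le> T \<Longrightarrow> (tderiv T u has_integral (u b - u a)) {a..b}"
proof -
  define U where "U t = u (max 0 (min T t))" for t
  have lipU: "C-lipschitz_on UNIV (\<lambda>t. U t \<bullet> i)" if "i \<in> Basis" for i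
  proof (rule lipschitz_onI)
    show "C \<ge> 0" using lip lipschitz_on_nonneg by blast
    fix x y :: real
    have "dist (U x \<bullet> i) (U y \<bullet> i) = \<bar>(U x - U y) \<bullet> i\<bar>" by (simp add: dist_real_def inner_diff_left)
    also have "\<dots> \<le> norm (U x - U y)" using that by (rule Basis_le_norm)
    also have "\<dots> \<le> C * dist (max 0 (min T x)) (max 0 (min T y))"
      using lipschitz_onD[OF lip, of "max 0 (min T x)" "max 0 (min T y)"] T
      by (simp add: U_def dist_norm)
    also have "\<dots> \<le> C * dist x y"
      using \<open>C \<ge> 0\<close> by (intro mult_left_mono) (auto simp: dist_real_def)
    finally show "dist (U x \<bullet> i) (U y \<bullet> i) \<le> C * dist x y" .
  qed
  have "\<forall>i\<in>Basis. \<exists>d. \<forall>a b. a \<le> b \<longrightarrow> (d has_integral (U b \<bullet> i - U a \<bullet> i)) {a..b}"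
    using lipschitz_real_is_integral[OF lipU] by metis
  then obtain D where D: "\<And>i a b. i \<in> Basis \<Longrightarrow> a \<le> b \<Longrightarrow> (D i has_integral (U b \<bullet> i - U a \<bullet> i)) {a..b}"
    by metis
  define d where "d t = (\<Sum>i\<in>Basis. D i t *\<^sub>R i)" for t
  have d: "(d has_integral (U b - U a)) {a..b}" if "a \<le> b" for a b
  proof -
    have "(d has_integral (\<Sum>i\<in>Basis. (U b \<bullet> i - U a \<bullet> i) *\<^sub>R i)) {a..b}"
      unfolding d_def using that by (intro has_integral_sum has_integral_scaleR_left D) auto
    also have "(\<Sum>i\<in>Basis. (U b \<bullet> i - U a \<bullet> i) *\<^sub>R i) = U b - U a"
      by (simp add: inner_diff_left[symmetric] euclidean_representation)
    finally show ?thesis .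
  qed
  have dI: "d integrable_on {a..b}" for a b
    using d[of a b] by (cases "a \<le> b") (auto intro: has_integral_integrable)
  obtain N where N: "negligible N"
    "\<And>a x. x \<notin> N \<Longrightarrow> a < x \<Longrightarrow> ((\<lambda>s. integral {a..s} d) has_vector_derivative d x) (at x)"
    using lebesgue_differentiation[OF dI] by blast
  have der: "(u has_vector_derivative d t) (at t within {0..T})" if t: "t \<in> {0..T}" "t \<notin> N" for t
  proof -
    have "((\<lambda>s. integral {-1..s} d + u 0) has_vector_derivative d t) (at t within {0..T})"
      using has_vector_derivative_add[OF has_vector_derivative_at_within[OF N(2)[of t "-1"]]
          has_vector_derivative_const[of "u 0"]] t by simp
    then show ?thesis
    proof (rule has_vector_derivative_transform[rotated 2])
      fix s assume s: "s \<in> {0..T}"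
      have "integral {-1..s} d = U s - U (-1)" using d[of "-1" s] s by (auto intro: integral_unique)
      then show "u s = integral {-1..s} d + u 0" using s T by (simp add: U_def)
    qed (use t in auto)
  qed
  have td: "tderiv T u t = d t" if "t \<in> {0..T}" "t \<notin> N" for t
    using der[OF that] that T by (intro vector_derivative_within_closed_interval) auto
  show "AE t in lebesgue_on {0..T}. u differentiable (at t within {0..T})"
    unfolding AE_lebesgue_on_iff_negligible using N(1) der by (blast intro: differentiableI_vector)
  fix a b assume ab: "0 \<le> a" "a \<le> b" "b \<le> T"
  have "(d has_integral (u b - u a)) {a..b}" using d[OF ab(2)] ab by (simp add: U_def)
  then show "(tderiv T u has_integral (u b - u a)) {a..b}"
    by (rule has_integral_spike[OF N(1), rotated]) (use td ab in auto)
qed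

lemma has_vector_derivative_norm_le_lipschitz:
  fixes u :: "real \<Rightarrow> 'a::real_normed_vector"
  assumes T: "T > 0" and lip: "C-lipschitz_on {0..T} u" and t: "t \<in> {0..T}"
    and der: "(u has_vector_derivative D) (at t within {0..T})"
  shows "norm D \<le> C"
proof (rule field_le_epsilon)
  fix e :: real assume e: "e > 0"
  obtain d where d: "d > 0" "\<And>y. y \<in> {0..T} \<Longrightarrow> norm (y - t) < d \<Longrightarrow>
      norm (u y - u t - (y - t) *\<^sub>R D) \<le> e * norm (y - t)"
    using der e unfolding has_vector_derivative_def has_derivative_within_alt by blast
  obtain y where y: "y \<in> {0..T}" "y \<noteq> t" "norm (y - t) < d"
  proof (cases "t < T")
    case True
    show thesis by (rule that[of "t + min (d/2) (T - t)"]) (use True d t in auto)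
  next
    case False
    show thesis by (rule that[of "t - min (d/2) T"]) (use False d t T in auto)
  qed
  have "\<bar>y - t\<bar> * norm D = norm ((u y - u t) - (u y - u t - (y - t) *\<^sub>R D))" by simp
  also have "\<dots> \<le> norm (u y - u t) + norm (u y - u t - (y - t) *\<^sub>R D)" by (rule norm_triangle_ineq4)
  also have "\<dots> \<le> C * \<bar>y - t\<bar> + e * \<bar>y - t\<bar>"
    using lipschitz_onD[OF lip y(1) t] d(2)[OF y(1,3)] by (simp add: dist_norm)
  finally have "\<bar>y - t\<bar> * norm D \<le> \<bar>y - t\<bar> * (C + e)" by (simp add: algebra_simps)
  then show "norm D \<le> C + e" using y(2) by simp
qed

lemma lipschitz_on_intervalI:
  fixes u :: "real \<Rightarrow> 'a::real_normed_vector"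
  assumes C: "C \<ge> 0" and *: "\<And>x y. 0 \<le> x \<Longrightarrow> x \<le> y \<Longrightarrow> y \<le> T \<Longrightarrow> norm (u y - u x) \<le> C * (y - x)"
  shows "C-lipschitz_on {0..T} u"
proof (rule lipschitz_onI[OF _ C])
  fix x y assume "x \<in> {0..T}" "y \<in> {0..T}"
  then show "dist (u x) (u y) \<le> C * dist x y"
    using *[of x y] *[of y x]
    by (cases "x \<le> y") (auto simp: dist_norm dist_real_def norm_minus_commute)
qed

text \<open>
  Used for the cells of a partition, which contain \<open>t\<close> without having it as an end point.
\<close>

lemma straddling_quotient_tendsto:
  fixes u :: "real \<Rightarrow> 'b::real_normed_vector"
  assumes der: "(u has_vector_derivative D) (at t within {0..T})"
    and a: "\<And>k. 0 \<le> a k" "\<And>k. a k \<le> t" and b: "\<And>k. t \<le> b k" "\<And>k. b k \<le> T"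
    and lt: "\<And>k. a k < b k" and lim: "(\<lambda>k. b k - a k) \<longlonglongrightarrow> 0"
  shows "(\<lambda>k. (u (b k) - u (a k)) /\<^sub>R (b k - a k)) \<longlonglongrightarrow> D"
proof (rule LIMSEQ_I)
  fix e :: real assume e: "e > 0"
  obtain d where d: "d > 0" "\<And>y. y \<in> {0..T} \<Longrightarrow> norm (y - t) < d \<Longrightarrow>
      norm (u y - u t - (y - t) *\<^sub>R D) \<le> (e/2) * norm (y - t)"
    using der half_gt_zero[OF e] unfolding has_vector_derivative_def has_derivative_within_alt by blast
  obtain N where N: "\<And>k. k \<ge> N \<Longrightarrow> norm (b k - a k - 0) < d"
    using LIMSEQ_D[OF lim d(1)] by blast
  show "\<exists>N. \<forall>k\<ge>N. norm ((u (b k) - u (a k)) /\<^sub>R (b k - a k) - D) < e"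
  proof (intro exI[of _ N] allI impI)
    fix k assume "N \<le> k"
    from N[OF this] have small: "b k - a k < d" by simp
    have rng: "a k \<in> {0..T}" "b k \<in> {0..T}"
      using a[of k] b[of k] by auto
    define h where "h = b k - a k"
    have h: "h > 0" using lt[of k] by (simp add: h_def)
    have "norm ((u (b k) - u (a k)) - h *\<^sub>R D)
      = norm ((u (b k) - u t - (b k - t) *\<^sub>R D) - (u (a k) - u t - (a k - t) *\<^sub>R D))"
      by (simp add: h_def algebra_simps)
    also have "\<dots> \<le> norm (u (b k) - u t - (b k - t) *\<^sub>R D) + norm (u (a k) - u t - (a k - t) *\<^sub>R D)"
      by (rule norm_triangle_ineq4)
    also have "\<dots> \<le> (e/2) * norm (b k - t) + (e/2) * norm (a k - t)"
      using rng a[of k] b[of k] small by (intro add_mono d(2)) auto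
    also have "\<dots> = (e/2) * h" using a[of k] b[of k] by (simp add: h_def flip: distrib_left)
    finally have 1: "norm ((u (b k) - u (a k)) - h *\<^sub>R D) \<le> (e/2) * h" .
    have "(u (b k) - u (a k)) /\<^sub>R h - D = ((u (b k) - u (a k)) - h *\<^sub>R D) /\<^sub>R h"
      using h by (simp add: algebra_simps)
    then have "norm ((u (b k) - u (a k)) /\<^sub>R h - D) = norm ((u (b k) - u (a k)) - h *\<^sub>R D) / h"
      using h by (simp add: divide_inverse mult.commute)
    also have "\<dots> \<le> e / 2" using 1 h by (simp add: divide_le_eq)
    finally show "norm ((u (b k) - u (a k)) /\<^sub>R (b k - a k) - D) < e" using e by (simp add: h_def)
  qed
qed

section \<open>Integrals over a compact interval\<close>

lemma has_integral_norm_bound_AE: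
  fixes f :: "real \<Rightarrow> 'a::euclidean_space"
  assumes "(f has_integral I) {a..b}" "a \<le> b" "0 \<le> a" "b \<le> T" "C \<ge> 0"
    and AE: "AE t in lebesgue_on {0..T}. norm (f t) \<le> C"
  shows "norm I \<le> C * (b - a)"
proof -
  obtain N where neg: "negligible N" and N: "\<And>t. t \<in> {0..T} - N \<Longrightarrow> norm (f t) \<le> C"
    using AE unfolding AE_lebesgue_on_iff_negligible by blast
  have "((\<lambda>t. if t \<in> N then 0 else f t) has_integral I) (cbox a b)"
    unfolding cbox_interval by (rule has_integral_spike[OF neg _ assms(1)]) auto
  then have "norm I \<le> C * measure lborel (cbox a b)"
  proof (rule has_integral_bound[rotated])
    fix t assume "t \<in> cbox a b"
    then show "norm (if t \<in> N then 0 else f t) \<le> C"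
      using assms(3-5) N[of t] by auto
  qed (use assms in auto)
  then show ?thesis using assms by simp
qed

text \<open>
  Completeness of Lebesgue measure, needed because \<open>tderiv\<close> is an arbitrary value wherever the
  derivative does not exist.
\<close>

lemma measurable_lebesgue_on_AE:
  fixes f g :: "real \<Rightarrow> 'b::euclidean_space"
  assumes f: "f \<in> borel_measurable (lebesgue_on {0..T})" and ae: "AE t in lebesgue_on {0..T}. f t = g t"
  shows "g \<in> borel_measurable (lebesgue_on {0..T})"
proof -
  have "(\<lambda>t. if t \<in> {0..T} then f t else 0) \<in> borel_measurable lebesgue"
    using f by (subst borel_measurable_if) auto
  moreover have "AE t in lebesgue. (if t \<in> {0..T} then f t else 0) = (if t \<in> {0..T} then g t else 0)"
    using ae by (auto simp: AE_restrict_space_iff elim!: eventually_mono)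
  ultimately have "(\<lambda>t. if t \<in> {0..T} then g t else 0) \<in> borel_measurable lebesgue"
    by (rule borel_measurable_AE)
  then show ?thesis by (subst (asm) borel_measurable_if) auto
qed

lemma AE_bounded_integrable:
  fixes f :: "real \<Rightarrow> 'b::euclidean_space"
  assumes "f \<in> borel_measurable (lebesgue_on {0..T})" "AE t in lebesgue_on {0..T}. norm (f t) \<le> B"
  shows "integrable (lebesgue_on {0..T}) f"
proof -
  have "integrable (lebesgue_on {0..T}) (\<lambda>_. B)" by simp
  then show ?thesis by (rule Bochner_Integration.integrable_bound) (use assms in \<open>auto elim!: eventually_mono\<close>)
qed

lemma continuous_lebesgue_on_integrable:
  fixes f :: "real \<Rightarrow> 'b::euclidean_space"
  assumes "continuous_on {0..T} f" shows "integrable (lebesgue_on {0..T}) f"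
proof -
  have m: "f \<in> borel_measurable (lebesgue_on {0..T})"
    using assms by (intro continuous_imp_measurable_on_sets_lebesgue) auto
  obtain B where "\<forall>x\<in>{0..T}. norm (f x) \<le> B"
    using compact_imp_bounded[OF compact_continuous_image[OF assms]] by (auto simp: bounded_iff)
  then show ?thesis by (intro AE_bounded_integrable[OF m, of B] AE_I2) auto
qed

lemma continuous_ball_bound:
  fixes u :: "real \<Rightarrow> 'b::real_normed_vector"
  assumes "continuous_on {0..T} u"
  obtains r where "r > 0" "\<And>t. t \<in> {0..T} \<Longrightarrow> u t \<in> ball 0 r"
proof -
  obtain B where "\<forall>x\<in>{0..T}. norm (u x) \<le> B"
    using compact_imp_bounded[OF compact_continuous_image[OF assms]] by (auto simp: bounded_iff)
  then have "u t \<in> ball 0 (\<bar>B\<bar> + 1)" if "t \<in> {0..T}" for t using that by fastforce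
  then show thesis by (intro that[of "\<bar>B\<bar> + 1"]) auto
qed

lemma integrable_inner_continuous:
  fixes e v :: "real \<Rightarrow> 'b::euclidean_space"
  assumes e: "integrable (lebesgue_on {0..T}) e" and v: "continuous_on {0..T} v"
  shows "integrable (lebesgue_on {0..T}) (\<lambda>t. e t \<bullet> v t)"
proof -
  obtain R where R: "R > 0" "\<And>t. t \<in> {0..T} \<Longrightarrow> v t \<in> ball 0 R"
    using continuous_ball_bound[OF v] by metis
  show ?thesis
  proof (rule Bochner_Integration.integrable_bound)
    show "integrable (lebesgue_on {0..T}) (\<lambda>t. norm (e t) * R)" using e by simp
    show "(\<lambda>t. e t \<bullet> v t) \<in> borel_measurable (lebesgue_on {0..T})"
      using e by (intro borel_measurable_inner continuous_imp_measurable_on_sets_lebesgue[OF v]) auto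
    show "AE t in lebesgue_on {0..T}. norm (e t \<bullet> v t) \<le> norm (norm (e t) * R)"
      using AE_lebesgue_on_mem[of T]
    proof eventually_elim
      case (elim t)
      have "norm (e t \<bullet> v t) \<le> norm (e t) * norm (v t)" using Cauchy_Schwarz_ineq2 by auto
      also have "\<dots> \<le> norm (e t) * R" using R(2)[OF elim] by (intro mult_left_mono) auto
      finally show ?case using R(1) by simp
    qed
  qed
qed

lemma continuous_level_AE:
  fixes h :: "real \<Rightarrow> real"
  assumes T: "T > 0" and h: "continuous_on {0..T} h" and ae: "AE t in lebesgue_on {0..T}. h t = \<gamma>" and t: "t \<in> {0..T}"
  shows "h t = \<gamma>"
proof -
  define U where "U = {0<..<T} \<inter> h -` (- {\<gamma>})"
  have "open U"
    unfolding U_def using h by (intro continuous_open_preimage continuous_on_subset[OF h]) auto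
  moreover have "negligible U"
  proof -
    obtain N where "negligible N" "\<And>t. t \<in> {0..T} - N \<Longrightarrow> h t = \<gamma>"
      using ae unfolding AE_lebesgue_on_iff_negligible by blast
    moreover from this have "U \<subseteq> N" unfolding U_def by force
    ultimately show ?thesis by (blast intro: negligible_subset)
  qed
  ultimately have "U = {}" using open_not_negligible by blast
  then have "\<And>s. s \<in> {0<..<T} \<Longrightarrow> h s = \<gamma>" by (auto simp: U_def)
  moreover have "closure {0<..<T} = {0..T}" using T by simp
  ultimately show ?thesis using continuous_constant_on_closure[of "{0<..<T}" h \<gamma> t] h t by simp
qed

lemma lebesgue_on_integrable_on_subinterval:
  fixes e :: "real \<Rightarrow> 'b::euclidean_space"
  assumes "integrable (lebesgue_on {0..T}) e" "0 \<le> a" "b \<le> T"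
  shows "e integrable_on {a..b}"
proof -
  have "e integrable_on {0..T}"
    using has_integral_integral_lebesgue_on[OF assms(1)] by (auto intro: has_integral_integrable)
  then show ?thesis by (rule Henstock_Kurzweil_Integration.integrable_on_subinterval) (use assms in auto)
qed

lemma lebesgue_on_eq_integral:
  fixes e :: "real \<Rightarrow> 'b::euclidean_space"
  assumes "integrable (lebesgue_on {0..T}) e"
  shows "integral\<^sup>L (lebesgue_on {0..T}) e = integral {0..T} e"
  using assms by (intro lebesgue_integral_eq_integral) auto

lemma integral_increment:
  fixes e :: "real \<Rightarrow> 'b::euclidean_space"
  assumes "integrable (lebesgue_on {0..T}) e" "0 \<le> a" "a \<le> b" "b \<le> T"
  shows "integral {0..b} e - integral {0..a} e = integral {a..b} e"
  using Henstock_Kurzweil_Integration.integral_combine[of 0 a b e] assms lebesgue_on_integrable_on_subinterval[OF assms(1), of 0 b]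
  by (simp add: algebra_simps)

lemma integral_uniform_partition:
  fixes f :: "real \<Rightarrow> 'b::euclidean_space"
  assumes f: "f integrable_on {0..T}" and \<delta>: "0 \<le> \<delta>" "real n * \<delta> \<le> T"
  shows "integral {0..real n * \<delta>} f = (\<Sum>i<n. integral {real i * \<delta>..real (Suc i) * \<delta>} f)"
  using \<delta>(2)
proof (induction n)
  case (Suc n)
  have le: "real n * \<delta> \<le> real (Suc n) * \<delta>" using \<delta> by (intro mult_right_mono) auto
  have "integral {0..real n * \<delta>} f + integral {real n * \<delta>..real (Suc n) * \<delta>} f = integral {0..real (Suc n) * \<delta>} f"
    using le Suc.prems \<delta> f
    by (intro Henstock_Kurzweil_Integration.integral_combine) (auto intro: Henstock_Kurzweil_Integration.integrable_on_subinterval)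
  then show ?case using Suc.IH Suc.prems le by simp
qed simp

lemma continuous_indefinite_integral:
  fixes e :: "real \<Rightarrow> 'b::euclidean_space"
  assumes "integrable (lebesgue_on {0..T}) e"
  shows "continuous_on {0..T} (\<lambda>t. integral {0..t} e)"
  using assms by (intro indefinite_integral_continuous_1 lebesgue_on_integrable_on_subinterval) auto

lemma indefinite_integral_derivative_ae:
  fixes e :: "real \<Rightarrow> 'b::euclidean_space"
  assumes "integrable (lebesgue_on {0..T}) e"
  shows "AE t in lebesgue_on {0..T}.
    ((\<lambda>s. integral {0..s} e) has_vector_derivative e t) (at t within {0..T})"
proof -
  define e0 where "e0 t = (if t \<in> {0..T} then e t else 0)" for t
  have "e integrable_on {0..T}" using assms by (intro lebesgue_on_integrable_on_subinterval) auto
  then have "e0 integrable_on UNIV" unfolding e0_def by (simp only: integrable_restrict_UNIV)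
  then have "e0 integrable_on {a..b}" for a b
    using integrable_on_subcbox[of e0 UNIV a b] by (simp add: cbox_interval)
  then obtain N where N: "negligible N"
    "\<And>a x. x \<notin> N \<Longrightarrow> a < x \<Longrightarrow> ((\<lambda>s. integral {a..s} e0) has_vector_derivative e0 x) (at x)"
    using lebesgue_differentiation by blast
  have "((\<lambda>s. integral {0..s} e) has_vector_derivative e t) (at t within {0..T})"
    if t: "t \<in> {0..T} - (N \<union> {0})" for t
  proof -
    have "((\<lambda>s. integral {0..s} e0) has_vector_derivative e0 t) (at t)"
      using N(2)[of t 0] t by simp
    then have "((\<lambda>s. integral {0..s} e0) has_vector_derivative e0 t) (at t within {0..T})"
      by (rule has_vector_derivative_at_within)
    then have "((\<lambda>s. integral {0..s} e) has_vector_derivative e0 t) (at t within {0..T})"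
    proof (rule has_vector_derivative_transform[rotated 2])
      fix s assume s: "s \<in> {0..T}"
      show "integral {0..s} e = integral {0..s} e0"
        using s by (intro Henstock_Kurzweil_Integration.integral_cong) (auto simp: e0_def)
    qed (use t in auto)
    then show ?thesis using t by (simp add: e0_def)
  qed
  moreover have "negligible (N \<union> {0})" using N(1) by simp
  ultimately show ?thesis unfolding AE_lebesgue_on_iff_negligible by blast
qed

text \<open>
  The part of \<open>norm e\<close> above height \<open>n\<close>; bounding \<open>e\<close> by \<open>n\<close> up to this part yields absolute continuity
  of its integral.
\<close>

lemma integral_excess_tendsto_0:
  fixes e :: "real \<Rightarrow> 'b::euclidean_space"
  assumes e: "integrable (lebesgue_on {0..T}) e"
  shows "(\<lambda>n. LINT t|lebesgue_on {0..T}. norm (e t) - min (norm (e t)) (real n)) \<longlonglongrightarrow> 0"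
proof -
  have "(\<lambda>n. LINT t|lebesgue_on {0..T}. norm (e t) - min (norm (e t)) (real n))
      \<longlonglongrightarrow> (LINT t|lebesgue_on {0..T}. 0)"
  proof (rule integral_dominated_convergence)
    show "integrable (lebesgue_on {0..T}) (\<lambda>t. norm (e t))" using e by simp
    have [measurable]: "e \<in> borel_measurable (lebesgue_on {0..T})" using e by auto
    show "(\<lambda>t. norm (e t) - min (norm (e t)) (real n)) \<in> borel_measurable (lebesgue_on {0..T})" for n
      by measurable
    show "AE t in lebesgue_on {0..T}. (\<lambda>n. norm (e t) - min (norm (e t)) (real n)) \<longlonglongrightarrow> 0"
    proof (rule AE_I2)
      fix t
      obtain N :: nat where "norm (e t) \<le> real N" using real_arch_simple by blast
      then have "\<forall>\<^sub>F n in sequentially. norm (e t) - min (norm (e t)) (real n) = 0"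
        by (auto simp: eventually_sequentially intro!: exI[of _ N])
      then show "(\<lambda>n. norm (e t) - min (norm (e t)) (real n)) \<longlonglongrightarrow> 0"
        by (rule tendsto_eventually)
    qed
  qed auto
  then show ?thesis by simp
qed

theorem indefinite_integral_abs_continuous:
  fixes e f :: "real \<Rightarrow> 'b::euclidean_space"
  assumes e: "integrable (lebesgue_on {0..T}) e"
    and f: "\<And>t. t \<in> {0..T} \<Longrightarrow> f t = integral {0..t} e + a"
  shows "abs_continuous_on {0..T} f"
  unfolding abs_continuous_on_def
proof (intro allI impI)
  fix \<epsilon> :: real assume \<epsilon>: "\<epsilon> > 0"
  \<comment> \<open>\<open>norm (e t) \<le> n + r n t\<close>, where \<open>r n\<close> has small integral for large \<open>n\<close>.\<close>
  define r where "r n t = norm (e t) - min (norm (e t)) (real n)" for n t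
  have rI: "integrable (lebesgue_on {0..T}) (r n)" for n
    unfolding r_def using e by (intro Bochner_Integration.integrable_diff integrable_min) auto
  have "\<forall>\<^sub>F n in sequentially. (LINT t|lebesgue_on {0..T}. r n t) < \<epsilon> / 2"
    using order_tendstoD(2)[OF integral_excess_tendsto_0[OF e], of "\<epsilon> / 2"] \<epsilon> by (simp add: r_def)
  then obtain n where n: "integral {0..T} (r n) < \<epsilon> / 2"
    using lebesgue_on_eq_integral[OF rI] by (auto simp: eventually_sequentially)
  show "\<exists>\<delta>>0. \<forall>\<D> A. \<D> division_of A \<and> A \<subseteq> {0..T} \<and> (\<Sum>I\<in>\<D>. measure lborel I) < \<delta> \<longrightarrow>
        (\<Sum>I\<in>\<D>. norm (f (Sup I) - f (Inf I))) < \<epsilon>"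
  proof (intro exI[of _ "\<epsilon> / (2 * (real n + 1))"] conjI allI impI)
    show "\<epsilon> / (2 * (real n + 1)) > 0" using \<epsilon> by simp
    fix \<D> A assume *: "\<D> division_of A \<and> A \<subseteq> {0..T} \<and> (\<Sum>I\<in>\<D>. measure lborel I) < \<epsilon> / (2 * (real n + 1))"
    have rint: "r n integrable_on {0..T}" using rI by (intro lebesgue_on_integrable_on_subinterval) auto
    have rA: "r n integrable_on A" using * rint by (auto intro: integrable_on_subdivision)
    have "(\<Sum>I\<in>\<D>. norm (f (Sup I) - f (Inf I)))
        \<le> (\<Sum>I\<in>\<D>. real n * measure lborel I + integral I (r n))"
    proof (rule sum_mono)
      fix I assume I: "I \<in> \<D>"
      then have sub: "I \<subseteq> {0..T}" and ne: "I \<noteq> {}" and "\<exists>c d. I = cbox c d"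
        using division_ofD(2,3,4)[OF conjunct1[OF *] I] * by blast+
      then obtain c d where cd: "I = {c..d}" "c \<le> d" by auto
      then have bds: "0 \<le> c" "d \<le> T" using sub by auto
      have "norm (integral {0..d} e - integral {0..c} e) = norm (integral {c..d} e)"
        using integral_increment[OF e bds(1) cd(2) bds(2)] by simp
      also have "\<dots> \<le> integral {c..d} (\<lambda>t. real n + r n t)"
        using e rI bds by (intro integral_norm_bound_integral lebesgue_on_integrable_on_subinterval integrable_add integrable_on_const)
          (auto simp: r_def)
      also have "\<dots> = real n * measure lborel I + integral I (r n)"
        using rI bds cd by (subst Henstock_Kurzweil_Integration.integral_add)
          (auto intro: lebesgue_on_integrable_on_subinterval simp: mult.commute)
      finally show "norm (f (Sup I) - f (Inf I)) \<le> real n * measure lborel I + integral I (r n)"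
        using cd bds f[of c] f[of d] by simp
    qed
    also have "\<dots> = real n * (\<Sum>I\<in>\<D>. measure lborel I) + (\<Sum>I\<in>\<D>. integral I (r n))"
      by (simp add: sum.distrib sum_distrib_left)
    also have "(\<Sum>I\<in>\<D>. integral I (r n)) = integral A (r n)"
      using integral_combine_division_topdown[of "r n" A \<D>] rA * by auto
    also have "integral A (r n) \<le> integral {0..T} (r n)"
      using * rA rint by (intro integral_subset_le) (auto simp: r_def)
    also have "real n * (\<Sum>I\<in>\<D>. measure lborel I) \<le> real n * (\<epsilon> / (2 * (real n + 1)))"
      using * by (intro mult_left_mono) auto
    also have "real n * (\<epsilon> / (2 * (real n + 1))) \<le> \<epsilon> / 2"
      using \<epsilon> by (simp add: divide_simps)
    finally show "(\<Sum>I\<in>\<D>. norm (f (Sup I) - f (Inf I))) < \<epsilon>"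
      using n by simp
  qed
qed

section \<open>Potentials with integrable gradient bounds\<close>

text \<open>
  The class \<open>class_B\<close> with the supremum over a ball replaced by an integrable majorant that is valid for
  almost every \<open>t\<close>.  In this form the class is visibly a vector space, and it contains \<open>\<alpha>(t) H(x)\<close> for \<open>\<alpha>\<close>
  bounded only almost everywhere.
\<close>

definition admissible :: "real \<Rightarrow> (real \<Rightarrow> real^'n \<Rightarrow> real) \<Rightarrow> bool" where
  "admissible T P \<longleftrightarrow>
     (\<forall>x. (\<lambda>t. P t x) \<in> borel_measurable (lebesgue_on {0..T})) \<and>
     (\<forall>t\<in>{0..T}. C1_on UNIV (P t)) \<and>
     (\<forall>x. (\<lambda>t. gradient (P t) x) \<in> borel_measurable (lebesgue_on {0..T})) \<and>
     (\<forall>r>0. \<exists>m. integrable (lebesgue_on {0..T}) m \<and>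
        (AE t in lebesgue_on {0..T}. \<forall>x\<in>ball 0 r. norm (gradient (P t) x) \<le> m t)) \<and>
     integrable (lebesgue_on {0..T}) (\<lambda>t. P t 0)"

lemma C1_on_continuous_gradient: "C1_on UNIV f \<Longrightarrow> continuous_on UNIV (gradient f)"
  by (simp add: C1_on_def)

lemma C1_on_GDERIV:
  fixes f :: "'a::euclidean_space \<Rightarrow> real"
  shows "C1_on S f \<Longrightarrow> x \<in> S \<Longrightarrow> GDERIV f x :> gradient f x"
  by (auto simp: C1_on_def intro: GDERIV_gradient)

lemma GDERIV_directional:
  fixes f :: "'a::real_inner \<Rightarrow> real"
  assumes "GDERIV f x :> D"
  shows "((\<lambda>s. (f (x + s *\<^sub>R h) - f x) / s) \<longlongrightarrow> D \<bullet> h) (at 0)"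
proof -
  have 1: "(f has_derivative (\<lambda>h. h \<bullet> D)) (at (x + 0 *\<^sub>R h))" using assms by (simp add: gderiv_def)
  have 2: "((\<lambda>s. x + s *\<^sub>R h) has_derivative (\<lambda>s. s *\<^sub>R h)) (at 0)"
    by (auto intro!: derivative_eq_intros)
  have "((\<lambda>s. f (x + s *\<^sub>R h)) has_derivative (\<lambda>s. (s *\<^sub>R h) \<bullet> D)) (at 0)"
    using diff_chain_at[OF 2 1] by (simp add: o_def)
  then have "((\<lambda>s. f (x + s *\<^sub>R h)) has_field_derivative (D \<bullet> h)) (at 0)"
    by (simp add: has_field_derivative_def inner_commute mult.commute[of "_ \<bullet> _"] mult_commute_abs)
  then show ?thesis by (simp add: has_field_derivative_iff)
qed

lemma C1_onI:
  fixes f :: "'a::euclidean_space \<Rightarrow> real"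
  assumes "\<And>x. GDERIV f x :> D x" "continuous_on UNIV D"
  shows "C1_on UNIV f" "gradient f = D"
proof -
  show g: "gradient f = D" using gradient_eqI[OF assms(1)] by auto
  show "C1_on UNIV f" unfolding C1_on_def g
    using assms by (auto simp: gderiv_def differentiable_def)
qed

lemma C1_on_continuous:
  fixes f :: "'a::euclidean_space \<Rightarrow> real"
  assumes "C1_on UNIV f" shows "continuous_on UNIV f"
  using assms by (auto simp: C1_on_def intro!: continuous_at_imp_continuous_on differentiable_imp_continuous_within)

lemma class_B_admissible:
  assumes F: "F \<in> class_B T" shows "admissible T F"
proof -
  have "\<exists>m. integrable (lebesgue_on {0..T}) m \<and>
        (AE t in lebesgue_on {0..T}. \<forall>x\<in>ball 0 r. norm (gradient (F t) x) \<le> m t)" if "r > 0" for r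
  proof (intro exI conjI)
    show "integrable (lebesgue_on {0..T}) (\<lambda>t. SUP x\<in>ball 0 r. norm (gradient (F t) x))"
      using F that by (simp add: class_B_def)
    show "AE t in lebesgue_on {0..T}. \<forall>x\<in>ball 0 r. norm (gradient (F t) x) \<le> (SUP x\<in>ball 0 r. norm (gradient (F t) x))"
    proof (rule AE_I2, intro ballI)
      fix t and x :: "real^'a" assume t: "t \<in> space (lebesgue_on {0..T})" and x: "x \<in> ball 0 r"
      have "C1_on UNIV (F t)" using t F by (auto simp: class_B_def)
      then have "continuous_on (cball 0 r) (\<lambda>x. norm (gradient (F t) x))"
        by (intro continuous_on_norm continuous_on_subset[OF C1_on_continuous_gradient]) auto
      then have "bdd_above ((\<lambda>x. norm (gradient (F t) x)) ` cball 0 r)"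
        by (intro bounded_imp_bdd_above compact_imp_bounded compact_continuous_image) auto
      then have "bdd_above ((\<lambda>x. norm (gradient (F t) x)) ` ball 0 r)"
        by (rule bdd_above_mono) auto
      then show "norm (gradient (F t) x) \<le> (SUP x\<in>ball 0 r. norm (gradient (F t) x))"
        using x by (intro cSUP_upper)
    qed
  qed
  then show ?thesis using F by (auto simp: class_B_def admissible_def)
qed

lemma admissible_add_cmult:
  assumes P: "admissible T P" and Q: "admissible T Q"
  shows "admissible T (\<lambda>t x. P t x + c * Q t x)"
proof -
  have D: "GDERIV (\<lambda>x. P t x + c * Q t x) x :> gradient (P t) x + c *\<^sub>R gradient (Q t) x" if "t \<in> {0..T}" for t x
  proof -
    have "GDERIV (P t) x :> gradient (P t) x" "GDERIV (Q t) x :> gradient (Q t) x"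
      using that P Q by (auto simp: admissible_def intro!: C1_on_GDERIV[of UNIV])
    from GDERIV_add[OF this(1) GDERIV_mult[OF GDERIV_const[of c] this(2)]] show ?thesis by simp
  qed
  have c: "continuous_on UNIV (\<lambda>x. gradient (P t) x + c *\<^sub>R gradient (Q t) x)" if "t \<in> {0..T}" for t
    using that P Q by (intro continuous_intros C1_on_continuous_gradient) (auto simp: admissible_def)
  note * = C1_onI[OF D c]
  have g: "gradient (\<lambda>x. P t x + c * Q t x) x = gradient (P t) x + c *\<^sub>R gradient (Q t) x" if "t \<in> {0..T}" for t x
    using *(2)[OF that that] by simp
  show "admissible T (\<lambda>t x. P t x + c * Q t x)"
    unfolding admissible_def
  proof (intro conjI allI ballI impI)
    fix x
    show "(\<lambda>t. P t x + c * Q t x) \<in> borel_measurable (lebesgue_on {0..T})"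
      using P Q by (intro borel_measurable_add borel_measurable_times borel_measurable_scaleR) (auto simp: admissible_def)
    have "(\<lambda>t. gradient (P t) x + c *\<^sub>R gradient (Q t) x) \<in> borel_measurable (lebesgue_on {0..T})"
      using P Q by (intro borel_measurable_add borel_measurable_times borel_measurable_scaleR) (auto simp: admissible_def)
    then show "(\<lambda>t. gradient (\<lambda>x. P t x + c * Q t x) x) \<in> borel_measurable (lebesgue_on {0..T})"
      by (subst measurable_lebesgue_cong[OF g]) auto
  next
    fix r :: real assume r: "r > 0"
    obtain m where m: "integrable (lebesgue_on {0..T}) m"
      "AE t in lebesgue_on {0..T}. \<forall>x\<in>ball 0 r. norm (gradient (P t) x) \<le> m t"
      using P r unfolding admissible_def by blast
    obtain n where n: "integrable (lebesgue_on {0..T}) n"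
      "AE t in lebesgue_on {0..T}. \<forall>x\<in>ball 0 r. norm (gradient (Q t) x) \<le> n t"
      using Q r unfolding admissible_def by blast
    show "\<exists>m. integrable (lebesgue_on {0..T}) m \<and>
        (AE t in lebesgue_on {0..T}. \<forall>x\<in>ball 0 r. norm (gradient (\<lambda>x. P t x + c * Q t x) x) \<le> m t)"
    proof (intro exI conjI)
      show "integrable (lebesgue_on {0..T}) (\<lambda>t. m t + \<bar>c\<bar> * n t)" using m n by simp
      show "AE t in lebesgue_on {0..T}. \<forall>x\<in>ball 0 r. norm (gradient (\<lambda>x. P t x + c * Q t x) x) \<le> m t + \<bar>c\<bar> * n t"
        using m(2) n(2) AE_lebesgue_on_mem[of T]
      proof eventually_elim
        case (elim t)
        then show ?case using g[of t] by (auto intro!: norm_triangle_le add_mono mult_left_mono)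
      qed
    qed
  next
    show "integrable (lebesgue_on {0..T}) (\<lambda>t. P t 0 + c * Q t 0)"
      using P Q by (auto simp: admissible_def)
  qed (use * in auto)
qed

lemma admissible_weight:
  fixes H :: "real^'n \<Rightarrow> real"
  assumes \<beta>: "\<beta> \<in> Linfty T" and H: "C1_on UNIV H"
  shows "admissible T (\<lambda>t x. \<beta> t * (H x - \<gamma>))"
proof -
  have D: "GDERIV (\<lambda>x. \<beta> t * (H x - \<gamma>)) x :> \<beta> t *\<^sub>R gradient H x" for t x
  proof -
    have "GDERIV (\<lambda>x. H x - \<gamma>) x :> gradient H x - 0"
      using H by (intro GDERIV_diff GDERIV_const C1_on_GDERIV) auto
    from GDERIV_mult[OF GDERIV_const[of "\<beta> t"] this] show ?thesis by simp
  qed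
  have c: "continuous_on UNIV (\<lambda>x. \<beta> t *\<^sub>R gradient H x)" for t
    using H by (intro continuous_intros C1_on_continuous_gradient)
  note * = C1_onI[OF D c]
  obtain C where C: "AE t in lebesgue_on {0..T}. \<bar>\<beta> t\<bar> \<le> C" and
    bm: "\<beta> \<in> borel_measurable (lebesgue_on {0..T})" using \<beta> by (auto simp: Linfty_def)
  have I: "integrable (lebesgue_on {0..T}) \<beta>"
  proof (rule Bochner_Integration.integrable_bound)
    show "integrable (lebesgue_on {0..T}) (\<lambda>_. C)" by simp
    show "AE t in lebesgue_on {0..T}. norm (\<beta> t) \<le> norm C" using C by eventually_elim auto
  qed fact
  show ?thesis
    unfolding admissible_def *(2)
  proof (intro conjI allI ballI impI)
    fix r :: real assume r: "r > 0"
    have "bounded (gradient H ` cball 0 r)"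
      using H by (intro compact_imp_bounded compact_continuous_image continuous_on_subset[OF C1_on_continuous_gradient]) auto
    then obtain B where B: "\<forall>x\<in>cball 0 r. norm (gradient H x) \<le> B"
      by (auto simp: bounded_iff)
    show "\<exists>m. integrable (lebesgue_on {0..T}) m \<and>
        (AE t in lebesgue_on {0..T}. \<forall>x\<in>ball 0 r. norm (\<beta> t *\<^sub>R gradient H x) \<le> m t)"
      by (rule exI[of _ "\<lambda>t. \<bar>\<beta> t\<bar> * B"]) (use I B in \<open>auto intro!: AE_I2 mult_left_mono\<close>)
  qed (use * bm I in auto)
qed

text \<open>
  Replace \<open>t\<close> inside \<open>u\<close> by its truncation to a grid: the composite is then glued from countably many
  measurable functions \<open>t \<mapsto> g t x\<close>, and it converges by continuity of \<open>g t\<close> and \<open>u\<close>.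
\<close>

lemma caratheodory_measurable:
  fixes g :: "real \<Rightarrow> 'a::metric_space \<Rightarrow> 'b::euclidean_space"
  assumes g: "\<And>x. (\<lambda>t. g t x) \<in> borel_measurable (lebesgue_on {0..T})"
    and c: "\<And>t. t \<in> {0..T} \<Longrightarrow> continuous_on UNIV (g t)"
    and u: "continuous_on {0..T} u"
  shows "(\<lambda>t. g t (u t)) \<in> borel_measurable (lebesgue_on {0..T})"
proof (rule borel_measurable_LIMSEQ_metric)
  fix k :: nat
  have id: "(\<lambda>t. t) \<in> borel_measurable (lebesgue_on {0..T})"
    by (intro continuous_imp_measurable_on_sets_lebesgue continuous_intros) auto
  have "(\<lambda>t. real (Suc k) * t) \<in> borel_measurable (lebesgue_on {0..T})"
    using id by (intro borel_measurable_times) auto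
  then have fl: "(\<lambda>t. \<lfloor>real (Suc k) * t\<rfloor>) \<in> measurable (lebesgue_on {0..T}) (count_space UNIV)"
    by (rule measurable_compose) measurable
  show "(\<lambda>t. g t (u (of_int \<lfloor>real (Suc k) * t\<rfloor> / real (Suc k)))) \<in> borel_measurable (lebesgue_on {0..T})"
    by (rule measurable_compose_countable[where f="\<lambda>i t. g t (u (of_int i / real (Suc k)))", OF g fl])
next
  fix t assume "t \<in> space (lebesgue_on {0..T})"
  then have t: "t \<in> {0..T}" by simp
  \<comment> \<open>\<open>s k\<close> rounds \<open>t\<close> down to a multiple of \<open>1 / Suc k\<close>, so it takes countably many values.\<close>
  define s where "s k = real_of_int \<lfloor>real (Suc k) * t\<rfloor> / real (Suc k)" for k
  have s1: "s k \<le> t" for k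
  proof -
    have "real_of_int \<lfloor>real (Suc k) * t\<rfloor> \<le> real (Suc k) * t" by (rule of_int_floor_le)
    then show ?thesis by (simp add: s_def divide_le_eq mult.commute)
  qed
  have s4: "s k \<le> T" for k using s1[of k] t by simp
  have s2: "s k \<ge> 0" for k using t by (simp add: s_def)
  have s3: "t - 1 / real (Suc k) \<le> s k" for k
  proof -
    have "real (Suc k) * t - 1 \<le> real_of_int \<lfloor>real (Suc k) * t\<rfloor>" by linarith
    then have "(real (Suc k) * t - 1) / real (Suc k) \<le> s k"
      unfolding s_def by (intro divide_right_mono) auto
    then show ?thesis by (simp add: diff_divide_distrib del: of_nat_Suc)
  qed
  have "(\<lambda>k. t - 1 / real (Suc k)) \<longlonglongrightarrow> t - 0"
    by (intro tendsto_diff tendsto_const) (use LIMSEQ_inverse_real_of_nat in \<open>simp add: inverse_eq_divide\<close>)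
  then have lower: "(\<lambda>k. t - 1 / real (Suc k)) \<longlonglongrightarrow> t" by simp
  have "s \<longlonglongrightarrow> t"
    by (rule tendsto_sandwich[OF _ _ lower tendsto_const[of t]]) (use s1 s3 in \<open>simp_all del: of_nat_Suc\<close>)
  then have "(\<lambda>k. u (s k)) \<longlonglongrightarrow> u t"
    by (rule continuous_on_tendsto_compose[OF u]) (use t s4 s2 in auto)
  then show "(\<lambda>k. g t (u (of_int \<lfloor>real (Suc k) * t\<rfloor> / real (Suc k)))) \<longlonglongrightarrow> g t (u t)"
    unfolding s_def[symmetric] by (rule continuous_on_tendsto_compose[OF c[OF t]]) auto
qed

text \<open>
  The mean value inequality on a ball; one integrable function dominates both the gradients and the
  difference quotients.
\<close>

lemma admissible_lipschitz:
  assumes P: "admissible T P" and r: "r > 0"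
  obtains m where "integrable (lebesgue_on {0..T}) m"
    "AE t in lebesgue_on {0..T}. 0 \<le> m t \<and> (\<forall>x\<in>ball 0 r. norm (gradient (P t) x) \<le> m t) \<and>
      (\<forall>x\<in>ball 0 r. \<forall>y\<in>ball 0 r. \<bar>P t x - P t y\<bar> \<le> m t * norm (x - y))"
proof -
  obtain m where m: "integrable (lebesgue_on {0..T}) m"
      "AE t in lebesgue_on {0..T}. \<forall>x\<in>ball 0 r. norm (gradient (P t) x) \<le> m t"
      using P r unfolding admissible_def by blast
  show thesis
  proof (rule that[OF m(1)])
    show "AE t in lebesgue_on {0..T}. 0 \<le> m t \<and> (\<forall>x\<in>ball 0 r. norm (gradient (P t) x) \<le> m t) \<and>
      (\<forall>x\<in>ball 0 r. \<forall>y\<in>ball 0 r. \<bar>P t x - P t y\<bar> \<le> m t * norm (x - y))"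
      using m(2) AE_lebesgue_on_mem[of T]
    proof eventually_elim
      case (elim t)
      have "0 \<le> norm (gradient (P t) 0)" by simp
      also have "\<dots> \<le> m t" using elim(1) r by auto
      finally have m0: "0 \<le> m t" .
      have "\<bar>P t x - P t y\<bar> \<le> m t * norm (x - y)" if "x \<in> ball 0 r" "y \<in> ball 0 r" for x y
      proof -
        have "norm (P t x - P t y) \<le> m t * norm (x - y)"
        proof (rule differentiable_bound[OF convex_ball _ _ that])
          fix z assume z: "z \<in> ball (0::real^'a) r"
          show "(P t has_derivative (\<lambda>h. h \<bullet> gradient (P t) z)) (at z within ball 0 r)"
            using P elim(2) C1_on_GDERIV[of UNIV "P t" z]
            by (auto simp: admissible_def gderiv_def intro: has_derivative_at_withinI)
          show "onorm (\<lambda>h. h \<bullet> gradient (P t) z) \<le> m t"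
          proof (rule onorm_bound[OF m0])
            fix h
            have "norm (h \<bullet> gradient (P t) z) \<le> norm h * norm (gradient (P t) z)"
              using Cauchy_Schwarz_ineq2 by auto
            also have "\<dots> \<le> norm h * m t" using elim(1) z by (intro mult_left_mono) auto
            finally show "norm (h \<bullet> gradient (P t) z) \<le> m t * norm h" by (simp add: mult.commute)
          qed
        qed
        then show ?thesis by simp
      qed
      then show ?case using m0 elim(1) by blast
    qed
  qed
qed

lemma admissible_comp_measurable:
  assumes P: "admissible T P" and u: "continuous_on {0..T} u"
  shows "(\<lambda>t. P t (u t)) \<in> borel_measurable (lebesgue_on {0..T})"
    and "(\<lambda>t. gradient (P t) (u t)) \<in> borel_measurable (lebesgue_on {0..T})"
proof -
  show "(\<lambda>t. P t (u t)) \<in> borel_measurable (lebesgue_on {0..T})"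
    by (rule caratheodory_measurable[OF _ _ u]) (use P in \<open>auto simp: admissible_def C1_on_continuous\<close>)
  show "(\<lambda>t. gradient (P t) (u t)) \<in> borel_measurable (lebesgue_on {0..T})"
    by (rule caratheodory_measurable[OF _ _ u]) (use P in \<open>auto simp: admissible_def C1_on_continuous_gradient\<close>)
qed

lemma admissible_integrable:
  assumes P: "admissible T P" and u: "continuous_on {0..T} u"
  shows "integrable (lebesgue_on {0..T}) (\<lambda>t. P t (u t))"
    and "integrable (lebesgue_on {0..T}) (\<lambda>t. gradient (P t) (u t))"
proof -
  obtain r where r: "r > 0" "\<And>t. t \<in> {0..T} \<Longrightarrow> u t \<in> ball 0 r" using continuous_ball_bound[OF u] by metis
  obtain m where m: "integrable (lebesgue_on {0..T}) m"
    "AE t in lebesgue_on {0..T}. 0 \<le> m t \<and> (\<forall>x\<in>ball 0 r. norm (gradient (P t) x) \<le> m t) \<and>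
      (\<forall>x\<in>ball 0 r. \<forall>y\<in>ball 0 r. \<bar>P t x - P t y\<bar> \<le> m t * norm (x - y))"
    by (rule admissible_lipschitz[OF P r(1)])
  show "integrable (lebesgue_on {0..T}) (\<lambda>t. gradient (P t) (u t))"
  proof (rule Bochner_Integration.integrable_bound[OF m(1) admissible_comp_measurable(2)[OF P u]])
    show "AE t in lebesgue_on {0..T}. norm (gradient (P t) (u t)) \<le> norm (m t)"
      using m(2) AE_lebesgue_on_mem[of T] by eventually_elim (use r in force)
  qed
  show "integrable (lebesgue_on {0..T}) (\<lambda>t. P t (u t))"
  proof (rule Bochner_Integration.integrable_bound[OF _ admissible_comp_measurable(1)[OF P u]])
    show "integrable (lebesgue_on {0..T}) (\<lambda>t. \<bar>P t 0\<bar> + m t * r)"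
      using P m(1) by (auto simp: admissible_def)
    show "AE t in lebesgue_on {0..T}. norm (P t (u t)) \<le> norm (\<bar>P t 0\<bar> + m t * r)"
      using m(2) AE_lebesgue_on_mem[of T]
    proof eventually_elim
      case (elim t)
      have "u t \<in> ball 0 r" "0 \<in> ball (0::real^'a) r" using elim r by auto
      then have "\<bar>P t (u t) - P t 0\<bar> \<le> m t * norm (u t - 0)" using elim(1) by blast
      also have "\<dots> \<le> m t * r" using elim r(2)[of t] by (intro mult_left_mono) auto
      finally show ?case by simp
    qed
  qed
qed

lemma admissible_integral_tendsto:
  assumes P: "admissible T P" and u: "continuous_on {0..T} u"
    and uk: "\<And>k. continuous_on {0..T} (w k)"
    and r: "\<And>k t. t \<in> {0..T} \<Longrightarrow> norm (w k t) \<le> r"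
    and lim: "\<And>t. t \<in> {0..T} \<Longrightarrow> (\<lambda>k. w k t) \<longlonglongrightarrow> u t"
  shows "(\<lambda>k. LINT t|lebesgue_on {0..T}. P t (w k t)) \<longlonglongrightarrow> (LINT t|lebesgue_on {0..T}. P t (u t))"
proof -
  define R where "R = \<bar>r\<bar> + 1"
  have R: "R > 0" "w k t \<in> ball 0 R" if "t \<in> {0..T}" for k t
    using r[OF that, of k] by (auto simp: R_def)
  have R0: "R > 0" by (simp add: R_def)
  obtain m where m: "integrable (lebesgue_on {0..T}) m"
    "AE t in lebesgue_on {0..T}. 0 \<le> m t \<and> (\<forall>x\<in>ball 0 R. norm (gradient (P t) x) \<le> m t) \<and>
      (\<forall>x\<in>ball 0 R. \<forall>y\<in>ball 0 R. \<bar>P t x - P t y\<bar> \<le> m t * norm (x - y))"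
    by (rule admissible_lipschitz[OF P R0])
  show ?thesis
  proof (rule integral_dominated_convergence)
    show "integrable (lebesgue_on {0..T}) (\<lambda>t. \<bar>P t 0\<bar> + m t * R)"
      using P m(1) by (auto simp: admissible_def)
    show "AE t in lebesgue_on {0..T}. norm (P t (w k t)) \<le> \<bar>P t 0\<bar> + m t * R" for k
      using m(2) AE_lebesgue_on_mem[of T]
    proof eventually_elim
      case (elim t)
      have "w k t \<in> ball 0 R" "0 \<in> ball (0::real^'a) R" using elim R R0 by auto
      then have "\<bar>P t (w k t) - P t 0\<bar> \<le> m t * norm (w k t - 0)" using elim(1) by blast
      also have "\<dots> \<le> m t * R" using elim R(2)[of t k] by (intro mult_left_mono) auto
      finally show ?case by simp
    qed
    show "AE t in lebesgue_on {0..T}. (\<lambda>k. P t (w k t)) \<longlonglongrightarrow> P t (u t)"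
    proof (rule AE_I2)
      fix t assume "t \<in> space (lebesgue_on {0..T})"
      then have "t \<in> {0..T}" by simp
      then show "(\<lambda>k. P t (w k t)) \<longlonglongrightarrow> P t (u t)"
        using P lim C1_on_continuous[of "P t"]
        by (intro continuous_on_tendsto_compose[of UNIV "P t"]) (auto simp: admissible_def)
    qed
  qed (use P u uk admissible_comp_measurable in auto)
qed

text \<open>
  Differentiation under the integral sign: the difference quotients are dominated by the gradient bound
  on a ball that contains the segments from \<open>u t\<close> to \<open>u t + h t\<close>.
\<close>

lemma admissible_directional_derivative:
  assumes P: "admissible T P" and u: "continuous_on {0..T} u" and h: "continuous_on {0..T} h"
    and s: "\<And>k. 0 < s k" "\<And>k. s k \<le> 1" "s \<longlonglongrightarrow> (0::real)"
  shows "(\<lambda>k. LINT t|lebesgue_on {0..T}. (P t (u t + s k *\<^sub>R h t) - P t (u t)) / s k)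
    \<longlonglongrightarrow> (LINT t|lebesgue_on {0..T}. gradient (P t) (u t) \<bullet> h t)"
proof -
  obtain r1 where r1: "r1 > 0" "\<And>t. t \<in> {0..T} \<Longrightarrow> u t \<in> ball 0 r1" using continuous_ball_bound[OF u] by metis
  obtain r2 where r2: "r2 > 0" "\<And>t. t \<in> {0..T} \<Longrightarrow> h t \<in> ball 0 r2" using continuous_ball_bound[OF h] by metis
  define R where "R = r1 + r2"
  have R: "R > 0" "u t \<in> ball 0 R" "u t + s k *\<^sub>R h t \<in> ball 0 R" if "t \<in> {0..T}" for k t
  proof -
    show "R > 0" "u t \<in> ball 0 R" using r1(2)[OF that] r1(1) r2(1) by (auto simp: R_def)
    have "norm (u t + s k *\<^sub>R h t) \<le> norm (u t) + s k * norm (h t)"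
      using norm_triangle_ineq[of "u t" "s k *\<^sub>R h t"] s(1)[of k] by simp
    also have "s k * norm (h t) \<le> 1 * norm (h t)" using s(2) by (intro mult_right_mono) auto
    finally show "u t + s k *\<^sub>R h t \<in> ball 0 R" using r1(2)[OF that] r2(2)[OF that] by (simp add: R_def)
  qed
  have R0: "R > 0" using r1 r2 by (simp add: R_def)
  obtain m where m: "integrable (lebesgue_on {0..T}) m"
    "AE t in lebesgue_on {0..T}. 0 \<le> m t \<and> (\<forall>x\<in>ball 0 R. norm (gradient (P t) x) \<le> m t) \<and>
      (\<forall>x\<in>ball 0 R. \<forall>y\<in>ball 0 R. \<bar>P t x - P t y\<bar> \<le> m t * norm (x - y))"
    by (rule admissible_lipschitz[OF P R0])
  have hm: "h \<in> borel_measurable (lebesgue_on {0..T})"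
    using h by (intro continuous_imp_measurable_on_sets_lebesgue) auto
  show ?thesis
  proof (rule integral_dominated_convergence)
    show "integrable (lebesgue_on {0..T}) (\<lambda>t. m t * r2)" using m(1) by simp
    show "(\<lambda>t. gradient (P t) (u t) \<bullet> h t) \<in> borel_measurable (lebesgue_on {0..T})"
      using admissible_comp_measurable(2)[OF P u] hm by (rule borel_measurable_inner)
    have "continuous_on {0..T} (\<lambda>t. u t + s k *\<^sub>R h t)" for k using u h by (intro continuous_intros)
    then show "(\<lambda>t. (P t (u t + s k *\<^sub>R h t) - P t (u t)) / s k) \<in> borel_measurable (lebesgue_on {0..T})" for k
      using admissible_comp_measurable(1)[OF P] u by (intro borel_measurable_divide borel_measurable_diff) auto
    show "AE t in lebesgue_on {0..T}. norm ((P t (u t + s k *\<^sub>R h t) - P t (u t)) / s k) \<le> m t * r2" for k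
      using m(2) AE_lebesgue_on_mem[of T]
    proof eventually_elim
      case (elim t)
      have "\<bar>P t (u t + s k *\<^sub>R h t) - P t (u t)\<bar> \<le> m t * norm (s k *\<^sub>R h t)"
        using elim(1) R(2)[OF elim(2)] R(3)[OF elim(2), of k] by (metis add_diff_cancel_left')
      also have "\<dots> = (m t * norm (h t)) * s k" using s(1)[of k] by simp
      also have "\<dots> \<le> (m t * r2) * s k"
        using elim r2(2)[of t] s(1)[of k] by (intro mult_right_mono mult_left_mono) auto
      finally show ?case using s(1)[of k] by (simp add: abs_divide divide_le_eq)
    qed
    show "AE t in lebesgue_on {0..T}. (\<lambda>k. (P t (u t + s k *\<^sub>R h t) - P t (u t)) / s k)
        \<longlonglongrightarrow> gradient (P t) (u t) \<bullet> h t"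
    proof (rule AE_I2)
      fix t assume "t \<in> space (lebesgue_on {0..T})"
      then have t: "t \<in> {0..T}" by simp
      have "((\<lambda>x. (P t (u t + x *\<^sub>R h t) - P t (u t)) / x) \<longlongrightarrow> gradient (P t) (u t) \<bullet> h t) (at 0)"
        using P t C1_on_GDERIV[of UNIV "P t" "u t"] by (intro GDERIV_directional) (auto simp: admissible_def)
      moreover have "filterlim s (at 0) sequentially"
        using s by (auto simp: filterlim_at less_imp_neq[THEN not_sym])
      ultimately show "(\<lambda>k. (P t (u t + s k *\<^sub>R h t) - P t (u t)) / s k) \<longlonglongrightarrow> gradient (P t) (u t) \<bullet> h t"
        by (rule filterlim_compose)
    qed
  qed
qed

section \<open>Periodic Lipschitz curves\<close>

text \<open>
  The almost-everywhere bound on the speed and the Lipschitz constant \<open>L\<close> carry the same information.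
  In the second form it is evident that \<open>K\<close> is convex and closed under pointwise limits.
\<close>

theorem K_set_iff:
  fixes u :: "real \<Rightarrow> real^'n"
  assumes L: "L \<ge> 0" and T: "T > 0"
  shows "u \<in> K_set L T \<longleftrightarrow> L-lipschitz_on {0..T} u \<and> u 0 = u T"
proof
  assume u: "u \<in> K_set L T"
  then obtain C where C: "C-lipschitz_on {0..T} u" by (auto simp: K_set_def)
  have "AE t in lebesgue_on {0..T}. norm (tderiv T u t) \<le> L"
    using u by (auto simp: K_set_def elim!: eventually_mono)
  then have "norm (u b - u a) \<le> L * (b - a)" if "0 \<le> a" "a \<le> b" "b \<le> T" for a b
    using lipschitz_differentiable_ae(2)[OF T C that] that L
    by (intro has_integral_norm_bound_AE) auto
  then have "L-lipschitz_on {0..T} u" by (intro lipschitz_on_intervalI L)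
  then show "L-lipschitz_on {0..T} u \<and> u 0 = u T" using u by (auto simp: K_set_def)
next
  assume u: "L-lipschitz_on {0..T} u \<and> u 0 = u T"
  have "AE t in lebesgue_on {0..T}. u differentiable (at t within {0..T}) \<and> norm (tderiv T u t) \<le> L"
    using lipschitz_differentiable_ae(1)[OF T conjunct1[OF u]] AE_lebesgue_on_mem[of T]
  proof eventually_elim
    case (elim t)
    then show ?case
      using has_vector_derivative_norm_le_lipschitz[OF T conjunct1[OF u]]
      by (metis vector_derivative_works)
  qed
  then show "u \<in> K_set L T" using u by (auto simp: K_set_def)
qed

locale periodic_setting =
  fixes L T :: real
  assumes L_pos: "L > 0" and T_pos: "T > 0"

begin

lemma K_iff: "u \<in> K_set L T \<longleftrightarrow> L-lipschitz_on {0..T} u \<and> u 0 = u T"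
  using K_set_iff[OF less_imp_le[OF L_pos] T_pos] .

lemma K_has_integral:
  assumes "u \<in> K_set L T" "0 \<le> a" "a \<le> b" "b \<le> T"
  shows "(tderiv T u has_integral (u b - u a)) {a..b}"
  using lipschitz_differentiable_ae(2)[OF T_pos] assms by (auto simp: K_iff)

lemma K_AE:
  assumes "u \<in> K_set L T"
  shows "AE t in lebesgue_on {0..T}. (u has_vector_derivative tderiv T u t) (at t within {0..T}) \<and>
    norm (tderiv T u t) \<le> L \<and> t \<in> {0..T}"
proof -
  have "AE t in lebesgue_on {0..T}. u differentiable (at t within {0..T}) \<and> norm (tderiv T u t) \<le> L"
    using assms by (simp add: K_set_def)
  then show ?thesis using AE_lebesgue_on_mem[of T]
    by eventually_elim (simp add: vector_derivative_works)
qed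

lemma tderiv_eqI:
  assumes "(u has_vector_derivative (d :: 'b::euclidean_space)) (at t within {0..T})" "t \<in> {0..T}"
  shows "tderiv T u t = d"
  by (rule vector_derivative_within_closed_interval) (use assms T_pos in auto)

lemma K_tderiv_measurable:
  assumes "u \<in> K_set L T"
  shows "tderiv T u \<in> borel_measurable (lebesgue_on {0..T})"
  using K_has_integral[OF assms, of 0 T] T_pos
  by (intro integrable_imp_measurable) (auto intro: has_integral_integrable)

lemma K_tderiv_integrable:
  assumes "u \<in> K_set L T"
  shows "integrable (lebesgue_on {0..T}) (tderiv T u)"
  by (rule AE_bounded_integrable[OF K_tderiv_measurable[OF assms], of L])
    (use K_AE[OF assms] in \<open>auto elim!: eventually_mono\<close>)

lemma K_continuous:
  assumes "u \<in> K_set L T" shows "continuous_on {0..T} u"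
  using assms by (auto simp: K_iff lipschitz_on_continuous_on)

lemma K_dist:
  assumes "u \<in> K_set L T" "t \<in> {0..T}" "s \<in> {0..T}"
  shows "norm (u t - u s) \<le> L * T"
proof -
  have "norm (u t - u s) \<le> L * dist t s"
    using assms lipschitz_onD[of L "{0..T}" u t s] by (auto simp: K_iff dist_norm)
  also have "\<dots> \<le> L * T" using assms L_pos by (intro mult_left_mono) (auto simp: dist_real_def)
  finally show ?thesis .
qed

lemma K_const: "(\<lambda>_. x) \<in> K_set L T"
  using L_pos by (auto simp: K_iff intro!: lipschitz_onI)

lemma K_add_const: "u \<in> K_set L T \<Longrightarrow> (\<lambda>t. u t + x) \<in> K_set L T"
  by (auto simp: K_iff lipschitz_on_def)

lemma K_convex:
  assumes "u \<in> K_set L T" "v \<in> K_set L T" "0 \<le> s" "s \<le> 1"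
  shows "(\<lambda>t. u t + s *\<^sub>R (v t - u t)) \<in> K_set L T"
  unfolding K_iff
proof
  show "L-lipschitz_on {0..T} (\<lambda>t. u t + s *\<^sub>R (v t - u t))"
  proof (rule lipschitz_onI)
    fix x y assume xy: "x \<in> {0..T}" "y \<in> {0..T}"
    have "norm (u x + s *\<^sub>R (v x - u x) - (u y + s *\<^sub>R (v y - u y)))
      = norm ((1 - s) *\<^sub>R (u x - u y) + s *\<^sub>R (v x - v y))" by (simp add: algebra_simps)
    also have "\<dots> \<le> norm ((1 - s) *\<^sub>R (u x - u y)) + norm (s *\<^sub>R (v x - v y))"
      by (rule norm_triangle_ineq)
    also have "\<dots> = (1 - s) * norm (u x - u y) + s * norm (v x - v y)" using assms by simp
    also have "\<dots> \<le> (1 - s) * (L * dist x y) + s * (L * dist x y)"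
      using assms xy lipschitz_onD[of L "{0..T}" u x y] lipschitz_onD[of L "{0..T}" v x y]
      by (intro add_mono mult_left_mono) (auto simp: K_iff dist_norm)
    also have "\<dots> = L * dist x y" by (simp add: algebra_simps)
    finally show "dist (u x + s *\<^sub>R (v x - u x)) (u y + s *\<^sub>R (v y - u y)) \<le> L * dist x y"
      by (simp add: dist_norm)
  qed (use L_pos in auto)
qed (use assms in \<open>simp add: K_iff\<close>)

lemma K_tderiv_const_add:
  assumes "u \<in> K_set L T"
  shows "AE t in lebesgue_on {0..T}. tderiv T (\<lambda>t. u t + x) t = tderiv T u t"
  using K_AE[OF assms]
proof eventually_elim
  case (elim t)
  then have "((\<lambda>t. u t + x) has_vector_derivative tderiv T u t + 0) (at t within {0..T})"
    by (intro has_vector_derivative_add has_vector_derivative_const) auto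
  then show ?case using elim by (intro tderiv_eqI) auto
qed

lemma K_tderiv_convex:
  assumes "u \<in> K_set L T" "v \<in> K_set L T"
  shows "AE t in lebesgue_on {0..T}.
    tderiv T (\<lambda>t. u t + s *\<^sub>R (v t - u t)) t = (1 - s) *\<^sub>R tderiv T u t + s *\<^sub>R tderiv T v t"
  using K_AE[OF assms(1)] K_AE[OF assms(2)]
proof eventually_elim
  case (elim t)
  then have "((\<lambda>t. u t + s *\<^sub>R (v t - u t)) has_vector_derivative
      tderiv T u t + s *\<^sub>R (tderiv T v t - tderiv T u t)) (at t within {0..T})"
    by (intro has_vector_derivative_add has_vector_derivative_diff
        bounded_linear.has_vector_derivative[OF bounded_linear_scaleR_right]) auto
  then have "tderiv T (\<lambda>t. u t + s *\<^sub>R (v t - u t)) t = tderiv T u t + s *\<^sub>R (tderiv T v t - tderiv T u t)"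
    using elim by (intro tderiv_eqI) auto
  then show ?case by (simp add: algebra_simps)
qed

text \<open>
  \<open>\<Phi>\<close> matters only on the closed ball, so it is composed with the projection onto the ball, which
  gives a continuous function on the whole space.
\<close>

lemma continuous_on_cball_comp_measurable:
  fixes f :: "real \<Rightarrow> 'b::euclidean_space" and \<Phi> :: "'b \<Rightarrow> real"
  assumes f: "f \<in> borel_measurable (lebesgue_on {0..T})" and ae: "AE t in lebesgue_on {0..T}. norm (f t) \<le> L"
    and \<Phi>: "continuous_on (cball 0 L) \<Phi>"
  shows "(\<lambda>t. \<Phi> (f t)) \<in> borel_measurable (lebesgue_on {0..T})"
proof -
  define p where "p x = closest_point (cball 0 L) x" for x :: 'b
  have ne: "cball (0::'b) L \<noteq> {}" using L_pos by auto
  have "continuous_on UNIV p" unfolding p_def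
    by (rule continuous_on_closest_point) (use ne in auto)
  moreover have "p ` UNIV \<subseteq> cball 0 L" unfolding p_def
    using ne by (auto intro!: closest_point_in_set simp del: mem_cball)
  ultimately have "continuous_on UNIV (\<Phi> \<circ> p)"
    by (intro continuous_on_compose continuous_on_subset[OF \<Phi>])
  then have "\<Phi> \<circ> p \<in> borel_measurable borel" by (rule borel_measurable_continuous_onI)
  from measurable_compose[OF f this]
  have "(\<lambda>t. \<Phi> (p (f t))) \<in> borel_measurable (lebesgue_on {0..T})" by simp
  moreover have "AE t in lebesgue_on {0..T}. \<Phi> (p (f t)) = \<Phi> (f t)"
    using ae by eventually_elim (simp add: p_def closest_point_self)
  ultimately show ?thesis by (rule measurable_lebesgue_on_AE)
qed

text \<open>
  When \<open>e\<close> is bounded, its primitive is Lipschitz, so the product with \<open>v\<close> is Lipschitz too and is the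
  integral of its derivative.
\<close>

lemma integration_by_parts_bounded:
  fixes e :: "real \<Rightarrow> real^'n"
  assumes e: "integrable (lebesgue_on {0..T}) e" and B: "\<And>t. t \<in> {0..T} \<Longrightarrow> norm (e t) \<le> B"
    and v: "v \<in> K_set L T"
  shows "(LINT t|lebesgue_on {0..T}. integral {0..t} e \<bullet> tderiv T v t)
     = integral {0..T} e \<bullet> v T - (LINT t|lebesgue_on {0..T}. e t \<bullet> v t)"
proof -
  define E where "E t = integral {0..t} e" for t
  define f where "f t = E t \<bullet> v t" for t
  have "0 \<le> norm (e 0)" by simp
  also have "\<dots> \<le> B" using B[of 0] T_pos by simp
  finally have B0: "0 \<le> B" .
  have Einc: "norm (E b - E a) \<le> B * (b - a)" if "0 \<le> a" "a \<le> b" "b \<le> T" for a b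
  proof -
    have "norm (E b - E a) = norm (integral (cbox a b) e)"
      unfolding E_def using integral_increment[OF e that] by (simp add: cbox_interval)
    also have "\<dots> \<le> B * measure lborel (cbox a b)"
      using B B0 that e lebesgue_on_integrable_on_subinterval[OF e, of a b]
      by (intro integrable_bound) (auto simp: cbox_interval)
    finally show ?thesis using that by simp
  qed
  have Elip: "norm (E x - E y) \<le> B * dist x y" if "x \<in> {0..T}" "y \<in> {0..T}" for x y
    using Einc[of x y] Einc[of y x] that
    by (cases "x \<le> y") (auto simp: dist_real_def norm_minus_commute)
  have Ebd: "norm (E x) \<le> B * T" if "x \<in> {0..T}" for x
  proof -
    have "norm (E x) \<le> B * x" using Einc[of 0 x] that by (simp add: E_def)
    also have "\<dots> \<le> B * T" using that B0 by (intro mult_left_mono) auto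
    finally show ?thesis .
  qed
  have cv: "continuous_on {0..T} v" by (rule K_continuous[OF v])
  obtain R where R: "R > 0" "\<And>t. t \<in> {0..T} \<Longrightarrow> v t \<in> ball 0 R"
    using continuous_ball_bound[OF cv] by metis
  have vlip: "norm (v x - v y) \<le> L * dist x y" if "x \<in> {0..T}" "y \<in> {0..T}" for x y
    using v that lipschitz_onD[of L "{0..T}" v x y] by (auto simp: K_iff dist_norm)
  have flip: "(B * T * L + B * R)-lipschitz_on {0..T} f"
  proof (rule lipschitz_onI)
    fix x y assume xy: "x \<in> {0..T}" "y \<in> {0..T}"
    have "f x - f y = E x \<bullet> (v x - v y) + (E x - E y) \<bullet> v y"
      by (simp add: f_def inner_diff_left inner_diff_right)
    then have "\<bar>f x - f y\<bar> \<le> \<bar>E x \<bullet> (v x - v y)\<bar> + \<bar>(E x - E y) \<bullet> v y\<bar>" by linarith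
    also have "\<dots> \<le> norm (E x) * norm (v x - v y) + norm (E x - E y) * norm (v y)"
      by (intro add_mono Cauchy_Schwarz_ineq2)
    also have "\<dots> \<le> (B * T) * (L * dist x y) + (B * dist x y) * R"
      using xy Ebd[of x] vlip[of x y] Elip[of x y] R(2)[of y] B0 T_pos L_pos
      by (intro add_mono mult_mono) auto
    finally show "dist (f x) (f y) \<le> (B * T * L + B * R) * dist x y"
      by (simp add: dist_real_def algebra_simps)
  qed (use B0 T_pos L_pos R in auto)
  have ftc: "(tderiv T f has_integral (f T - f 0)) {0..T}"
    using lipschitz_differentiable_ae(2)[OF T_pos flip, of 0 T] T_pos by simp
  have ev: "integrable (lebesgue_on {0..T}) (\<lambda>t. e t \<bullet> v t)"
    by (rule integrable_inner_continuous[OF e cv])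
  have Ec: "continuous_on {0..T} E" unfolding E_def by (rule continuous_indefinite_integral[OF e])
  have Ev: "integrable (lebesgue_on {0..T}) (\<lambda>t. E t \<bullet> tderiv T v t)"
    using integrable_inner_continuous[OF K_tderiv_integrable[OF v] Ec] by (simp add: inner_commute)
  have ae: "AE t in lebesgue_on {0..T}. tderiv T f t = e t \<bullet> v t + E t \<bullet> tderiv T v t"
    using K_AE[OF v] indefinite_integral_derivative_ae[OF e]
  proof eventually_elim
    case (elim t)
    then have "(f has_vector_derivative (E t \<bullet> tderiv T v t + e t \<bullet> v t)) (at t within {0..T})"
      unfolding f_def E_def
      by (intro bounded_bilinear.has_vector_derivative[OF bounded_bilinear_inner]) auto
    then have "tderiv T f t = E t \<bullet> tderiv T v t + e t \<bullet> v t"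
      by (rule tderiv_eqI) (use elim in auto)
    then show ?case by simp
  qed
  have fm: "tderiv T f \<in> borel_measurable (lebesgue_on {0..T})"
    using ftc by (intro integrable_imp_measurable) (auto intro: has_integral_integrable)
  have sumI: "integrable (lebesgue_on {0..T}) (\<lambda>t. e t \<bullet> v t + E t \<bullet> tderiv T v t)"
    using ev Ev by simp
  have fI: "integrable (lebesgue_on {0..T}) (tderiv T f)"
    by (subst integrable_cong_AE[OF fm _ ae]) (use sumI in auto)
  have "f T - f 0 = integral {0..T} (tderiv T f)" using ftc by (simp add: integral_unique)
  also have "\<dots> = (LINT t|lebesgue_on {0..T}. tderiv T f t)" using lebesgue_on_eq_integral[OF fI] by simp
  also have "\<dots> = (LINT t|lebesgue_on {0..T}. e t \<bullet> v t + E t \<bullet> tderiv T v t)"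
    by (rule integral_cong_AE[OF fm _ ae]) (use sumI in auto)
  also have "\<dots> = (LINT t|lebesgue_on {0..T}. e t \<bullet> v t) + (LINT t|lebesgue_on {0..T}. E t \<bullet> tderiv T v t)"
    using ev Ev by simp
  finally show ?thesis by (simp add: f_def E_def)
qed

text \<open>
  The bounded case is applied to the truncations of \<open>e\<close>, whose primitives converge boundedly to that of
  \<open>e\<close>.
\<close>

theorem integration_by_parts_K:
  fixes e :: "real \<Rightarrow> real^'n"
  assumes e: "integrable (lebesgue_on {0..T}) e" and v: "v \<in> K_set L T"
  shows "(LINT t|lebesgue_on {0..T}. integral {0..t} e \<bullet> tderiv T v t)
     = integral {0..T} e \<bullet> v T - (LINT t|lebesgue_on {0..T}. e t \<bullet> v t)"
proof -
  define en where "en n t = (if norm (e t) \<le> real n then e t else 0)" for n t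
  have em[measurable]: "e \<in> borel_measurable (lebesgue_on {0..T})" using e by auto
  have enm[measurable]: "en n \<in> borel_measurable (lebesgue_on {0..T})" for n
    unfolding en_def by measurable
  have nle: "norm (en n t) \<le> norm (e t)" for n t by (simp add: en_def)
  have nI: "integrable (lebesgue_on {0..T}) (\<lambda>t. norm (e t))" using e by simp
  have enI: "integrable (lebesgue_on {0..T}) (en n)" for n
    by (rule Bochner_Integration.integrable_bound[OF nI enm]) (use nle in \<open>auto intro!: AE_I2\<close>)
  have enlim: "(\<lambda>n. en n t) \<longlonglongrightarrow> e t" for t
  proof (rule tendsto_eventually)
    obtain N :: nat where "norm (e t) \<le> real N" using real_arch_simple by blast
    then show "\<forall>\<^sub>F n in sequentially. en n t = e t"
      by (auto simp: eventually_sequentially en_def intro!: exI[of _ N])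
  qed
  have parts: "(LINT t|lebesgue_on {0..T}. integral {0..t} (en n) \<bullet> tderiv T v t)
     = integral {0..T} (en n) \<bullet> v T - (LINT t|lebesgue_on {0..T}. en n t \<bullet> v t)" for n
    by (rule integration_by_parts_bounded[OF enI _ v, of n "real n"]) (simp add: en_def)
  have Elim: "(\<lambda>n. integral {0..t} (en n)) \<longlonglongrightarrow> integral {0..t} e" if "t \<in> {0..T}" for t
    by (rule dominated_convergence(2)[where h="\<lambda>t. norm (e t)"])
      (use that enI nI nle enlim in \<open>auto intro!: lebesgue_on_integrable_on_subinterval\<close>)
  have Ebd: "norm (integral {0..t} (en n)) \<le> integral {0..T} (\<lambda>t. norm (e t))" if t: "t \<in> {0..T}" for n t
  proof -
    have "norm (integral {0..t} (en n)) \<le> integral {0..t} (\<lambda>t. norm (e t))"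
      using t enI nI nle by (intro integral_norm_bound_integral lebesgue_on_integrable_on_subinterval) auto
    also have "\<dots> \<le> integral {0..T} (\<lambda>t. norm (e t))"
      using t nI by (intro integral_subset_le lebesgue_on_integrable_on_subinterval) auto
    finally show ?thesis .
  qed
  have cv: "continuous_on {0..T} v" by (rule K_continuous[OF v])
  then have vm[measurable]: "v \<in> borel_measurable (lebesgue_on {0..T})"
    by (intro continuous_imp_measurable_on_sets_lebesgue) auto
  have dm[measurable]: "tderiv T v \<in> borel_measurable (lebesgue_on {0..T})" by (rule K_tderiv_measurable[OF v])
  obtain R where R: "R > 0" "\<And>t. t \<in> {0..T} \<Longrightarrow> v t \<in> ball 0 R"
    using continuous_ball_bound[OF cv] by metis
  have "(\<lambda>n. LINT t|lebesgue_on {0..T}. en n t \<bullet> v t) \<longlonglongrightarrow> (LINT t|lebesgue_on {0..T}. e t \<bullet> v t)"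
  proof (rule integral_dominated_convergence)
    show "integrable (lebesgue_on {0..T}) (\<lambda>t. norm (e t) * R)" using nI by simp
    show "AE t in lebesgue_on {0..T}. norm (en n t \<bullet> v t) \<le> norm (e t) * R" for n
      using AE_lebesgue_on_mem[of T]
    proof eventually_elim
      case (elim t)
      have "norm (en n t \<bullet> v t) \<le> norm (en n t) * norm (v t)" using Cauchy_Schwarz_ineq2 by auto
      also have "\<dots> \<le> norm (e t) * R" using R(2)[OF elim] nle by (intro mult_mono) auto
      finally show ?case .
    qed
    show "AE t in lebesgue_on {0..T}. (\<lambda>n. en n t \<bullet> v t) \<longlonglongrightarrow> e t \<bullet> v t"
      by (intro AE_I2 tendsto_inner enlim tendsto_const)
  qed measurable
  moreover have "(\<lambda>n. integral {0..T} (en n) \<bullet> v T) \<longlonglongrightarrow> integral {0..T} e \<bullet> v T"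
    using Elim[of T] T_pos by (intro tendsto_inner tendsto_const) auto
  moreover have "(\<lambda>n. LINT t|lebesgue_on {0..T}. integral {0..t} (en n) \<bullet> tderiv T v t)
      \<longlonglongrightarrow> (LINT t|lebesgue_on {0..T}. integral {0..t} e \<bullet> tderiv T v t)"
  proof (rule integral_dominated_convergence)
    show "integrable (lebesgue_on {0..T}) (\<lambda>t. integral {0..T} (\<lambda>t. norm (e t)) * L)" by simp
    show "AE t in lebesgue_on {0..T}. norm (integral {0..t} (en n) \<bullet> tderiv T v t)
        \<le> integral {0..T} (\<lambda>t. norm (e t)) * L" for n
      using K_AE[OF v]
    proof eventually_elim
      case (elim t)
      have "norm (integral {0..t} (en n) \<bullet> tderiv T v t) \<le> norm (integral {0..t} (en n)) * norm (tderiv T v t)"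
        using Cauchy_Schwarz_ineq2 by auto
      also have "\<dots> \<le> integral {0..T} (\<lambda>t. norm (e t)) * L"
        using elim Ebd[of t n] by (intro mult_mono) (auto intro: order_trans[OF norm_ge_zero])
      finally show ?case .
    qed
    show "AE t in lebesgue_on {0..T}. (\<lambda>n. integral {0..t} (en n) \<bullet> tderiv T v t)
        \<longlonglongrightarrow> integral {0..t} e \<bullet> tderiv T v t"
      using AE_lebesgue_on_mem[of T] by eventually_elim (intro tendsto_inner Elim tendsto_const)
    have c: "(\<lambda>t. integral {0..t} f) \<in> borel_measurable (lebesgue_on {0..T})"
      if "integrable (lebesgue_on {0..T}) f" for f :: "real \<Rightarrow> real^'n"
      using continuous_indefinite_integral[OF that] by (intro continuous_imp_measurable_on_sets_lebesgue) auto
    show "(\<lambda>t. integral {0..t} e \<bullet> tderiv T v t) \<in> borel_measurable (lebesgue_on {0..T})"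
      by (intro borel_measurable_inner c e dm)
    show "(\<lambda>t. integral {0..t} (en n) \<bullet> tderiv T v t) \<in> borel_measurable (lebesgue_on {0..T})" for n
      by (intro borel_measurable_inner c enI dm)
  qed
  ultimately show ?thesis
    unfolding parts using LIMSEQ_unique tendsto_diff by blast
qed

end

section \<open>The convex kinetic potential\<close>

text \<open>
  Brouwer's theorem for \<open>x \<mapsto> \<Pi> (x - N x)\<close> with \<open>\<Pi>\<close> the projection onto the ball of radius \<open>R\<close>.  At a
  fixed point \<open>x\<close> the vector \<open>- N x\<close> is an outward normal to the ball; on the sphere that contradicts
  \<open>N x \<bullet> x > 0\<close>, and in the interior only \<open>N x = 0\<close> is possible.
\<close>

lemma zero_of_coercive_field:
  fixes N :: "'b::euclidean_space \<Rightarrow> 'b"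
  assumes c: "continuous_on UNIV N" and R: "R > 0" and pos: "\<And>x. norm x = R \<Longrightarrow> 0 < N x \<bullet> x"
  obtains x where "N x = 0"
proof -
  have ne: "cball (0::'b) R \<noteq> {}" using R by auto
  define p where "p x = closest_point (cball 0 R) (x - N x)" for x
  have "continuous_on UNIV (\<lambda>x. x - N x)" using c by (intro continuous_intros)
  from continuous_on_compose2[OF continuous_on_closest_point[of "cball 0 R" UNIV] this]
  have "continuous_on UNIV p" unfolding p_def using ne by auto
  then have pc: "continuous_on (cball 0 R) p" by (rule continuous_on_subset) simp
  have pr: "p \<in> cball 0 R \<rightarrow> cball 0 R"
    unfolding p_def using ne by (auto intro!: closest_point_in_set simp del: mem_cball)
  obtain x where x: "x \<in> cball 0 R" "closest_point (cball 0 R) (x - N x) = x"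
    using brouwer[OF compact_cball convex_cball ne pc pr] by (metis p_def)
  have vi: "(- N x) \<bullet> (z - x) \<le> 0" if "z \<in> cball 0 R" for z
    using closest_point_dot[OF convex_cball closed_cball that, of "x - N x"] x(2) by simp
  have "norm x \<noteq> R" using vi[of 0] pos[of x] R by auto
  then have lt: "norm x < R" using x(1) by auto
  \<comment> \<open>A step so small that \<open>x - \<epsilon> N x\<close> stays in the ball.\<close>
  define \<epsilon> where "\<epsilon> = (R - norm x) / (norm (N x) + 1)"
  have \<epsilon>: "\<epsilon> > 0" using lt by (auto simp: \<epsilon>_def intro!: divide_pos_pos add_nonneg_pos)
  have "\<epsilon> * norm (N x) \<le> \<epsilon> * (norm (N x) + 1)" using \<epsilon> by simp
  also have "\<dots> = R - norm x" by (simp add: \<epsilon>_def add_nonneg_eq_0_iff)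
  finally have "x - \<epsilon> *\<^sub>R N x \<in> cball 0 R"
    using norm_triangle_ineq4[of x "\<epsilon> *\<^sub>R N x"] \<epsilon> by simp
  from vi[OF this] have "\<epsilon> * (N x \<bullet> N x) \<le> 0" by simp
  then have "N x \<bullet> N x \<le> 0" using \<epsilon> by (simp add: mult_le_0_iff)
  then have "N x = 0" by (metis inner_ge_zero inner_eq_zero_iff order_antisym)
  then show thesis by (rule that)
qed

locale relativistic_setting = periodic_setting L T for L T +
  fixes \<phi> :: "real^'n \<Rightarrow> real^'n" and \<Phi> :: "real^'n \<Rightarrow> real"
  assumes class_A: "\<phi> \<in> class_A L" and potential: "is_potential L \<phi> \<Phi>"

begin

lemma Phi_continuous: "continuous_on (cball 0 L) \<Phi>"
  using potential by (simp add: is_potential_def)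

lemma Phi_strict:
  assumes "x \<in> cball 0 L" "y \<in> cball 0 L" "x \<noteq> y" "0 < s" "s < 1"
  shows "\<Phi> ((1 - s) *\<^sub>R x + s *\<^sub>R y) < (1 - s) * \<Phi> x + s * \<Phi> y"
  using potential assms by (auto simp: is_potential_def strictly_convex_on_def)

lemma Phi_convex:
  assumes "x \<in> cball 0 L" "y \<in> cball 0 L" "0 \<le> s" "s \<le> 1"
  shows "\<Phi> ((1 - s) *\<^sub>R x + s *\<^sub>R y) \<le> (1 - s) * \<Phi> x + s * \<Phi> y"
proof (cases "x = y \<or> s = 0 \<or> s = 1")
  case True
  then show ?thesis by (auto simp: algebra_simps simp flip: scaleR_add_left)
next
  case False
  then show ?thesis using Phi_strict[of x y s] assms by force
qed

lemma Phi_bound: obtains M where "\<And>x. x \<in> cball 0 L \<Longrightarrow> \<bar>\<Phi> x\<bar> \<le> M"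
proof -
  have "\<exists>M. \<forall>x\<in>cball 0 L. \<bar>\<Phi> x\<bar> \<le> M"
    using compact_imp_bounded[OF compact_continuous_image[OF Phi_continuous]]
    by (auto simp: bounded_iff)
  then show thesis using that by blast
qed

text \<open>
  The base point has to lie in the open ball, where \<open>\<Phi>\<close> is differentiable, but the comparison point may
  lie on the sphere: this is where competitors of maximal speed \<open>L\<close> enter.
\<close>

lemma Phi_tangent:
  assumes x: "x \<in> ball 0 L" and z: "z \<in> cball 0 L"
  shows "\<Phi> x + \<phi> x \<bullet> (z - x) \<le> \<Phi> z"
proof -
  have "GDERIV \<Phi> x :> \<phi> x"
    using potential x C1_on_GDERIV[of "ball 0 L" \<Phi> x] by (auto simp: is_potential_def)
  then have lim: "((\<lambda>s. (\<Phi> (x + s *\<^sub>R (z - x)) - \<Phi> x) / s) \<longlongrightarrow> \<phi> x \<bullet> (z - x)) (at_right 0)"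
    by (rule filterlim_at_split[THEN iffD1, THEN conjunct2, OF GDERIV_directional])
  have "\<phi> x \<bullet> (z - x) \<le> \<Phi> z - \<Phi> x"
  proof (rule tendsto_upperbound[OF lim])
    show "\<forall>\<^sub>F s in at_right 0. (\<Phi> (x + s *\<^sub>R (z - x)) - \<Phi> x) / s \<le> \<Phi> z - \<Phi> x"
      using eventually_at_right_real[of 0 "1::real", OF zero_less_one]
    proof eventually_elim
      case (elim s)
      have "x + s *\<^sub>R (z - x) = (1 - s) *\<^sub>R x + s *\<^sub>R z" by (simp add: algebra_simps)
      then have "\<Phi> (x + s *\<^sub>R (z - x)) \<le> (1 - s) * \<Phi> x + s * \<Phi> z"
        using Phi_convex[of x z s] x z elim by (auto simp: less_imp_le)
      then have "\<Phi> (x + s *\<^sub>R (z - x)) - \<Phi> x \<le> (\<Phi> z - \<Phi> x) * s" by (simp add: algebra_simps)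
      then show ?case using elim by (subst pos_divide_le_eq) auto
    qed
  qed simp
  then show ?thesis by simp
qed

lemma Phi_tangent_strict:
  assumes x: "x \<in> ball 0 L" and z: "z \<in> cball 0 L" and ne: "z \<noteq> x"
  shows "\<Phi> x + \<phi> x \<bullet> (z - x) < \<Phi> z"
proof -
  define m where "m = (1 - 1/2) *\<^sub>R x + (1/2::real) *\<^sub>R z"
  have mb: "m \<in> cball 0 L" unfolding m_def using x z
    by (intro convexD_alt[OF convex_cball]) auto
  have "\<Phi> m < (1 - 1/2) * \<Phi> x + (1/2) * \<Phi> z"
    unfolding m_def using x z ne by (intro Phi_strict) auto
  moreover have "\<Phi> x + \<phi> x \<bullet> (m - x) \<le> \<Phi> m" by (rule Phi_tangent[OF x mb])
  moreover have "m - x = (1/2) *\<^sub>R (z - x)"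
    by (simp add: m_def vec_eq_iff field_simps)
  ultimately show ?thesis by simp
qed

lemma phi_monotone_at_zero:
  assumes p: "p \<in> ball 0 L" shows "0 \<le> \<phi> p \<bullet> p"
proof -
  have z: "(0::real^'n) \<in> ball 0 L" using L_pos by simp
  have "\<phi> 0 = 0" using class_A by (simp add: class_A_def)
  then have "\<Phi> 0 \<le> \<Phi> p" using Phi_tangent[OF z, of p] p by simp
  moreover have "\<Phi> p + \<phi> p \<bullet> (0 - p) \<le> \<Phi> 0" using Phi_tangent[OF p, of 0] z by simp
  ultimately show ?thesis by simp
qed

definition velocity :: "real^'n \<Rightarrow> real^'n" where
  "velocity = inv_into (ball 0 L) \<phi>"

lemma velocity:
  "continuous_on UNIV velocity" "velocity y \<in> ball 0 L" "\<phi> (velocity y) = y"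
proof -
  obtain \<psi> where \<psi>: "homeomorphism (ball 0 L) UNIV \<phi> \<psi>"
    using class_A by (auto simp: class_A_def)
  have "\<phi> ` ball 0 L = UNIV" using \<psi> by (simp add: homeomorphism_def)
  then have y: "y \<in> \<phi> ` ball 0 L" for y by simp
  show v: "velocity y \<in> ball 0 L" "\<phi> (velocity y) = y" for y
    unfolding velocity_def using inv_into_into[OF y] f_inv_into_f[OF y] by auto
  have "velocity = \<psi>"
  proof
    fix y show "velocity y = \<psi> y" using \<psi> v[of y] unfolding homeomorphism_def by metis
  qed
  then show "continuous_on UNIV velocity" using \<psi> by (simp add: homeomorphism_def)
qed

text \<open>
  Compare \<open>\<Phi>\<close> with its tangent plane at \<open>velocity y\<close> in the point of the sphere in direction \<open>y\<close>; \<open>\<Phi>\<close>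
  being bounded, the momentum \<open>y\<close> and the velocity are almost parallel for large \<open>y\<close>.
\<close>

lemma velocity_coercive:
  obtains M where "\<And>y. L * norm y - M \<le> y \<bullet> velocity y"
proof -
  obtain M where M: "\<And>x. x \<in> cball 0 L \<Longrightarrow> \<bar>\<Phi> x\<bar> \<le> M" using Phi_bound by metis
  have "L * norm y - 2 * M \<le> y \<bullet> velocity y" for y
  proof -
    define z where "z = (L / norm y) *\<^sub>R y"
    have z: "z \<in> cball 0 L" "y \<bullet> z = L * norm y"
      using L_pos by (auto simp: z_def dot_square_norm power2_eq_square)
    have "\<Phi> (velocity y) + y \<bullet> (z - velocity y) \<le> \<Phi> z"
      using Phi_tangent[OF velocity(2) z(1), of y] velocity(3) by simp
    moreover have "\<bar>\<Phi> (velocity y)\<bar> \<le> M" "\<bar>\<Phi> z\<bar> \<le> M"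
      using M z velocity(2)[of y] by auto
    ultimately show ?thesis using z(2) by (simp add: inner_diff_right)
  qed
  then show thesis by (rule that)
qed

text \<open>
  The vector \<open>a\<close> is the integration constant that makes the curve with momentum \<open>E + a\<close> periodic.
\<close>

lemma velocity_mean_zero:
  fixes E :: "real \<Rightarrow> real^'n"
  assumes E: "continuous_on {0..T} E"
  obtains a where "integral {0..T} (\<lambda>t. velocity (E t + a)) = 0"
proof -
  define N where "N a = integral {0..T} (\<lambda>t. velocity (E t + a))" for a
  have cv: "continuous_on {0..T} (\<lambda>t. velocity (E t + a))" for a
    by (rule continuous_on_compose2[OF velocity(1)]) (auto intro!: continuous_intros E)
  have vI: "integrable (lebesgue_on {0..T}) (\<lambda>t. velocity (E t + a))" for a by (rule continuous_lebesgue_on_integrable[OF cv])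
  have vI': "(\<lambda>t. velocity (E t + a)) integrable_on {0..T}" for a
    using vI T_pos by (intro lebesgue_on_integrable_on_subinterval) auto
  have "continuous_on UNIV N"
  proof (rule continuous_on_sequentiallyI)
    fix s :: "nat \<Rightarrow> real^'n" and a assume s: "s \<longlonglongrightarrow> a"
    have "(\<lambda>n. integral {0..T} (\<lambda>t. velocity (E t + s n))) \<longlonglongrightarrow> integral {0..T} (\<lambda>t. velocity (E t + a))"
    proof (rule dominated_convergence(2)[where h="\<lambda>_. L"])
      show "norm (velocity (E t + s n)) \<le> L" for n t using velocity(2)[of "E t + s n"] by simp
      show "(\<lambda>n. velocity (E t + s n)) \<longlonglongrightarrow> velocity (E t + a)" for t
        by (rule continuous_on_tendsto_compose[OF velocity(1)]) (auto intro!: tendsto_intros s)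
    qed (use vI' in auto)
    then show "(\<lambda>n. N (s n)) \<longlonglongrightarrow> N a" by (simp add: N_def)
  qed
  moreover
  obtain M where M: "\<And>y. L * norm y - M \<le> y \<bullet> velocity y" using velocity_coercive by metis
  obtain B where B: "B > 0" "\<And>t. t \<in> {0..T} \<Longrightarrow> E t \<in> ball 0 B"
    using continuous_ball_bound[OF E] by metis
  \<comment> \<open>Large enough that \<open>velocity (E t + a) \<bullet> a \<ge> 1\<close> for all \<open>t\<close> when \<open>norm a = R\<close>.\<close>
  define R where "R = (2 * L * B + \<bar>M\<bar> + 1) / L"
  have R: "R > 0" using L_pos B by (auto simp: R_def intro!: divide_pos_pos add_nonneg_pos)
  have "0 < N a \<bullet> a" if a: "norm a = R" for a
  proof -
    have low: "1 \<le> velocity (E t + a) \<bullet> a" if t: "t \<in> {0..T}" for t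
    proof -
      have "velocity (E t + a) \<bullet> a = (E t + a) \<bullet> velocity (E t + a) - E t \<bullet> velocity (E t + a)"
        by (simp add: inner_add_left inner_commute)
      moreover have "E t \<bullet> velocity (E t + a) \<le> B * L"
      proof -
        have "E t \<bullet> velocity (E t + a) \<le> norm (E t) * norm (velocity (E t + a))" by (rule norm_cauchy_schwarz)
        also have "\<dots> \<le> B * L" using B(2)[OF t] velocity(2)[of "E t + a"] B(1) by (intro mult_mono) auto
        finally show ?thesis .
      qed
      moreover have "L * (R - B) \<le> L * norm (E t + a)"
      proof (rule mult_left_mono)
        have "norm a \<le> norm (E t + a) + norm (E t)" using norm_triangle_ineq4[of "E t + a" "E t"] by simp
        then show "R - B \<le> norm (E t + a)" using a B(2)[OF t] by simp
      qed (use L_pos in auto)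
      moreover have "L * R = 2 * L * B + \<bar>M\<bar> + 1" using L_pos by (simp add: R_def)
      ultimately show ?thesis using M[of "E t + a"] by (simp add: algebra_simps)
    qed
    have "integral {0..T} (\<lambda>t. 1) \<le> integral {0..T} (\<lambda>t. velocity (E t + a) \<bullet> a)"
      using low integrable_linear[OF vI' bounded_linear_inner_left, of a a]
      by (intro integral_le) (auto simp: o_def)
    also have "\<dots> = N a \<bullet> a"
      unfolding N_def using integral_linear[OF vI' bounded_linear_inner_left, of a a] by (simp add: o_def)
    finally show ?thesis using T_pos by simp
  qed
  ultimately obtain a where "N a = 0" using zero_of_coercive_field[OF _ R] by metis
  then show thesis by (intro that[of a]) (simp add: N_def)
qed

definition kinetic :: "(real \<Rightarrow> real^'n) \<Rightarrow> real" where
  "kinetic u = (LINT t|lebesgue_on {0..T}. \<Phi> (tderiv T u t))"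

lemma kinetic_integrable:
  assumes u: "u \<in> K_set L T"
  shows "integrable (lebesgue_on {0..T}) (\<lambda>t. \<Phi> (tderiv T u t))"
proof -
  obtain M where M: "\<And>x. x \<in> cball 0 L \<Longrightarrow> \<bar>\<Phi> x\<bar> \<le> M" using Phi_bound by metis
  have ae: "AE t in lebesgue_on {0..T}. norm (tderiv T u t) \<le> L"
    using K_AE[OF u] by eventually_elim auto
  show ?thesis
  proof (rule AE_bounded_integrable)
    show "(\<lambda>t. \<Phi> (tderiv T u t)) \<in> borel_measurable (lebesgue_on {0..T})"
      by (rule continuous_on_cball_comp_measurable[OF K_tderiv_measurable[OF u] ae Phi_continuous])
    show "AE t in lebesgue_on {0..T}. norm (\<Phi> (tderiv T u t)) \<le> M"
      using ae by eventually_elim (use M in auto)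
  qed
qed

lemma energy_eq:
  assumes u: "u \<in> K_set L T" and P: "admissible T P"
  shows "energy T \<Phi> P u = kinetic u + (LINT t|lebesgue_on {0..T}. P t (u t))"
  unfolding energy_def kinetic_def
  by (rule Bochner_Integration.integral_add[OF kinetic_integrable[OF u] admissible_integrable(1)[OF P K_continuous[OF u]]])

lemma kinetic_cong_AE:
  assumes "u \<in> K_set L T" "v \<in> K_set L T" "AE t in lebesgue_on {0..T}. tderiv T u t = tderiv T v t"
  shows "kinetic u = kinetic v"
  unfolding kinetic_def using assms kinetic_integrable[OF assms(1)] kinetic_integrable[OF assms(2)]
  by (intro integral_cong_AE) (auto elim!: eventually_mono)

section \<open>Minimizers solve the equation\<close>

text \<open>
  Along the segment from \<open>u\<close> to \<open>v\<close> the kinetic part is bounded by its chord, while the potential part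
  is differentiated.  Working inside \<open>K\<close> with a convex bound avoids differentiating \<open>\<Phi>\<close> on the sphere, where
  the speed constraint may be active.
\<close>

lemma minimizer_variational_inequality:
  assumes P: "admissible T P" and min: "is_global_min_on (energy T \<Phi> P) (K_set L T) u"
    and v: "v \<in> K_set L T"
  shows "0 \<le> kinetic v - kinetic u + (LINT t|lebesgue_on {0..T}. gradient (P t) (u t) \<bullet> (v t - u t))"
proof -
  have u: "u \<in> K_set L T" using min by (simp add: is_global_min_on_def)
  define s where "s k = inverse (real (Suc k))" for k
  have s: "0 < s k" "s k \<le> 1" for k by (auto simp: s_def field_simps)
  have s0: "s \<longlonglongrightarrow> 0" unfolding s_def by (rule LIMSEQ_inverse_real_of_nat)
  define h where "h t = v t - u t" for t
  have uc: "continuous_on {0..T} u" and vc: "continuous_on {0..T} v" using u v by (auto intro: K_continuous)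
  then have hc: "continuous_on {0..T} h" by (simp add: h_def continuous_on_diff)
  have lim: "(\<lambda>k. LINT t|lebesgue_on {0..T}. (P t (u t + s k *\<^sub>R h t) - P t (u t)) / s k)
    \<longlonglongrightarrow> (LINT t|lebesgue_on {0..T}. gradient (P t) (u t) \<bullet> h t)"
    by (rule admissible_directional_derivative[OF P uc hc s s0])
  have "0 \<le> kinetic v - kinetic u + (LINT t|lebesgue_on {0..T}. (P t (u t + s k *\<^sub>R h t) - P t (u t)) / s k)" for k
  proof -
    define w where "w t = u t + s k *\<^sub>R h t" for t
    have w: "w \<in> K_set L T" unfolding w_def h_def using u v s[of k] by (intro K_convex) auto
    have "kinetic w \<le> (LINT t|lebesgue_on {0..T}. (1 - s k) * \<Phi> (tderiv T u t) + s k * \<Phi> (tderiv T v t))"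
      unfolding kinetic_def
    proof (rule integral_mono_AE)
      show "AE t in lebesgue_on {0..T}. \<Phi> (tderiv T w t) \<le> (1 - s k) * \<Phi> (tderiv T u t) + s k * \<Phi> (tderiv T v t)"
        using K_tderiv_convex[OF u v, of "s k"] K_AE[OF u] K_AE[OF v]
      proof eventually_elim
        case (elim t)
        then show ?case unfolding w_def h_def using s[of k] Phi_convex[of "tderiv T u t" "tderiv T v t" "s k"] by simp
      qed
    qed (use kinetic_integrable u v w in auto)
    also have "\<dots> = (1 - s k) * kinetic u + s k * kinetic v"
      unfolding kinetic_def using kinetic_integrable[OF u] kinetic_integrable[OF v] by simp
    finally have kw: "kinetic w \<le> (1 - s k) * kinetic u + s k * kinetic v" .
    have "energy T \<Phi> P u \<le> energy T \<Phi> P w" using min w by (simp add: is_global_min_on_def)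
    then have "kinetic u + (LINT t|lebesgue_on {0..T}. P t (u t)) \<le> kinetic w + (LINT t|lebesgue_on {0..T}. P t (w t))"
      using energy_eq[OF u P] energy_eq[OF w P] by simp
    moreover have "(LINT t|lebesgue_on {0..T}. (P t (w t) - P t (u t)) / s k)
       = ((LINT t|lebesgue_on {0..T}. P t (w t)) - (LINT t|lebesgue_on {0..T}. P t (u t))) / s k"
      using admissible_integrable(1)[OF P uc] admissible_integrable(1)[OF P K_continuous[OF w]] by simp
    ultimately have "s k * 0 \<le> s k * (kinetic v - kinetic u + (LINT t|lebesgue_on {0..T}. (P t (w t) - P t (u t)) / s k))"
      using kw s[of k] by (simp add: algebra_simps)
    then show ?thesis using s(1)[of k] unfolding w_def by (simp add: zero_le_mult_iff)
  qed
  then show ?thesis unfolding h_def[symmetric]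
    by (intro LIMSEQ_le_const[OF tendsto_add[OF tendsto_const lim]]) auto
qed

text \<open>
  The curve \<open>w\<close> with momentum \<open>\<phi> w' = E + a\<close>, where \<open>E\<close> is the primitive of the force \<open>e\<close>, satisfies the
  opposite of the variational inequality: by the tangent plane inequality and integration by parts,
  \<open>\<integral> \<Phi> u' + e \<bullet> u \<ge> \<integral> \<Phi> w' + e \<bullet> w\<close>, with equality only if \<open>u' = w'\<close> almost everywhere.
\<close>

theorem minimizer_is_solution:
  assumes P: "admissible T P" and min: "is_global_min_on (energy T \<Phi> P) (K_set L T) u"
  shows "is_solution L T \<phi> P u"
proof -
  have u: "u \<in> K_set L T" using min by (simp add: is_global_min_on_def)
  have uc: "continuous_on {0..T} u" by (rule K_continuous[OF u])
  define e where "e t = gradient (P t) (u t)" for t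
  have eI: "integrable (lebesgue_on {0..T}) e" unfolding e_def by (rule admissible_integrable(2)[OF P uc])
  have vi: "0 \<le> kinetic v - kinetic u + (LINT t|lebesgue_on {0..T}. e t \<bullet> (v t - u t))" if "v \<in> K_set L T" for v
    using minimizer_variational_inequality[OF P min that] by (simp add: e_def)
  \<comment> \<open>\<open>K\<close> is invariant under translations, which leave the kinetic part unchanged.\<close>
  have e0: "integral {0..T} e = 0"
  proof -
    define x where "x = - integral {0..T} e"
    have K: "(\<lambda>t. u t + x) \<in> K_set L T" by (rule K_add_const[OF u])
    have "kinetic (\<lambda>t. u t + x) = kinetic u"
      by (rule kinetic_cong_AE[OF K u K_tderiv_const_add[OF u]])
    then have "0 \<le> (LINT t|lebesgue_on {0..T}. e t \<bullet> x)" using vi[OF K] by simp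
    also have "\<dots> = integral {0..T} e \<bullet> x" using eI lebesgue_on_eq_integral[OF eI] by simp
    finally have "integral {0..T} e \<bullet> integral {0..T} e \<le> 0" by (simp add: x_def)
    then show ?thesis by (metis inner_ge_zero inner_eq_zero_iff order_antisym)
  qed
  define E where "E t = integral {0..t} e" for t
  have Ec: "continuous_on {0..T} E" unfolding E_def by (rule continuous_indefinite_integral[OF eI])
  have E0: "E 0 = 0" "E T = 0" by (simp_all add: E_def e0)
  obtain a where a: "integral {0..T} (\<lambda>t. velocity (E t + a)) = 0" by (rule velocity_mean_zero[OF Ec])
  define d where "d t = velocity (E t + a)" for t
  have dc: "continuous_on {0..T} d"
    unfolding d_def by (rule continuous_on_compose2[OF velocity(1)]) (auto intro!: continuous_intros Ec)
  have dball: "d t \<in> ball 0 L" and \<phi>d: "\<phi> (d t) = E t + a" for t unfolding d_def using velocity by auto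
  define w where "w t = integral {0..t} d" for t
  have wder: "(w has_vector_derivative d t) (at t within {0..T})" if "t \<in> {0..T}" for t
    unfolding w_def by (rule integral_has_vector_derivative[OF dc that])
  have wtd: "tderiv T w t = d t" if "t \<in> {0..T}" for t using wder[OF that] that by (rule tderiv_eqI)
  have dI: "integrable (lebesgue_on {0..T}) d" by (rule continuous_lebesgue_on_integrable[OF dc])
  have w: "w \<in> K_set L T"
    unfolding K_iff
  proof
    have "norm (w y - w x) \<le> L * (y - x)" if "0 \<le> x" "x \<le> y" "y \<le> T" for x y
    proof -
      have "norm (w y - w x) = norm (integral {x..y} d)"
        unfolding w_def using integral_increment[OF dI that] by simp
      also have "\<dots> \<le> integral {x..y} (\<lambda>_. L)"
        using that lebesgue_on_integrable_on_subinterval[OF dI, of x y] dball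
        by (intro integral_norm_bound_integral) (auto simp: less_imp_le)
      finally show ?thesis using that by (simp add: mult.commute)
    qed
    then show "L-lipschitz_on {0..T} w" using L_pos by (intro lipschitz_on_intervalI) auto
    show "w 0 = w T" using a by (simp add: w_def d_def[abs_def])
  qed
  have wc: "continuous_on {0..T} w" by (rule K_continuous[OF w])
  \<comment> \<open>By parts; there is no boundary term because \<open>E\<close> vanishes at both ends and \<open>v\<close> is periodic.\<close>
  have pair: "(LINT t|lebesgue_on {0..T}. (E t + a) \<bullet> tderiv T v t) = - (LINT t|lebesgue_on {0..T}. e t \<bullet> v t)"
    and pairI: "integrable (lebesgue_on {0..T}) (\<lambda>t. (E t + a) \<bullet> tderiv T v t)"
    and evI: "integrable (lebesgue_on {0..T}) (\<lambda>t. e t \<bullet> v t)"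
    if v: "v \<in> K_set L T" for v
  proof -
    have vh: "(tderiv T v has_integral 0) {0..T}"
      using K_has_integral[OF v, of 0 T] T_pos v by (simp add: K_iff)
    have vI: "integrable (lebesgue_on {0..T}) (tderiv T v)" by (rule K_tderiv_integrable[OF v])
    have EI: "integrable (lebesgue_on {0..T}) (\<lambda>t. E t \<bullet> tderiv T v t)"
      using integrable_inner_continuous[OF vI Ec] by (simp add: inner_commute)
    have aI: "integrable (lebesgue_on {0..T}) (\<lambda>t. a \<bullet> tderiv T v t)" using vI by simp
    have "(LINT t|lebesgue_on {0..T}. a \<bullet> tderiv T v t) = a \<bullet> (LINT t|lebesgue_on {0..T}. tderiv T v t)"
      using vI by simp
    also have "(LINT t|lebesgue_on {0..T}. tderiv T v t) = 0"
      using lebesgue_on_eq_integral[OF vI] integral_unique[OF vh] by simp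
    finally have a0: "(LINT t|lebesgue_on {0..T}. a \<bullet> tderiv T v t) = 0" by simp
    show "integrable (lebesgue_on {0..T}) (\<lambda>t. (E t + a) \<bullet> tderiv T v t)"
      using EI aI by (simp add: inner_add_left)
    show "(LINT t|lebesgue_on {0..T}. (E t + a) \<bullet> tderiv T v t) = - (LINT t|lebesgue_on {0..T}. e t \<bullet> v t)"
      using EI aI a0 integration_by_parts_K[OF eI v] e0 by (simp add: inner_add_left E_def)
    show "integrable (lebesgue_on {0..T}) (\<lambda>t. e t \<bullet> v t)"
      by (rule integrable_inner_continuous[OF eI K_continuous[OF v]])
  qed
  \<comment> \<open>The excess of \<open>\<Phi>\<close> at \<open>u'\<close> over its tangent plane at \<open>d = w'\<close>: nonnegative, and zero only where
    \<open>u' = w'\<close>.  The variational inequality tested with \<open>w\<close> makes its integral nonpositive.\<close>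
  define gap where "gap t = \<Phi> (tderiv T u t) - \<Phi> (tderiv T w t) - ((E t + a) \<bullet> tderiv T u t - (E t + a) \<bullet> tderiv T w t)" for t
  have gapI: "integrable (lebesgue_on {0..T}) gap"
    unfolding gap_def using kinetic_integrable[OF u] kinetic_integrable[OF w] pairI[OF u] pairI[OF w] by simp
  have gap_alt: "gap t = \<Phi> (tderiv T u t) - (\<Phi> (d t) + \<phi> (d t) \<bullet> (tderiv T u t - d t))" if "t \<in> {0..T}" for t
    using wtd[OF that] \<phi>d[of t] by (simp add: gap_def inner_diff_right)
  have gap0: "AE t in lebesgue_on {0..T}. 0 \<le> gap t"
    using K_AE[OF u] by eventually_elim (use Phi_tangent dball gap_alt in auto)
  have "integral\<^sup>L (lebesgue_on {0..T}) gap = kinetic u - kinetic w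
     + ((LINT t|lebesgue_on {0..T}. e t \<bullet> u t) - (LINT t|lebesgue_on {0..T}. e t \<bullet> w t))"
    unfolding gap_def kinetic_def
    using kinetic_integrable[OF u] kinetic_integrable[OF w] pairI[OF u] pairI[OF w] pair[OF u] pair[OF w] by simp
  moreover have "(LINT t|lebesgue_on {0..T}. e t \<bullet> (w t - u t))
      = (LINT t|lebesgue_on {0..T}. e t \<bullet> w t) - (LINT t|lebesgue_on {0..T}. e t \<bullet> u t)"
    using evI[OF u] evI[OF w] by (simp add: inner_diff_right)
  ultimately have "integral\<^sup>L (lebesgue_on {0..T}) gap \<le> 0" using vi[OF w] by simp
  then have "integral\<^sup>L (lebesgue_on {0..T}) gap = 0" using integral_nonneg_AE[OF gap0] by simp
  then have "AE t in lebesgue_on {0..T}. gap t = 0"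
    using integral_nonneg_eq_0_iff_AE[OF gapI gap0] by simp
  then have same: "AE t in lebesgue_on {0..T}. tderiv T u t = d t"
    using K_AE[OF u]
  proof eventually_elim
    case (elim t)
    then show ?case using Phi_tangent_strict[OF dball[of t], of "tderiv T u t"] gap_alt[of t] by force
  qed
  have uw: "u t = w t + u 0" if t: "t \<in> {0..T}" for t
  proof -
    have "u t - u 0 = integral {0..t} (tderiv T u)"
      using K_has_integral[OF u, of 0 t] t by (simp add: integral_unique)
    moreover have "integral {0..t} (tderiv T u) = integral {0..t} d"
    proof -
      obtain N where neg: "negligible N" and N: "\<And>t. t \<in> {0..T} - N \<Longrightarrow> tderiv T u t = d t"
        using same unfolding AE_lebesgue_on_iff_negligible by blast
      show ?thesis by (rule integral_spike[OF neg]) (use N t in auto)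
    qed
    ultimately show ?thesis by (simp add: w_def algebra_simps)
  qed
  have uder: "(u has_vector_derivative d t) (at t within {0..T})" if "t \<in> {0..T}" for t
  proof -
    have "((\<lambda>t. w t + u 0) has_vector_derivative d t + 0) (at t within {0..T})"
      by (intro has_vector_derivative_add wder that has_vector_derivative_const)
    then show ?thesis
      by (intro has_vector_derivative_transform[OF that uw]) auto
  qed
  have utd: "tderiv T u t = d t" if "t \<in> {0..T}" for t using uder[OF that] that by (rule tderiv_eqI)
  have Eder: "AE t in lebesgue_on {0..T}. (E has_vector_derivative e t) (at t within {0..T})"
    unfolding E_def by (rule indefinite_integral_derivative_ae[OF eI])
  have mom: "(\<phi> \<circ> tderiv T u) t = E t + a" if "t \<in> {0..T}" for t using utd[OF that] \<phi>d[of t] by simp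
  show ?thesis
    unfolding is_solution_def
  proof (intro conjI ballI)
    show "u differentiable at t within {0..T}" if "t \<in> {0..T}" for t
      using uder[OF that] by (rule differentiableI_vector)
    show "continuous_on {0..T} (tderiv T u)"
      by (subst continuous_on_cong[OF refl utd]) (use dc in auto)
    show "tderiv T u ` {0..T} \<subseteq> ball 0 L" using utd dball by auto
    show "u 0 = u T" using u by (simp add: K_iff)
    show "tderiv T u 0 = tderiv T u T" using utd[of 0] utd[of T] T_pos E0 by (simp add: d_def)
    show "abs_continuous_on {0..T} (\<phi> \<circ> tderiv T u)"
      by (rule indefinite_integral_abs_continuous[OF eI, of _ a]) (simp only: mom E_def)
    show "AE t in lebesgue_on {0..T}. ((\<phi> \<circ> tderiv T u) has_vector_derivative gradient (P t) (u t)) (at t within {0..T})"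
      using Eder AE_lebesgue_on_mem[of T]
    proof eventually_elim
      case (elim t)
      have "((\<lambda>t. E t + a) has_vector_derivative e t + 0) (at t within {0..T})"
        using elim by (intro has_vector_derivative_add has_vector_derivative_const) auto
      from has_vector_derivative_transform[OF elim(2) mom this]
      show ?case by (simp only: e_def add_0_right)
    qed
  qed
qed

section \<open>Compactness of sublevel sets\<close>

text \<open>
  A version of the derivative that satisfies the speed bound everywhere, so that pointwise inequalities
  can be integrated.
\<close>

lemma K_velocity_representative:
  assumes v: "v \<in> K_set L T"
  obtains d where "\<And>t. d t \<in> cball 0 L"
    "\<And>a b. 0 \<le> a \<Longrightarrow> a \<le> b \<Longrightarrow> b \<le> T \<Longrightarrow> (d has_integral (v b - v a)) {a..b}"
    "((\<lambda>t. \<Phi> (d t)) has_integral kinetic v) {0..T}"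
proof -
  define d where "d t = (if norm (tderiv T v t) \<le> L then tderiv T v t else 0)" for t
  have "AE t in lebesgue_on {0..T}. d t = tderiv T v t"
    using K_AE[OF v] by eventually_elim (simp add: d_def)
  then obtain N where neg: "negligible N" and N: "\<And>t. t \<in> {0..T} - N \<Longrightarrow> d t = tderiv T v t"
    unfolding AE_lebesgue_on_iff_negligible by blast
  show thesis
  proof (rule that)
    show "d t \<in> cball 0 L" for t using L_pos by (simp add: d_def)
    show "(d has_integral (v b - v a)) {a..b}" if "0 \<le> a" "a \<le> b" "b \<le> T" for a b
    proof (rule has_integral_spike[OF neg _ K_has_integral[OF v that]])
      fix t assume "t \<in> {a..b} - N"
      then show "d t = tderiv T v t" using that by (intro N) auto
    qed
    have "((\<lambda>t. \<Phi> (tderiv T v t)) has_integral kinetic v) {0..T}"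
      unfolding kinetic_def by (rule has_integral_integral_lebesgue_on[OF kinetic_integrable[OF v]]) simp
    then show "((\<lambda>t. \<Phi> (d t)) has_integral kinetic v) {0..T}"
    proof (rule has_integral_spike[OF neg, rotated])
      fix t assume "t \<in> {0..T} - N"
      then have "d t = tderiv T v t" by (rule N)
      then show "\<Phi> (d t) = \<Phi> (tderiv T v t)" by simp
    qed
  qed
qed

text \<open>
  On each cell of the partition \<open>\<Phi>\<close> is bounded below by its tangent plane at \<open>p i\<close>.  The bound
  depends on \<open>v\<close> only through finitely many values, so it is continuous under pointwise convergence.
\<close>

lemma kinetic_partition_lower_bound:
  fixes p :: "nat \<Rightarrow> real^'n"
  assumes v: "v \<in> K_set L T" and N: "real N * \<delta> = T" "\<delta> > 0" and p: "\<And>i. p i \<in> ball 0 L"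
  shows "(\<Sum>i<N. \<delta> * \<Phi> (p i) + \<phi> (p i) \<bullet> (v (real (Suc i) * \<delta>) - v (real i * \<delta>) - \<delta> *\<^sub>R p i)) \<le> kinetic v"
proof -
  obtain d where d: "\<And>t. d t \<in> cball 0 L"
    "\<And>a b. 0 \<le> a \<Longrightarrow> a \<le> b \<Longrightarrow> b \<le> T \<Longrightarrow> (d has_integral (v b - v a)) {a..b}"
    "((\<lambda>t. \<Phi> (d t)) has_integral kinetic v) {0..T}"
    using K_velocity_representative[OF v] by metis
  have \<Phi>I: "(\<lambda>t. \<Phi> (d t)) integrable_on {0..T}" using d(3) by (rule has_integral_integrable)
  have "(\<Sum>i<N. \<delta> * \<Phi> (p i) + \<phi> (p i) \<bullet> (v (real (Suc i) * \<delta>) - v (real i * \<delta>) - \<delta> *\<^sub>R p i))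
     \<le> (\<Sum>i<N. integral {real i * \<delta>..real (Suc i) * \<delta>} (\<lambda>t. \<Phi> (d t)))"
  proof (rule sum_mono)
    fix i assume "i \<in> {..<N}"
    then have "real (Suc i) * \<delta> \<le> real N * \<delta>" using N(2) by (intro mult_right_mono) auto
    then have r: "0 \<le> real i * \<delta>" "real i * \<delta> \<le> real (Suc i) * \<delta>" "real (Suc i) * \<delta> \<le> T"
      using N by (auto intro: mult_right_mono)
    define a b where "a = real i * \<delta>" and "b = real (Suc i) * \<delta>"
    have ab: "0 \<le> a" "a \<le> b" "b \<le> T" "b - a = \<delta>" using r by (auto simp: a_def b_def algebra_simps)
    have 1: "((\<lambda>t. \<phi> (p i) \<bullet> d t) has_integral \<phi> (p i) \<bullet> (v b - v a)) {a..b}"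
      using has_integral_linear[OF d(2)[OF ab(1-3)] bounded_linear_inner_right] by (simp add: o_def)
    have 2: "((\<lambda>t. \<Phi> (p i) - \<phi> (p i) \<bullet> p i) has_integral \<delta> * (\<Phi> (p i) - \<phi> (p i) \<bullet> p i)) {a..b}"
      using has_integral_const_real[of "\<Phi> (p i) - \<phi> (p i) \<bullet> p i" a b] ab by simp
    have 3: "(\<lambda>t. \<Phi> (d t)) integrable_on {a..b}"
      using \<Phi>I by (rule Henstock_Kurzweil_Integration.integrable_on_subinterval) (use ab in auto)
    have "\<phi> (p i) \<bullet> (v b - v a) + \<delta> * (\<Phi> (p i) - \<phi> (p i) \<bullet> p i) \<le> integral {a..b} (\<lambda>t. \<Phi> (d t))"
    proof (rule has_integral_le[OF has_integral_add[OF 1 2] integrable_integral[OF 3]])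
      fix t
      show "\<phi> (p i) \<bullet> d t + (\<Phi> (p i) - \<phi> (p i) \<bullet> p i) \<le> \<Phi> (d t)"
        using Phi_tangent[OF p d(1), of i t] by (simp add: inner_diff_right)
    qed
    then show "\<delta> * \<Phi> (p i) + \<phi> (p i) \<bullet> (v (real (Suc i) * \<delta>) - v (real i * \<delta>) - \<delta> *\<^sub>R p i)
        \<le> integral {real i * \<delta>..real (Suc i) * \<delta>} (\<lambda>t. \<Phi> (d t))"
      unfolding a_def[symmetric] b_def[symmetric] by (simp add: inner_diff_right right_diff_distrib)
  qed
  also have "\<dots> = integral {0..real N * \<delta>} (\<lambda>t. \<Phi> (d t))"
    by (rule integral_uniform_partition[symmetric, OF \<Phi>I]) (use N in auto)
  also have "\<dots> = kinetic v" using d(3) N by (simp add: integral_unique)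
  finally show ?thesis .
qed

text \<open>
  Difference quotients of \<open>u\<close> may have norm \<open>L\<close>; the factor \<open>(k + 1) / (k + 2)\<close>, which tends to \<open>1\<close>, moves
  them into the open ball, where tangent planes to \<open>\<Phi>\<close> exist.
\<close>

lemma kinetic_difference_quotient_limit:
  assumes u: "u \<in> K_set L T"
  defines "\<delta> \<equiv> \<lambda>k. T / real (Suc k)"
  defines "p \<equiv> \<lambda>k i. (real (Suc k) / (real (Suc k) + 1)) *\<^sub>R ((u (real (Suc i) * \<delta> k) - u (real i * \<delta> k)) /\<^sub>R \<delta> k)"
  shows "(\<lambda>k. \<Sum>i<Suc k. \<delta> k * \<Phi> (p k i)) \<longlonglongrightarrow> kinetic u"
    and "\<And>k i. i < Suc k \<Longrightarrow> p k i \<in> ball 0 L"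
proof -
  define \<theta> where "\<theta> k = real (Suc k) / (real (Suc k) + 1)" for k
  have \<theta>: "0 < \<theta> k" "\<theta> k < 1" for k by (auto simp: \<theta>_def)
  have \<delta>: "\<delta> k > 0" "real (Suc k) * \<delta> k = T" for k using T_pos by (auto simp: \<delta>_def simp del: of_nat_Suc)
  have rng: "0 \<le> real i * \<delta> k" "real i * \<delta> k \<le> real (Suc i) * \<delta> k" "real (Suc i) * \<delta> k \<le> T" if "i < Suc k" for i k
  proof -
    have "real (Suc i) * \<delta> k \<le> real (Suc k) * \<delta> k" using that \<delta>(1)[of k] by (intro mult_right_mono) auto
    then show "real (Suc i) * \<delta> k \<le> T" using \<delta>(2) by simp
    show "0 \<le> real i * \<delta> k" "real i * \<delta> k \<le> real (Suc i) * \<delta> k"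
      using \<delta>(1)[of k] by (auto intro: mult_right_mono)
  qed
  show pb: "p k i \<in> ball 0 L" if i: "i < Suc k" for k i
  proof -
    have "norm (u (real (Suc i) * \<delta> k) - u (real i * \<delta> k)) \<le> L * dist (real (Suc i) * \<delta> k) (real i * \<delta> k)"
      using u rng[OF i] lipschitz_onD[of L "{0..T}" u "real (Suc i) * \<delta> k" "real i * \<delta> k"] by (auto simp: K_iff dist_norm simp del: of_nat_Suc)
    also have "dist (real (Suc i) * \<delta> k) (real i * \<delta> k) = \<delta> k"
      using \<delta>(1)[of k] by (simp add: dist_real_def algebra_simps)
    finally have le: "norm (u (real (Suc i) * \<delta> k) - u (real i * \<delta> k)) \<le> L * \<delta> k" .
    have "norm (x /\<^sub>R d) \<le> L" if "norm x \<le> L * d" "d > 0" for x :: "real^'n" and d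
      using that by (simp add: divide_inverse[symmetric] mult.commute[of "inverse d"] divide_le_eq)
    from mult_left_mono[OF this[OF le \<delta>(1)] less_imp_le[OF \<theta>(1)[of k]]]
    have "norm (p k i) \<le> \<theta> k * L"
      unfolding p_def \<theta>_def[symmetric] by (simp only: norm_scaleR abs_of_pos[OF \<theta>(1)])
    also have "\<dots> < 1 * L" using \<theta>(2)[of k] L_pos by (intro mult_strict_right_mono)
    finally show ?thesis by simp
  qed
  \<comment> \<open>\<open>j k t\<close> is the number of the partition interval that contains \<open>t\<close>; the minimum assigns the
    end point \<open>T\<close> to the last interval.\<close>
  define j where "j k t = min (nat \<lfloor>t / \<delta> k\<rfloor>) k" for k t
  define q where "q k t = p k (j k t)" for k t
  have jlt: "j k t < Suc k" for k t by (simp add: j_def less_Suc_eq_le)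
  have js: "real (j k t) * \<delta> k \<le> t" "t \<le> real (Suc (j k t)) * \<delta> k" if t: "t \<in> {0..T}" for k t
  proof -
    have nn: "0 \<le> t / \<delta> k" using t \<delta>(1)[of k] by simp
    have "real (j k t) \<le> real (nat \<lfloor>t / \<delta> k\<rfloor>)" by (simp add: j_def)
    also have "\<dots> \<le> t / \<delta> k" using nn by simp
    finally show "real (j k t) * \<delta> k \<le> t" using \<delta>(1)[of k] by (simp add: field_simps)
    show "t \<le> real (Suc (j k t)) * \<delta> k"
    proof (cases "nat \<lfloor>t / \<delta> k\<rfloor> \<le> k")
      case True
      have "t / \<delta> k \<le> real (nat \<lfloor>t / \<delta> k\<rfloor>) + 1" using nn by linarith
      also have "\<dots> = real (Suc (j k t))" using True by (simp add: j_def)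
      finally show ?thesis using \<delta>(1)[of k] by (simp add: field_simps)
    next
      case False
      then have "j k t = k" by (simp add: j_def)
      then show ?thesis using \<delta>(2)[of k] t by simp
    qed
  qed
  have piece: "((\<lambda>t. \<Phi> (q k t)) has_integral (\<delta> k * \<Phi> (p k i))) {real i * \<delta> k..real (Suc i) * \<delta> k}"
    if i: "i < Suc k" for k i
  proof -
    have "((\<lambda>t. \<Phi> (p k i)) has_integral (\<delta> k * \<Phi> (p k i))) {real i * \<delta> k..real (Suc i) * \<delta> k}"
      using has_integral_const_real[of "\<Phi> (p k i)" "real i * \<delta> k" "real (Suc i) * \<delta> k"] \<delta>(1)[of k]
      by (simp add: algebra_simps)
    then show ?thesis
    proof (rule has_integral_spike[OF negligible_sing[of "real (Suc i) * \<delta> k"], rotated])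
      fix t assume t: "t \<in> {real i * \<delta> k..real (Suc i) * \<delta> k} - {real (Suc i) * \<delta> k}"
      then have "real i \<le> t / \<delta> k" "t / \<delta> k < real (Suc i)"
        using \<delta>(1)[of k] by (auto simp: field_simps simp del: of_nat_Suc)
      then have "\<lfloor>t / \<delta> k\<rfloor> = int i" by (simp add: floor_eq_iff)
      then have "j k t = i" using i by (simp add: j_def)
      then show "\<Phi> (q k t) = \<Phi> (p k i)" by (simp add: q_def)
    qed
  qed
  have whole: "((\<lambda>t. \<Phi> (q k t)) has_integral (\<Sum>i<n. \<delta> k * \<Phi> (p k i))) {0..real n * \<delta> k}" if "n \<le> Suc k" for k n
    using that
  proof (induction n)
    case 0 then show ?case using has_integral_refl(1)[of "\<lambda>t. \<Phi> (q k t)" 0] by (simp add: cbox_interval)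
  next
    case (Suc n)
    then have IH: "((\<lambda>t. \<Phi> (q k t)) has_integral (\<Sum>i<n. \<delta> k * \<Phi> (p k i))) {0..real n * \<delta> k}" by simp
    have "((\<lambda>t. \<Phi> (q k t)) has_integral (\<Sum>i<n. \<delta> k * \<Phi> (p k i)) + \<delta> k * \<Phi> (p k n)) {0..real (Suc n) * \<delta> k}"
      by (rule has_integral_combine[OF _ _ IH piece]) (use rng[of n k] Suc.prems in auto)
    then show ?case by simp
  qed
  have sumq: "((\<lambda>t. \<Phi> (q k t)) has_integral (\<Sum>i<Suc k. \<delta> k * \<Phi> (p k i))) {0..T}" for k
    using whole[of "Suc k" k] \<delta>(2) by simp
  obtain M where M: "\<And>x. x \<in> cball 0 L \<Longrightarrow> \<bar>\<Phi> x\<bar> \<le> M" using Phi_bound by metis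
  have qb: "q k t \<in> ball 0 L" for k t unfolding q_def by (rule pb[OF jlt])
  have qm: "(\<lambda>t. \<Phi> (q k t)) \<in> borel_measurable (lebesgue_on {0..T})" for k
    using sumq by (intro integrable_imp_measurable) (auto intro: has_integral_integrable)
  have qbd: "norm (\<Phi> (q k t)) \<le> M" for k t using M[of "q k t"] qb[of k t] by simp
  have qI: "integrable (lebesgue_on {0..T}) (\<lambda>t. \<Phi> (q k t))" for k
    by (rule AE_bounded_integrable[OF qm]) (use qbd in \<open>auto intro!: AE_I2\<close>)
  have eq: "(LINT t|lebesgue_on {0..T}. \<Phi> (q k t)) = (\<Sum>i<Suc k. \<delta> k * \<Phi> (p k i))" for k
    using lebesgue_on_eq_integral[OF qI] integral_unique[OF sumq] by simp
  have "(\<lambda>k. LINT t|lebesgue_on {0..T}. \<Phi> (q k t)) \<longlonglongrightarrow> kinetic u"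
    unfolding kinetic_def
  proof (rule integral_dominated_convergence)
    show "integrable (lebesgue_on {0..T}) (\<lambda>t. M)" by simp
    show "(\<lambda>t. \<Phi> (tderiv T u t)) \<in> borel_measurable (lebesgue_on {0..T})" using kinetic_integrable[OF u] by simp
    show "AE t in lebesgue_on {0..T}. (\<lambda>k. \<Phi> (q k t)) \<longlonglongrightarrow> \<Phi> (tderiv T u t)"
      using K_AE[OF u]
    proof eventually_elim
      case (elim t)
      define a where "a k = real (j k t) * \<delta> k" for k
      define b where "b k = real (Suc (j k t)) * \<delta> k" for k
      have ba: "b k - a k = \<delta> k" for k by (simp add: a_def b_def algebra_simps)
      have "\<delta> \<longlonglongrightarrow> 0"
      proof -
        have "(\<lambda>k. T * inverse (real (Suc k))) \<longlonglongrightarrow> T * 0"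
          by (intro tendsto_mult tendsto_const LIMSEQ_inverse_real_of_nat)
        then show ?thesis by (simp add: \<delta>_def divide_inverse)
      qed
      then have "(\<lambda>k. b k - a k) \<longlonglongrightarrow> 0" by (simp add: ba)
      then have "(\<lambda>k. (u (b k) - u (a k)) /\<^sub>R (b k - a k)) \<longlonglongrightarrow> tderiv T u t"
      proof (rule straddling_quotient_tendsto[rotated -1])
        show "a k < b k" for k using ba[of k] \<delta>(1)[of k] by simp
      qed (use elim rng[OF jlt] js[of t] in \<open>auto simp: a_def b_def simp del: of_nat_Suc\<close>)
      moreover have "\<theta> \<longlonglongrightarrow> 1" unfolding \<theta>_def
      proof -
        have "(\<lambda>k. 1 - inverse (real (Suc (Suc k)))) \<longlonglongrightarrow> 1 - 0"
          by (intro tendsto_diff tendsto_const LIMSEQ_Suc[OF LIMSEQ_inverse_real_of_nat])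
        moreover have "1 - inverse (real (Suc (Suc k))) = real (Suc k) / (real (Suc k) + 1)" for k
          by (simp add: field_simps)
        ultimately show "(\<lambda>k. real (Suc k) / (real (Suc k) + 1)) \<longlonglongrightarrow> 1" by simp
      qed
      ultimately have "(\<lambda>k. \<theta> k *\<^sub>R ((u (b k) - u (a k)) /\<^sub>R (b k - a k))) \<longlonglongrightarrow> 1 *\<^sub>R tderiv T u t"
        by (rule tendsto_scaleR[rotated])
      moreover have "\<theta> k *\<^sub>R ((u (b k) - u (a k)) /\<^sub>R (b k - a k)) = q k t" for k
        unfolding ba by (simp add: q_def p_def a_def b_def \<theta>_def)
      ultimately have "(\<lambda>k. q k t) \<longlonglongrightarrow> tderiv T u t" by simp
      then show ?case
        by (rule continuous_on_tendsto_compose[OF Phi_continuous])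
          (use elim qb in \<open>auto simp: less_imp_le\<close>)
    qed
    show "AE t in lebesgue_on {0..T}. norm (\<Phi> (q k t)) \<le> M" for k using qbd by (intro AE_I2) auto
  qed (rule qm)
  then show "(\<lambda>k. \<Sum>i<Suc k. \<delta> k * \<Phi> (p k i)) \<longlonglongrightarrow> kinetic u" by (simp only: eq)
qed

text \<open>
  For tangent points taken from the limit curve \<open>u\<close>, the lower bounds of \<open>kinetic_partition_lower_bound\<close>
  pass to the limit along \<open>w\<close>; refining the partition then recovers the kinetic energy of \<open>u\<close>.
\<close>

theorem kinetic_lower_semicontinuous:
  assumes u: "u \<in> K_set L T" and w: "\<And>k. w k \<in> K_set L T"
    and lim: "\<And>t. t \<in> {0..T} \<Longrightarrow> (\<lambda>k. w k t) \<longlonglongrightarrow> u t"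
    and le: "\<forall>\<^sub>F k in sequentially. kinetic (w k) \<le> a k" and a: "a \<longlonglongrightarrow> c"
  shows "kinetic u \<le> c"
proof (rule LIMSEQ_le_const2[OF kinetic_difference_quotient_limit(1)[OF u]], intro exI allI impI)
  fix n :: nat
  define \<delta> where "\<delta> = T / real (Suc n)"
  define \<theta> where "\<theta> = real (Suc n) / (real (Suc n) + 1)"
  define m where "m i = (u (real (Suc i) * \<delta>) - u (real i * \<delta>)) /\<^sub>R \<delta>" for i
  define p where "p i = \<theta> *\<^sub>R m i" for i
  have \<theta>: "0 < \<theta>" "\<theta> < 1" by (auto simp: \<theta>_def)
  have \<delta>: "\<delta> > 0" "real (Suc n) * \<delta> = T" using T_pos by (auto simp: \<delta>_def simp del: of_nat_Suc)
  have pb: "p i \<in> ball 0 L" if "i < Suc n" for i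
    using kinetic_difference_quotient_limit(2)[OF u that] unfolding p_def \<theta>_def m_def \<delta>_def .
  \<comment> \<open>Extended by \<open>0\<close> to all indices, so that every value lies in the open ball.\<close>
  define p' where "p' i = (if i < Suc n then p i else 0)" for i
  have p'b: "p' i \<in> ball 0 L" for i using pb L_pos by (simp add: p'_def)
  define R where "R v = (\<Sum>i<Suc n. \<delta> * \<Phi> (p' i) + \<phi> (p' i) \<bullet> (v (real (Suc i) * \<delta>) - v (real i * \<delta>) - \<delta> *\<^sub>R p' i))"
    for v :: "real \<Rightarrow> real^'n"
  have Rle: "R v \<le> kinetic v" if "v \<in> K_set L T" for v
    unfolding R_def by (rule kinetic_partition_lower_bound[OF that \<delta>(2,1) p'b])
  have "(\<lambda>k. R (w k)) \<longlonglongrightarrow> R u"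
    unfolding R_def
  proof (intro tendsto_intros lim)
    fix i assume "i \<in> {..<Suc n}"
    then have "real (Suc i) * \<delta> \<le> real (Suc n) * \<delta>" using \<delta>(1) by (intro mult_right_mono) auto
    moreover have "real i * \<delta> \<le> real (Suc i) * \<delta>" using \<delta>(1) by (intro mult_right_mono) auto
    moreover have "0 \<le> real i * \<delta>" using \<delta>(1) by simp
    ultimately show "real (Suc i) * \<delta> \<in> {0..T}" "real i * \<delta> \<in> {0..T}" using \<delta>(2) by auto
  qed
  moreover have "\<forall>\<^sub>F k in sequentially. R (w k) \<le> a k"
    using le by eventually_elim (use Rle[OF w] in \<open>auto intro: order_trans\<close>)
  ultimately have Ru: "R u \<le> c" using a by (intro tendsto_le[OF _ a]) auto
  \<comment> \<open>The shrinking factor leaves a remainder proportional to \<open>\<phi> (p i) \<bullet> m i\<close>, of the favourable sign.\<close>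
  have "(\<Sum>i<Suc n. \<delta> * \<Phi> (p i)) \<le> R u"
    unfolding R_def
  proof (rule sum_mono)
    fix i assume i: "i \<in> {..<Suc n}"
    have "u (real (Suc i) * \<delta>) - u (real i * \<delta>) - \<delta> *\<^sub>R p i = (\<delta> * (1 - \<theta>)) *\<^sub>R m i"
    proof -
      have "u (real (Suc i) * \<delta>) - u (real i * \<delta>) = \<delta> *\<^sub>R m i" using \<delta>(1) by (simp add: m_def)
      then show ?thesis by (simp add: p_def algebra_simps)
    qed
    moreover have "0 \<le> \<phi> (p i) \<bullet> m i"
    proof -
      have "0 \<le> \<theta> * (\<phi> (p i) \<bullet> m i)" using phi_monotone_at_zero[OF pb[of i]] i by (simp add: p_def)
      then show ?thesis using \<theta>(1) by (simp add: zero_le_mult_iff)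
    qed
    ultimately have "0 \<le> \<phi> (p i) \<bullet> (u (real (Suc i) * \<delta>) - u (real i * \<delta>) - \<delta> *\<^sub>R p i)"
      using \<delta>(1) \<theta>(2) by simp
    then show "\<delta> * \<Phi> (p i) \<le> \<delta> * \<Phi> (p' i) + \<phi> (p' i) \<bullet> (u (real (Suc i) * \<delta>) - u (real i * \<delta>) - \<delta> *\<^sub>R p' i)"
      using i by (simp add: p'_def)
  qed
  then have "(\<Sum>i<Suc n. \<delta> * \<Phi> (p i)) \<le> c" using Ru by simp
  then show "(\<Sum>i<Suc n. T / real (Suc n) * \<Phi> ((real (Suc n) / (real (Suc n) + 1)) *\<^sub>R
      ((u (real (Suc i) * (T / real (Suc n))) - u (real i * (T / real (Suc n)))) /\<^sub>R (T / real (Suc n))))) \<le> c"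
    unfolding p_def m_def \<theta>_def \<delta>_def .
qed

theorem K_sequentially_compact:
  assumes w: "\<And>k. w k \<in> K_set L T" and R: "\<And>k. norm (w k 0) \<le> R"
  shows "\<exists>r u. strict_mono (r :: nat \<Rightarrow> nat) \<and> u \<in> K_set L T \<and>
    (\<forall>P. admissible T P \<longrightarrow> (\<lambda>k. LINT t|lebesgue_on {0..T}. P t (w (r k) t))
        \<longlonglongrightarrow> (LINT t|lebesgue_on {0..T}. P t (u t))) \<and>
    (\<forall>a c. a \<longlonglongrightarrow> c \<longrightarrow> (\<forall>\<^sub>F k in sequentially. kinetic (w (r k)) \<le> a k) \<longrightarrow> kinetic u \<le> c)"
proof -
  have bd: "norm (w k t) \<le> R + L * T" if "t \<in> {0..T}" for k t
  proof -
    have "norm (w k t) \<le> norm (w k 0) + norm (w k t - w k 0)" using norm_triangle_ineq[of "w k 0" "w k t - w k 0"] by simp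
    also have "\<dots> \<le> R + L * T" using R[of k] K_dist[OF w that, of 0 k] T_pos by (intro add_mono) auto
    finally show ?thesis .
  qed
  have lip: "norm (w k x - w k y) \<le> L * \<bar>x - y\<bar>" if "x \<in> {0..T}" "y \<in> {0..T}" for k x y
    using w[of k] that lipschitz_onD[of L "{0..T}" "w k" x y] by (auto simp: K_iff dist_norm dist_real_def)
  obtain u r where ur: "continuous_on {0..T} u" "strict_mono (r :: nat \<Rightarrow> nat)"
    "\<And>e. 0 < e \<Longrightarrow> \<exists>N. \<forall>n x. n \<ge> N \<and> x \<in> {0..T} \<longrightarrow> norm (w (r n) x - u x) < e"
  proof (rule Arzela_Ascoli[of "{0..T}" w "R + L * T"])
    fix x e :: real assume x: "x \<in> {0..T}" and e: "0 < e"
    show "\<exists>d>0. \<forall>n y. y \<in> {0..T} \<and> norm (x - y) < d \<longrightarrow> norm (w n x - w n y) < e"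
    proof (intro exI[of _ "e / L"] conjI allI impI)
      show "e / L > 0" using e L_pos by simp
      fix n y assume y: "y \<in> {0..T} \<and> norm (x - y) < e / L"
      then have "L * \<bar>x - y\<bar> < e" using L_pos by (simp add: field_simps)
      then show "norm (w n x - w n y) < e" using lip[OF x, of y n] y by simp
    qed
  qed (use bd in auto)
  have lim: "(\<lambda>k. w (r k) t) \<longlonglongrightarrow> u t" if "t \<in> {0..T}" for t
    using ur(3) that by (intro LIMSEQ_I) blast
  have u: "u \<in> K_set L T"
    unfolding K_iff
  proof
    show "L-lipschitz_on {0..T} u"
    proof (rule lipschitz_onI)
      fix x y assume xy: "x \<in> {0..T}" "y \<in> {0..T}"
      have "(\<lambda>k. norm (w (r k) x - w (r k) y)) \<longlonglongrightarrow> norm (u x - u y)"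
        by (intro tendsto_norm tendsto_diff lim xy)
      then have "norm (u x - u y) \<le> L * \<bar>x - y\<bar>"
        by (rule LIMSEQ_le_const2) (use lip[OF xy] in auto)
      then show "dist (u x) (u y) \<le> L * dist x y" by (simp add: dist_norm)
    qed (use L_pos in auto)
    have "(\<lambda>k. w (r k) 0) \<longlonglongrightarrow> u T" using lim[of T] T_pos w by (simp add: K_iff)
    then show "u 0 = u T" using LIMSEQ_unique[OF lim[of 0]] T_pos by simp
  qed
  show ?thesis
  proof (intro exI[of _ r] exI[of _ u] conjI allI impI ur(2) u)
    show "(\<lambda>k. LINT t|lebesgue_on {0..T}. P t (w (r k) t)) \<longlonglongrightarrow> (LINT t|lebesgue_on {0..T}. P t (u t))"
      if "admissible T P" for P
      by (rule admissible_integral_tendsto[OF that ur(1) K_continuous[OF w] bd lim])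
    show "kinetic u \<le> c" if "a \<longlonglongrightarrow> c" "\<forall>\<^sub>F k in sequentially. kinetic (w (r k)) \<le> a k" for a c
      by (rule kinetic_lower_semicontinuous[OF u w lim that(2,1)])
  qed
qed

text \<open>
  A curve in \<open>K\<close> cannot come closer to the origin than \<open>norm (u 0) - L * T\<close>, so a large initial value
  keeps the whole curve where the potential is large.
\<close>

lemma energy_coercive:
  assumes P: "admissible T P" and u: "u \<in> K_set L T"
    and low: "AE t in lebesgue_on {0..T}. \<forall>x. \<rho> \<le> norm x \<longrightarrow> B \<le> P t x"
    and M: "\<And>x. x \<in> cball 0 L \<Longrightarrow> \<bar>\<Phi> x\<bar> \<le> M"
    and big: "\<rho> + L * T \<le> norm (u 0)"
  shows "T * (B - M) \<le> kinetic u + (LINT t|lebesgue_on {0..T}. P t (u t))"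
proof -
  have "AE t in lebesgue_on {0..T}. B - M \<le> \<Phi> (tderiv T u t) + P t (u t)"
    using low K_AE[OF u]
  proof eventually_elim
    case (elim t)
    have "norm (u 0) \<le> norm (u t) + norm (u t - u 0)" using norm_triangle_ineq4[of "u t" "u t - u 0"] by simp
    moreover have "norm (u t - u 0) \<le> L * T" using elim T_pos by (intro K_dist[OF u]) auto
    ultimately have "\<rho> \<le> norm (u t)" using big by simp
    then have "B \<le> P t (u t)" using elim by blast
    then show ?case using M[of "tderiv T u t"] elim by auto
  qed
  then have "(LINT t|lebesgue_on {0..T}. B - M) \<le> (LINT t|lebesgue_on {0..T}. \<Phi> (tderiv T u t) + P t (u t))"
    using kinetic_integrable[OF u] admissible_integrable(1)[OF P K_continuous[OF u]]
    by (intro integral_mono_AE) auto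
  also have "\<dots> = kinetic u + (LINT t|lebesgue_on {0..T}. P t (u t))"
    unfolding kinetic_def
    by (rule Bochner_Integration.integral_add[OF kinetic_integrable[OF u] admissible_integrable(1)[OF P K_continuous[OF u]]])
  finally show ?thesis using T_pos by (simp add: measure_restrict_space)
qed

end

section \<open>A minimax argument for two minimizers\<close>

text \<open>
  For large \<open>\<kappa> > 0\<close> every minimizer of \<open>A + \<kappa> B\<close> has \<open>B \<le> 0\<close>, since \<open>A\<close> is bounded below while \<open>B p < 0\<close>
  makes the minimum tend to \<open>-\<infinity>\<close>; for large negative \<open>\<kappa>\<close> the roles are exchanged through \<open>q\<close>.  The
  sets of parameters that admit a minimizer with \<open>B \<le> 0\<close>, respectively \<open>B \<ge> 0\<close>, are closed by
  compactness, so connectedness of the line gives a common parameter.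
\<close>

theorem two_sided_minimizers:
  fixes A B :: "'a \<Rightarrow> real" and X :: "'a set"
  assumes compact: "\<And>\<kappa> u C \<Lambda>. (\<And>k. u k \<in> X) \<Longrightarrow> (\<And>k. \<bar>\<kappa> k\<bar> \<le> \<Lambda>) \<Longrightarrow>
      (\<And>k. A (u k) + \<kappa> k * B (u k) \<le> C) \<Longrightarrow>
      \<exists>r v. strict_mono (r :: nat \<Rightarrow> nat) \<and> v \<in> X \<and> (\<lambda>k. B (u (r k))) \<longlonglongrightarrow> B v \<and>
        (\<forall>a c. a \<longlonglongrightarrow> c \<longrightarrow> (\<forall>\<^sub>F k in sequentially. A (u (r k)) \<le> a k) \<longrightarrow> A v \<le> c)"
    and p: "p \<in> X" "B p < 0" and q: "q \<in> X" "0 < B q"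
  obtains \<kappa> u\<^sub>1 u\<^sub>2 where
    "is_global_min_on (\<lambda>u. A u + \<kappa> * B u) X u\<^sub>1" "B u\<^sub>1 \<le> 0"
    "is_global_min_on (\<lambda>u. A u + \<kappa> * B u) X u\<^sub>2" "0 \<le> B u\<^sub>2"
proof -
  define J where "J \<kappa> u = A u + \<kappa> * B u" for \<kappa> u
  have compact_const: "\<exists>r v. strict_mono (r :: nat \<Rightarrow> nat) \<and> v \<in> X \<and>
      (\<forall>a c. a \<longlonglongrightarrow> c \<longrightarrow> (\<forall>\<^sub>F k in sequentially. J \<kappa> (u (r k)) \<le> a k) \<longrightarrow> J \<kappa> v \<le> c)"
    if uX: "\<And>k. u k \<in> X" and C: "\<And>k. J \<kappa> (u k) \<le> C" for u \<kappa> C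
  proof -
    obtain r v where r: "strict_mono (r :: nat \<Rightarrow> nat)" "v \<in> X" and Bl: "(\<lambda>k. B (u (r k))) \<longlonglongrightarrow> B v"
      and Al: "\<And>a c. a \<longlonglongrightarrow> c \<Longrightarrow> (\<forall>\<^sub>F k in sequentially. A (u (r k)) \<le> a k) \<Longrightarrow> A v \<le> c"
      using compact[of u "\<lambda>_. \<kappa>" "\<bar>\<kappa>\<bar>" C] uX C unfolding J_def by blast
    have "J \<kappa> v \<le> c" if a: "a \<longlonglongrightarrow> c" "\<forall>\<^sub>F k in sequentially. J \<kappa> (u (r k)) \<le> a k" for a c
    proof -
      have "(\<lambda>k. a k - \<kappa> * B (u (r k))) \<longlonglongrightarrow> c - \<kappa> * B v" by (intro tendsto_intros a Bl)
      moreover have "\<forall>\<^sub>F k in sequentially. A (u (r k)) \<le> a k - \<kappa> * B (u (r k))"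
        using a(2) by eventually_elim (simp add: J_def)
      ultimately have "A v \<le> c - \<kappa> * B v" by (rule Al)
      then show ?thesis by (simp add: J_def)
    qed
    with r show ?thesis by blast
  qed
  have ex: "\<exists>u. is_global_min_on (J \<kappa>) X u" for \<kappa>
  proof -
    have bdd: "bdd_below (J \<kappa> ` X)"
    proof (rule ccontr)
      assume nb: "\<not> bdd_below (J \<kappa> ` X)"
      have "\<exists>x\<in>X. J \<kappa> x < - real k" for k :: nat
        using nb by (force simp: bdd_below_def not_le)
      then have "\<forall>k. \<exists>x. x \<in> X \<and> J \<kappa> x < - real k" by blast
      from choice[OF this] obtain u where u: "\<And>k. u k \<in> X" "\<And>k::nat. J \<kappa> (u k) < - real k" by blast
      have "J \<kappa> (u k) \<le> 0" for k using u(2)[of k] of_nat_0_le_iff[of k, where 'a=real] by linarith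
      then obtain r v where r: "strict_mono (r :: nat \<Rightarrow> nat)" and
        v: "\<And>a c. a \<longlonglongrightarrow> c \<Longrightarrow> (\<forall>\<^sub>F k in sequentially. J \<kappa> (u (r k)) \<le> a k) \<Longrightarrow> J \<kappa> v \<le> c"
        using compact_const[of u \<kappa> 0] u(1) by blast
      have "J \<kappa> v \<le> - real N" for N :: nat
      proof (rule v[OF tendsto_const])
        show "\<forall>\<^sub>F k in sequentially. J \<kappa> (u (r k)) \<le> - real N"
          using eventually_ge_at_top[of N]
        proof eventually_elim
          case (elim k)
          then have "N \<le> r k" using seq_suble[OF r, of k] by simp
          then show ?case using u(2)[of "r k"] by simp
        qed
      qed
      moreover obtain N :: nat where "- J \<kappa> v < real N" using reals_Archimedean2 by blast
      ultimately show False by (metis minus_less_iff not_le)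
    qed
    define m where "m = Inf (J \<kappa> ` X)"
    have m: "m \<le> J \<kappa> x" if "x \<in> X" for x unfolding m_def using bdd that by (intro cInf_lower) auto
    have "\<exists>x\<in>X. J \<kappa> x < m + inverse (real (Suc k))" for k
      using cInf_lessD[of "J \<kappa> ` X" "m + inverse (real (Suc k))"] p(1) by (auto simp: m_def)
    then obtain u where u: "\<And>k. u k \<in> X" "\<And>k. J \<kappa> (u k) < m + inverse (real (Suc k))" by metis
    have "J \<kappa> (u k) \<le> m + 1" for k
    proof -
      have "inverse (real (Suc k)) \<le> 1" by (simp add: field_simps)
      then show ?thesis using u(2)[of k] by linarith
    qed
    then obtain r v where r: "strict_mono (r :: nat \<Rightarrow> nat)" "v \<in> X" and
        v: "\<And>a c. a \<longlonglongrightarrow> c \<Longrightarrow> (\<forall>\<^sub>F k in sequentially. J \<kappa> (u (r k)) \<le> a k) \<Longrightarrow> J \<kappa> v \<le> c"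
      using compact_const[of u \<kappa> "m + 1"] u(1) by blast
    have "(\<lambda>k. m + inverse (real (Suc k))) \<longlonglongrightarrow> m + 0"
      by (intro tendsto_add tendsto_const LIMSEQ_inverse_real_of_nat)
    from LIMSEQ_subseq_LIMSEQ[OF this r(1)]
    have "(\<lambda>k. m + inverse (real (Suc (r k)))) \<longlonglongrightarrow> m" by (simp add: o_def)
    then have "J \<kappa> v \<le> m"
      by (rule v) (use u(2) in \<open>auto intro!: always_eventually less_imp_le\<close>)
    then have "is_global_min_on (J \<kappa>) X v" using m r(2) unfolding is_global_min_on_def by force
    then show ?thesis ..
  qed
  \<comment> \<open>Parameters with a minimizer on which \<open>B\<close> is nonnegative (\<open>\<sigma> = 1\<close>) or nonpositive (\<open>\<sigma> = -1\<close>).\<close>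
  define S where "S \<sigma> = {\<kappa>. \<exists>u. is_global_min_on (J \<kappa>) X u \<and> 0 \<le> \<sigma> * B u}" for \<sigma> :: real
  have closed: "closed (S \<sigma>)" for \<sigma>
    unfolding closed_sequential_limits
  proof (intro allI impI, elim conjE)
    fix \<kappa> l assume "\<forall>n. \<kappa> n \<in> S \<sigma>" and lim: "\<kappa> \<longlonglongrightarrow> l"
    then obtain u where u: "\<And>k. is_global_min_on (J (\<kappa> k)) X (u k)" "\<And>k. 0 \<le> \<sigma> * B (u k)"
      unfolding S_def by (simp add: Bex_def) metis
    have uX: "u k \<in> X" for k using u(1) by (simp add: is_global_min_on_def)
    have min: "J (\<kappa> k) (u k) \<le> J (\<kappa> k) x" if "x \<in> X" for k x
      using u(1) that by (simp add: is_global_min_on_def)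
    have "Bseq \<kappa>" using lim by (intro convergent_imp_Bseq convergentI)
    then obtain \<Lambda> where \<Lambda>: "\<And>k. \<bar>\<kappa> k\<bar> \<le> \<Lambda>" by (auto simp: Bseq_def)
    have "A (u k) + \<kappa> k * B (u k) \<le> A p + \<Lambda> * \<bar>B p\<bar>" for k
    proof -
      have "\<kappa> k * B p \<le> \<bar>\<kappa> k\<bar> * \<bar>B p\<bar>" by (metis abs_ge_self abs_mult)
      also have "\<dots> \<le> \<Lambda> * \<bar>B p\<bar>" using \<Lambda> by (intro mult_right_mono) auto
      finally show ?thesis using min[OF p(1), of k] by (simp add: J_def)
    qed
    then obtain r v where r: "strict_mono (r :: nat \<Rightarrow> nat)" "v \<in> X" and Bl: "(\<lambda>k. B (u (r k))) \<longlonglongrightarrow> B v"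
      and Al: "\<And>a c. a \<longlonglongrightarrow> c \<Longrightarrow> (\<forall>\<^sub>F k in sequentially. A (u (r k)) \<le> a k) \<Longrightarrow> A v \<le> c"
      using compact[of u \<kappa> \<Lambda>, OF uX \<Lambda>] by blast
    have lr: "(\<lambda>k. \<kappa> (r k)) \<longlonglongrightarrow> l" using LIMSEQ_subseq_LIMSEQ[OF lim r(1)] by (simp add: o_def)
    have "J l v \<le> J l x" if x: "x \<in> X" for x
    proof -
      have "(\<lambda>k. A x + \<kappa> (r k) * B x - \<kappa> (r k) * B (u (r k))) \<longlonglongrightarrow> A x + l * B x - l * B v"
        by (intro tendsto_intros lr Bl)
      moreover have "\<forall>\<^sub>F k in sequentially. A (u (r k)) \<le> A x + \<kappa> (r k) * B x - \<kappa> (r k) * B (u (r k))"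
      proof (intro always_eventually allI)
        fix k show "A (u (r k)) \<le> A x + \<kappa> (r k) * B x - \<kappa> (r k) * B (u (r k))"
          using min[OF x, of "r k"] by (simp add: J_def)
      qed
      ultimately have "A v \<le> A x + l * B x - l * B v" by (rule Al)
      then show ?thesis by (simp add: J_def)
    qed
    then have "is_global_min_on (J l) X v" using r(2) by (simp add: is_global_min_on_def)
    moreover have "(\<lambda>k. \<sigma> * B (u (r k))) \<longlonglongrightarrow> \<sigma> * B v" by (intro tendsto_intros Bl)
    then have "0 \<le> \<sigma> * B v" by (rule LIMSEQ_le_const) (use u(2) in auto)
    ultimately show "l \<in> S \<sigma>" unfolding S_def by blast
  qed
  have nonempty: "S \<sigma> \<noteq> {}" if \<sigma>: "\<bar>\<sigma>\<bar> = 1" and x: "x \<in> X" "0 < \<sigma> * B x" for \<sigma> x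
  proof -
    obtain u0 where u0: "is_global_min_on (J 0) X u0" using ex by blast
    define s where "s = (\<bar>A x - A u0\<bar> + 1) / (\<sigma> * B x)"
    have s: "s > 0" "s * (\<sigma> * B x) = \<bar>A x - A u0\<bar> + 1" using x by (auto simp: s_def)
    obtain u where u: "is_global_min_on (J (- \<sigma> * s)) X u" using ex by blast
    have uX: "u \<in> X" using u by (simp add: is_global_min_on_def)
    have 1: "A u0 \<le> A u" using u0 uX by (simp add: is_global_min_on_def J_def)
    have "A u - s * (\<sigma> * B u) \<le> A x - s * (\<sigma> * B x)"
      using u x(1) by (simp add: is_global_min_on_def J_def algebra_simps)
    then have "A u0 - s * (\<sigma> * B u) < A u0" using 1 s(2) by linarith
    then have "0 < s * (\<sigma> * B u)" by linarith
    then have "0 < \<sigma> * B u" using s(1) by (rule zero_less_mult_pos)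
    then have "0 \<le> \<sigma> * B u" by (rule less_imp_le)
    then show ?thesis using u unfolding S_def by blast
  qed
  have cover: "UNIV \<subseteq> S 1 \<union> S (-1)"
  proof
    fix \<kappa> :: real
    obtain u where "is_global_min_on (J \<kappa>) X u" using ex by blast
    moreover have "0 \<le> 1 * B u \<or> 0 \<le> -1 * B u" by linarith
    ultimately show "\<kappa> \<in> S 1 \<union> S (-1)" unfolding S_def by blast
  qed
  have "S 1 \<noteq> {}" "S (-1) \<noteq> {}" using nonempty[of 1 q] nonempty[of "-1" p] p q by auto
  then have "S 1 \<inter> S (-1) \<noteq> {}"
    using connected_closed[of "UNIV :: real set"] connected_UNIV closed cover by (metis inf_top_right)
  then obtain \<kappa> u1 u2 where "is_global_min_on (J \<kappa>) X u1" "0 \<le> -1 * B u1"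
    "is_global_min_on (J \<kappa>) X u2" "0 \<le> 1 * B u2" unfolding S_def by blast
  then show thesis by (intro that[of \<kappa> u1 u2]) (simp_all add: J_def[abs_def])
qed

context relativistic_setting
begin

text \<open>
  The case distinction at the end of the proof asks whether, for some penalty parameter, the minimizers
  on the two sides of the level \<open>c\<close> differ.  If they never do, the penalty parameters
  \<open>1, 2, \<dots>\<close> produce a sequence whose limit is a constant in the level set at which the integral of \<open>G\<close>
  equals \<open>c\<close>, and \<open>c\<close> is chosen so that there is none.
\<close>

theorem two_minimizers:
  assumes F: "F \<in> class_B T" and G: "G \<in> class_B T" and H: "C1_on UNIV H"
    and \<beta>: "\<beta> \<in> Linfty T"
    and sign: "AE t in lebesgue_on {0..T}. \<forall>x. 0 \<le> \<beta> t * (H x - \<gamma>)"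
    and nonzero: "AE t in lebesgue_on {0..T}. \<beta> t \<noteq> 0"
    and coercive: "\<And>\<Lambda> B \<mu>. 0 \<le> \<Lambda> \<Longrightarrow> \<exists>\<rho>. AE t in lebesgue_on {0..T}. \<forall>x l. \<rho> \<le> norm x \<longrightarrow> \<bar>l\<bar> \<le> \<Lambda> \<longrightarrow>
     B \<le> F t x + l * G t x + \<mu> * (\<beta> t * (H x - \<gamma>))"
    and count: "countable (H -` {\<gamma>})" and vw: "v \<in> H -` {\<gamma>}" "w \<in> H -` {\<gamma>}"
    and less: "(LINT t|lebesgue_on {0..T}. G t v) < (LINT t|lebesgue_on {0..T}. G t w)"
  obtains l \<mu> u\<^sub>1 u\<^sub>2 where "\<exists>t\<in>{0..T}. u\<^sub>1 t \<noteq> u\<^sub>2 t"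
    "is_global_min_on (energy T \<Phi> (\<lambda>t x. F t x + l * G t x + \<mu> * (\<beta> t * (H x - \<gamma>)))) (K_set L T) u\<^sub>1"
    "is_global_min_on (energy T \<Phi> (\<lambda>t x. F t x + l * G t x + \<mu> * (\<beta> t * (H x - \<gamma>)))) (K_set L T) u\<^sub>2"
proof -
  define W where "W t x = \<beta> t * (H x - \<gamma>)" for t x
  have admF: "admissible T F" and admG: "admissible T G" using F G by (auto intro: class_B_admissible)
  have admW: "admissible T W" unfolding W_def[abs_def] by (rule admissible_weight[OF \<beta> H])
  define Q where "Q l \<mu> t x = F t x + l * G t x + \<mu> * W t x" for l \<mu> t x
  have admQ: "admissible T (Q l \<mu>)" for l \<mu>
    unfolding Q_def[abs_def] by (intro admissible_add_cmult admF admG admW)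
  define pot where "pot P u = (LINT t|lebesgue_on {0..T}. P t (u t))" for P :: "real \<Rightarrow> real^'n \<Rightarrow> real" and u
  have potQ: "pot (Q l \<mu>) u = pot F u + l * pot G u + \<mu> * pot W u" if "u \<in> K_set L T" for u l \<mu>
    unfolding pot_def Q_def
    using admissible_integrable(1)[OF admF K_continuous[OF that]]
      admissible_integrable(1)[OF admG K_continuous[OF that]]
      admissible_integrable(1)[OF admW K_continuous[OF that]] by simp
  obtain M where M: "\<And>x. x \<in> cball 0 L \<Longrightarrow> \<bar>\<Phi> x\<bar> \<le> M" using Phi_bound by metis
  have compactness: "\<exists>r x. strict_mono (r :: nat \<Rightarrow> nat) \<and> x \<in> K_set L T \<and>
      (\<forall>P. admissible T P \<longrightarrow> (\<lambda>k. pot P (u (r k))) \<longlonglongrightarrow> pot P x) \<and>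
      (\<forall>a c. a \<longlonglongrightarrow> c \<longrightarrow> (\<forall>\<^sub>F k in sequentially. kinetic (u (r k)) \<le> a k) \<longrightarrow> kinetic x \<le> c)"
    if uK: "\<And>k. u k \<in> K_set L T" and l: "\<And>k. \<bar>l k\<bar> \<le> \<Lambda>" and C: "\<And>k. kinetic (u k) + pot (Q (l k) \<mu>) (u k) \<le> C"
    for u :: "nat \<Rightarrow> real \<Rightarrow> real^'n" and l \<Lambda> C \<mu>
  proof -
    have \<Lambda>: "0 \<le> \<Lambda>" using l[of 0] by simp
    define B where "B = M + (\<bar>C\<bar> + 1) / T"
    obtain \<rho> where \<rho>: "AE t in lebesgue_on {0..T}. \<forall>x l. \<rho> \<le> norm x \<longrightarrow> \<bar>l\<bar> \<le> \<Lambda> \<longrightarrow> B \<le> Q l \<mu> t x"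
      using coercive[OF \<Lambda>, of B \<mu>] unfolding Q_def W_def by blast
    have bd: "norm (u k 0) \<le> \<rho> + L * T" for k
    proof (rule ccontr)
      assume "\<not> norm (u k 0) \<le> \<rho> + L * T"
      then have big: "\<rho> + L * T \<le> norm (u k 0)" by simp
      have "AE t in lebesgue_on {0..T}. \<forall>x. \<rho> \<le> norm x \<longrightarrow> B \<le> Q (l k) \<mu> t x"
        using \<rho> by eventually_elim (use l in blast)
      from energy_coercive[OF admQ uK this M big]
      have "T * (B - M) \<le> C" using C[of k] by (simp add: pot_def)
      moreover have "T * (B - M) = \<bar>C\<bar> + 1" using T_pos by (simp add: B_def)
      ultimately show False by linarith
    qed
    show ?thesis unfolding pot_def by (rule K_sequentially_compact[OF uK bd])
  qed
  \<comment> \<open>A level \<open>c\<close> strictly between the values at \<open>v\<close> and \<open>w\<close> that no constant in the level set attains.\<close>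
  define gc where "gc x = (LINT t|lebesgue_on {0..T}. G t x)" for x
  have "countable (gc ` (H -` {\<gamma>}))" using count by (rule countable_image)
  moreover have "uncountable {gc v<..<gc w}" using less by (simp add: gc_def uncountable_open_interval)
  ultimately have "\<not> {gc v<..<gc w} \<subseteq> gc ` (H -` {\<gamma>})" using countable_subset by blast
  then obtain c where "c \<in> {gc v<..<gc w}" "c \<notin> gc ` (H -` {\<gamma>})" by blast
  then have c: "gc v < c" "c < gc w" "c \<notin> gc ` (H -` {\<gamma>})" by simp_all
  define B where "B u = pot G u - c" for u
  define A where "A \<mu> u = kinetic u + pot (Q 0 \<mu>) u" for \<mu> u
  define cv cw where "cv = (\<lambda>_::real. v)" and "cw = (\<lambda>_::real. w)"
  have cK: "cv \<in> K_set L T" "cw \<in> K_set L T" unfolding cv_def cw_def by (rule K_const)+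
  have Bcv: "B cv < 0" and Bcw: "0 < B cw" using c by (simp_all add: B_def pot_def cv_def cw_def gc_def)
  have Wcv: "pot W cv = 0" and Wcw: "pot W cw = 0" using vw by (simp_all add: pot_def cv_def cw_def W_def)
  have AB: "A \<mu> u + l * B u = kinetic u + pot (Q l \<mu>) u - l * c" if "u \<in> K_set L T" for l \<mu> u
    using potQ[OF that] by (simp add: A_def B_def algebra_simps)
  have minAB: "is_global_min_on (energy T \<Phi> (Q l \<mu>)) (K_set L T) u"
    if "is_global_min_on (\<lambda>u. A \<mu> u + l * B u) (K_set L T) u" for l \<mu> u
    unfolding is_global_min_on_def
  proof (intro conjI ballI)
    show uK: "u \<in> K_set L T" using that by (simp add: is_global_min_on_def)
    fix z :: "real \<Rightarrow> real^'n" assume z: "z \<in> K_set L T"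
    then have "A \<mu> u + l * B u \<le> A \<mu> z + l * B z" using that by (simp add: is_global_min_on_def)
    then show "energy T \<Phi> (Q l \<mu>) u \<le> energy T \<Phi> (Q l \<mu>) z"
      unfolding AB[OF uK] AB[OF z] energy_eq[OF uK admQ] energy_eq[OF z admQ] by (simp add: pot_def)
  qed
  have two: "\<exists>l u\<^sub>1 u\<^sub>2. is_global_min_on (\<lambda>u. A \<mu> u + l * B u) (K_set L T) u\<^sub>1 \<and> B u\<^sub>1 \<le> 0 \<and>
      is_global_min_on (\<lambda>u. A \<mu> u + l * B u) (K_set L T) u\<^sub>2 \<and> 0 \<le> B u\<^sub>2" for \<mu>
  proof (rule two_sided_minimizers[of "K_set L T" "A \<mu>" B, OF _ cK(1) Bcv cK(2) Bcw])
    fix l :: "nat \<Rightarrow> real" and u :: "nat \<Rightarrow> real \<Rightarrow> real^'n" and C \<Lambda>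
    assume uK: "\<And>k. u k \<in> K_set L T" and l: "\<And>k. \<bar>l k\<bar> \<le> \<Lambda>" and C: "\<And>k. A \<mu> (u k) + l k * B (u k) \<le> C"
    have "kinetic (u k) + pot (Q (l k) \<mu>) (u k) \<le> C + \<Lambda> * \<bar>c\<bar>" for k
    proof -
      have "l k * c \<le> \<bar>l k\<bar> * \<bar>c\<bar>" by (metis abs_ge_self abs_mult)
      also have "\<dots> \<le> \<Lambda> * \<bar>c\<bar>" using l by (intro mult_right_mono) auto
      finally show ?thesis using C[of k] AB[OF uK[of k], of \<mu> "l k"] by linarith
    qed
    from compactness[of u l \<Lambda> \<mu>, OF uK l this] obtain r x where r: "strict_mono (r :: nat \<Rightarrow> nat)" "x \<in> K_set L T"
      and pl: "\<And>P. admissible T P \<Longrightarrow> (\<lambda>k. pot P (u (r k))) \<longlonglongrightarrow> pot P x"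
      and kl: "\<And>a c. a \<longlonglongrightarrow> c \<Longrightarrow> (\<forall>\<^sub>F k in sequentially. kinetic (u (r k)) \<le> a k) \<Longrightarrow> kinetic x \<le> c"
      by blast
    have "(\<lambda>k. B (u (r k))) \<longlonglongrightarrow> B x" unfolding B_def by (intro tendsto_intros pl admG)
    moreover have "A \<mu> x \<le> d" if a: "a \<longlonglongrightarrow> d" "\<forall>\<^sub>F k in sequentially. A \<mu> (u (r k)) \<le> a k" for a d
    proof -
      have "(\<lambda>k. a k - pot (Q 0 \<mu>) (u (r k))) \<longlonglongrightarrow> d - pot (Q 0 \<mu>) x" by (intro tendsto_intros a pl admQ)
      moreover have "\<forall>\<^sub>F k in sequentially. kinetic (u (r k)) \<le> a k - pot (Q 0 \<mu>) (u (r k))"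
        using a(2) by eventually_elim (simp add: A_def)
      ultimately have "kinetic x \<le> d - pot (Q 0 \<mu>) x" by (rule kl)
      then show ?thesis by (simp add: A_def)
    qed
    ultimately show "\<exists>r v. strict_mono (r :: nat \<Rightarrow> nat) \<and> v \<in> K_set L T \<and> (\<lambda>k. B (u (r k))) \<longlonglongrightarrow> B v \<and>
        (\<forall>a c. a \<longlonglongrightarrow> c \<longrightarrow> (\<forall>\<^sub>F k in sequentially. A \<mu> (u (r k)) \<le> a k) \<longrightarrow> A \<mu> v \<le> c)"
      using r by blast
  qed blast
  show thesis
  proof (cases "\<exists>\<mu> l u\<^sub>1 u\<^sub>2. is_global_min_on (\<lambda>u. A \<mu> u + l * B u) (K_set L T) u\<^sub>1 \<and>
      is_global_min_on (\<lambda>u. A \<mu> u + l * B u) (K_set L T) u\<^sub>2 \<and> (\<exists>t\<in>{0..T}. u\<^sub>1 t \<noteq> u\<^sub>2 t)")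
    case True
    then obtain \<mu> l u1 u2 where *: "is_global_min_on (\<lambda>u. A \<mu> u + l * B u) (K_set L T) u1"
      "is_global_min_on (\<lambda>u. A \<mu> u + l * B u) (K_set L T) u2" and ne: "\<exists>t\<in>{0..T}. u1 t \<noteq> u2 t" by blast
    show thesis
      using minAB[OF *(1)] minAB[OF *(2)] unfolding Q_def[abs_def] W_def by (rule that[OF ne])
  next
    case False
    have "\<exists>u. u \<in> K_set L T \<and> B u = 0 \<and> A (real (Suc n)) u \<le> max (A 0 cv) (A 0 cw)" for n
    proof -
      define \<mu> where "\<mu> = real (Suc n)"
      obtain l u1 u2 where u1: "is_global_min_on (\<lambda>u. A \<mu> u + l * B u) (K_set L T) u1" "B u1 \<le> 0"
        and u2: "is_global_min_on (\<lambda>u. A \<mu> u + l * B u) (K_set L T) u2" "0 \<le> B u2"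
        using two by blast
      have "u1 t = u2 t" if "t \<in> {0..T}" for t using False u1(1) u2(1) that by blast
      then have "pot G u1 = pot G u2" unfolding pot_def by (intro Bochner_Integration.integral_cong) auto
      then have B0: "B u1 = 0" using u1(2) u2(2) by (simp add: B_def)
      have A0: "A \<mu> z = A 0 z" if "z \<in> K_set L T" "pot W z = 0" for z
        using potQ[OF that(1)] that(2) by (simp add: A_def)
      have min: "A \<mu> u1 \<le> A \<mu> z + l * B z" if "z \<in> K_set L T" for z
        using u1(1) that B0 by (auto simp: is_global_min_on_def)
      have "A \<mu> u1 \<le> max (A 0 cv) (A 0 cw)"
      proof (cases "0 \<le> l")
        case True
        then have "l * B cv \<le> 0" using Bcv by (simp add: mult_nonneg_nonpos)
        then show ?thesis using min[OF cK(1)] A0[OF cK(1) Wcv] by simp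
      next
        case False
        then have "l * B cw \<le> 0" using Bcw by (simp add: mult_nonpos_nonneg)
        then show ?thesis using min[OF cK(2)] A0[OF cK(2) Wcw] by simp
      qed
      then show ?thesis using B0 u1(1) by (auto simp: is_global_min_on_def \<mu>_def)
    qed
    then obtain u where uK: "\<And>n. u n \<in> K_set L T" and uB: "\<And>n. B (u n) = 0"
      and uA: "\<And>n. A (real (Suc n)) (u n) \<le> max (A 0 cv) (A 0 cw)" by metis
    define C where "C = max (A 0 cv) (A 0 cw)"
    have Wnn: "0 \<le> pot W z" for z
      unfolding pot_def using sign by (intro integral_nonneg_AE) (auto simp: W_def elim!: eventually_mono)
    have split: "A (real (Suc n)) (u n) = A 0 (u n) + real (Suc n) * pot W (u n)" for n
      using potQ[OF uK[of n]] by (simp add: A_def)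
    have "0 \<le> real (Suc n) * pot W (u n)" for n using Wnn[of "u n"] by simp
    then have A0C: "A 0 (u n) \<le> C" for n using uA[of n] split[of n] unfolding C_def by (smt (verit))
    \<comment> \<open>The penalty of the limit \<open>x\<close> vanishes, because the energies along \<open>u\<close> stay bounded.\<close>
    obtain r x where r: "strict_mono (r :: nat \<Rightarrow> nat)" and xK: "x \<in> K_set L T"
      and pl: "\<And>P. admissible T P \<Longrightarrow> (\<lambda>k. pot P (u (r k))) \<longlonglongrightarrow> pot P x"
      using compactness[of u "\<lambda>_. 0" 0 0 C, OF uK] A0C unfolding A_def by auto
    have "(\<lambda>k. B (u (r k))) \<longlonglongrightarrow> B x" unfolding B_def by (intro tendsto_intros pl admG)
    then have Bx: "B x = 0" using uB by (simp add: LIMSEQ_const_iff)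
    have kin: "- (M * T) \<le> kinetic z" if z: "z \<in> K_set L T" for z
    proof -
      have "(LINT t|lebesgue_on {0..T}. - M) \<le> kinetic z"
        unfolding kinetic_def
      proof (rule integral_mono_AE)
        show "AE t in lebesgue_on {0..T}. - M \<le> \<Phi> (tderiv T z t)"
          using K_AE[OF z]
        proof eventually_elim
          case (elim t) then show ?case using M[of "tderiv T z t"] by simp
        qed
      qed (use kinetic_integrable[OF z] in auto)
      then show ?thesis using T_pos by (simp add: measure_restrict_space mult.commute)
    qed
    have Wle: "pot W (u n) \<le> (C + M * T - pot (Q 0 0) (u n)) * inverse (real (Suc n))" for n
    proof -
      have "real (Suc n) * pot W (u n) \<le> C - A 0 (u n)" using uA[of n] split[of n] unfolding C_def by linarith
      also have "\<dots> \<le> C + M * T - pot (Q 0 0) (u n)" using kin[OF uK[of n]] by (simp add: A_def)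
      finally have "pot W (u n) \<le> (C + M * T - pot (Q 0 0) (u n)) / real (Suc n)"
        by (simp add: le_divide_eq mult.commute del: of_nat_Suc)
      then show ?thesis by (simp only: divide_inverse)
    qed
    have "(\<lambda>k. inverse (real (Suc (r k)))) \<longlonglongrightarrow> 0"
      using LIMSEQ_subseq_LIMSEQ[OF LIMSEQ_inverse_real_of_nat r] by (simp add: o_def)
    then have Wlim: "(\<lambda>k. (C + M * T - pot (Q 0 0) (u (r k))) * inverse (real (Suc (r k))))
        \<longlonglongrightarrow> (C + M * T - pot (Q 0 0) x) * 0"
      by (intro tendsto_intros pl admQ)
    have "pot W x \<le> (C + M * T - pot (Q 0 0) x) * 0"
      by (rule LIMSEQ_le[OF pl[OF admW] Wlim]) (use Wle in blast)
    then have "pot W x \<le> 0" by simp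
    then have "(LINT t|lebesgue_on {0..T}. W t (x t)) = 0" using Wnn[of x] by (simp add: pot_def)
    moreover have "AE t in lebesgue_on {0..T}. 0 \<le> W t (x t)" using sign by (auto simp: W_def elim!: eventually_mono)
    ultimately have "AE t in lebesgue_on {0..T}. W t (x t) = 0"
      using integral_nonneg_eq_0_iff_AE[OF admissible_integrable(1)[OF admW K_continuous[OF xK]]] by simp
    then have "AE t in lebesgue_on {0..T}. H (x t) = \<gamma>"
      using nonzero by eventually_elim (simp add: W_def)
    moreover have "continuous_on {0..T} (\<lambda>t. H (x t))"
      by (rule continuous_on_compose2[OF C1_on_continuous[OF H] K_continuous[OF xK]]) auto
    ultimately have "H (x t) = \<gamma>" if "t \<in> {0..T}" for t
      using continuous_level_AE[OF T_pos] that by blast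
    then have level: "x t \<in> H -` {\<gamma>}" if "t \<in> {0..T}" for t
      using that by simp
    have conn: "connected (x ` {0..T})" by (intro connected_continuous_image K_continuous[OF xK] connected_Icc)
    have cnt: "countable (x ` {0..T})" by (rule countable_subset[OF _ count]) (use level in auto)
    have const: "x t = x 0" if t: "t \<in> {0..T}" for t
    proof -
      have "x t \<in> x ` {0..T}" "x 0 \<in> x ` {0..T}" using t by auto
      then show ?thesis using connected_uncountable[OF conn] cnt by metis
    qed
    have "pot G x = gc (x 0)"
      unfolding pot_def gc_def
    proof (rule Bochner_Integration.integral_cong[OF refl])
      fix t assume "t \<in> space (lebesgue_on {0..T})"
      then have "x t = x 0" by (intro const) simp
      then show "G t (x t) = G t (x 0)" by (rule arg_cong)
    qed
    then have "c = gc (x 0)" using Bx by (simp add: B_def)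
    then show thesis using c(3) level[of 0] T_pos by auto
  qed
qed

end

section \<open>The multiplicity theorem\<close>

lemma growth_bounds:
  fixes F G :: "real \<Rightarrow> real^'n \<Rightarrow> real" and H :: "real^'n \<Rightarrow> real"
  assumes T: "T > 0"
    and F: "((\<lambda>x. (INF t\<in>{0..T}. ereal (F t x)) / ereal (norm x powr q)) \<longlongrightarrow> \<infinity>) at_infinity"
    and GH: "Limsup at_infinity
          (\<lambda>x. ((SUP t\<in>{0..T}. ereal \<bar>G t x\<bar>) + ereal \<bar>H x\<bar>) / ereal (norm x powr q)) < \<infinity>"
  shows "\<And>b. \<exists>\<rho>>0. \<forall>x. \<rho> \<le> norm x \<longrightarrow> (\<forall>t\<in>{0..T}. b * norm x powr q \<le> F t x)"
    and "\<exists>C\<ge>0. \<exists>\<rho>>0. \<forall>x. \<rho> \<le> norm x \<longrightarrow> \<bar>H x\<bar> \<le> C * norm x powr q \<and>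
      (\<forall>t\<in>{0..T}. \<bar>G t x\<bar> \<le> C * norm x powr q)"
proof -
  fix b
  have "\<forall>\<^sub>F x in at_infinity. ereal b < (INF t\<in>{0..T}. ereal (F t x)) / ereal (norm x powr q)"
    using F by (simp add: tendsto_PInfty)
  then obtain \<rho> where \<rho>: "\<And>x. \<rho> \<le> norm x \<Longrightarrow> ereal b < (INF t\<in>{0..T}. ereal (F t x)) / ereal (norm x powr q)"
    by (auto simp: eventually_at_infinity)
  show "\<exists>\<rho>>0. \<forall>x. \<rho> \<le> norm x \<longrightarrow> (\<forall>t\<in>{0..T}. b * norm x powr q \<le> F t x)"
  proof (intro exI[of _ "max \<rho> 1"] conjI allI impI ballI)
    fix x :: "real^'n" and t assume x: "max \<rho> 1 \<le> norm x" and t: "t \<in> {0..T}"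
    then have "x \<noteq> 0" by auto
    then have "0 < ereal (norm x powr q)" by simp
    then have "ereal (norm x powr q) * ereal b < (INF t\<in>{0..T}. ereal (F t x))"
      using \<rho>[of x] x by (subst ereal_less_divide_pos[symmetric]) auto
    also have "\<dots> \<le> ereal (F t x)" using t by (rule INF_lower)
    finally show "b * norm x powr q \<le> F t x" by (simp add: mult.commute)
  qed simp
next
  obtain C where C: "Limsup at_infinity
          (\<lambda>x. ((SUP t\<in>{0..T}. ereal \<bar>G t x\<bar>) + ereal \<bar>H x\<bar>) / ereal (norm x powr q)) < ereal C"
    using ereal_dense2[OF GH] by auto
  from Limsup_lessD[OF C] obtain \<rho> where \<rho>: "\<And>x. \<rho> \<le> norm x \<Longrightarrow>
      ((SUP t\<in>{0..T}. ereal \<bar>G t x\<bar>) + ereal \<bar>H x\<bar>) / ereal (norm x powr q) < ereal C"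
    by (auto simp: eventually_at_infinity)
  have key: "\<bar>G t x\<bar> + \<bar>H x\<bar> \<le> C * norm x powr q" if x: "max \<rho> 1 \<le> norm x" and t: "t \<in> {0..T}" for x t
  proof -
    have "x \<noteq> 0" using x by auto
    then have p: "0 < ereal (norm x powr q)" by simp
    have "ereal \<bar>G t x\<bar> + ereal \<bar>H x\<bar> \<le> (SUP t\<in>{0..T}. ereal \<bar>G t x\<bar>) + ereal \<bar>H x\<bar>"
      using t by (intro add_right_mono SUP_upper)
    also have "\<dots> < ereal (norm x powr q) * ereal C"
      using \<rho>[of x] x p by (subst ereal_divide_less_pos[symmetric]) auto
    finally show ?thesis by (simp add: mult.commute)
  qed
  show "\<exists>C\<ge>0. \<exists>\<rho>>0. \<forall>x. \<rho> \<le> norm x \<longrightarrow> \<bar>H x\<bar> \<le> C * norm x powr q \<and>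
      (\<forall>t\<in>{0..T}. \<bar>G t x\<bar> \<le> C * norm x powr q)"
  proof (rule exI[of _ "max C 0"], rule conjI, simp, rule exI[of _ "max \<rho> 1"],
      intro conjI allI impI ballI)
    fix x :: "real^'n" assume x: "max \<rho> 1 \<le> norm x"
    have C': "C * norm x powr q \<le> max C 0 * norm x powr q" by (intro mult_right_mono) auto
    show "\<bar>H x\<bar> \<le> max C 0 * norm x powr q" using key[OF x, of 0] T C' by simp
    fix t assume "t \<in> {0..T}"
    then show "\<bar>G t x\<bar> \<le> max C 0 * norm x powr q" using key[OF x, of t] C' by simp
  qed auto
qed

text \<open>
  The growth of \<open>F\<close> is uniform against all \<open>l\<close> in a bounded interval, which allows the parameter to
  vary along a minimizing sequence.
\<close>

lemma perturbation_coercive: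
  fixes F G :: "real \<Rightarrow> real^'n \<Rightarrow> real" and H :: "real^'n \<Rightarrow> real"
  assumes q: "q > 0"
    and F: "\<And>b. \<exists>\<rho>>0. \<forall>x. \<rho> \<le> norm x \<longrightarrow> (\<forall>t\<in>{0..T}. b * norm x powr q \<le> F t x)"
    and GH: "\<exists>C\<ge>0. \<exists>\<rho>>0. \<forall>x. \<rho> \<le> norm x \<longrightarrow> \<bar>H x\<bar> \<le> C * norm x powr q \<and>
      (\<forall>t\<in>{0..T}. \<bar>G t x\<bar> \<le> C * norm x powr q)"
    and \<beta>: "AE t in lebesgue_on {0..T}. \<bar>\<beta> t\<bar> \<le> D"
    and \<Lambda>: "0 \<le> \<Lambda>"
  shows "\<exists>\<rho>. AE t in lebesgue_on {0..T}. \<forall>x l. \<rho> \<le> norm x \<longrightarrow> \<bar>l\<bar> \<le> \<Lambda> \<longrightarrow>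
     B \<le> F t x + l * G t x + \<mu> * (\<beta> t * (H x - \<gamma>))"
proof -
  obtain C \<rho>1 where C: "C \<ge> 0" "\<rho>1 > 0" "\<And>x. \<rho>1 \<le> norm x \<Longrightarrow> \<bar>H x\<bar> \<le> C * norm x powr q"
    "\<And>x t. \<rho>1 \<le> norm x \<Longrightarrow> t \<in> {0..T} \<Longrightarrow> \<bar>G t x\<bar> \<le> C * norm x powr q"
    using GH by blast
  define D' where "D' = \<bar>D\<bar>"
  \<comment> \<open>\<open>b\<close> absorbs both perturbations and leaves one more \<open>norm x powr q\<close>, which beats the constants in \<open>B'\<close>.\<close>
  define b where "b = \<Lambda> * C + \<bar>\<mu>\<bar> * (D' * C) + 1"
  obtain \<rho>2 where \<rho>2: "\<rho>2 > 0" "\<And>x t. \<rho>2 \<le> norm x \<Longrightarrow> t \<in> {0..T} \<Longrightarrow> b * norm x powr q \<le> F t x"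
    using F[of b] by blast
  define B' where "B' = \<bar>B\<bar> + \<bar>\<mu>\<bar> * (D' * \<bar>\<gamma>\<bar>) + 1"
  have B': "B' > 0" unfolding B'_def D'_def by (intro add_nonneg_pos add_nonneg_nonneg mult_nonneg_nonneg) auto
  define \<rho> where "\<rho> = max (max \<rho>1 \<rho>2) (B' powr (1/q))"
  have "AE t in lebesgue_on {0..T}. \<forall>x l. \<rho> \<le> norm x \<longrightarrow> \<bar>l\<bar> \<le> \<Lambda> \<longrightarrow>
     B \<le> F t x + l * G t x + \<mu> * (\<beta> t * (H x - \<gamma>))"
    using \<beta> AE_lebesgue_on_mem[of T]
  proof eventually_elim
    case (elim t)
    show ?case
    proof (intro allI impI)
      fix x :: "real^'n" and l :: real assume x: "\<rho> \<le> norm x" and l: "\<bar>l\<bar> \<le> \<Lambda>"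
      define y where "y = norm x powr q"
      have "B' = (B' powr (1/q)) powr q" using q B' by (simp add: powr_powr)
      also have "\<dots> \<le> y" unfolding y_def using x q by (intro powr_mono2) (auto simp: \<rho>_def)
      finally have y: "B' \<le> y" .
      have Ft: "b * y \<le> F t x" using \<rho>2(2)[of x t] x elim by (simp add: \<rho>_def y_def)
      have "\<bar>l * G t x\<bar> \<le> \<Lambda> * (C * y)"
        unfolding abs_mult using l C(4)[of x t] x elim \<Lambda> by (intro mult_mono) (auto simp: \<rho>_def y_def)
      moreover have "\<bar>\<mu> * (\<beta> t * (H x - \<gamma>))\<bar> \<le> \<bar>\<mu>\<bar> * (D' * (C * y + \<bar>\<gamma>\<bar>))"
        unfolding abs_mult
      proof (intro mult_left_mono mult_mono)
        show "\<bar>\<beta> t\<bar> \<le> D'" using elim(1) by (simp add: D'_def)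
        have "\<bar>H x - \<gamma>\<bar> \<le> \<bar>H x\<bar> + \<bar>\<gamma>\<bar>" by linarith
        also have "\<bar>H x\<bar> \<le> C * y" using C(3)[of x] x by (simp add: \<rho>_def y_def)
        finally show "\<bar>H x - \<gamma>\<bar> \<le> C * y + \<bar>\<gamma>\<bar>" by simp
      qed (auto simp: D'_def)
      moreover have "b * y = \<Lambda> * (C * y) + \<bar>\<mu>\<bar> * (D' * (C * y)) + y"
        by (simp add: b_def algebra_simps)
      moreover have "\<bar>\<mu>\<bar> * (D' * (C * y + \<bar>\<gamma>\<bar>)) = \<bar>\<mu>\<bar> * (D' * (C * y)) + \<bar>\<mu>\<bar> * (D' * \<bar>\<gamma>\<bar>)"
        by (simp add: algebra_simps)
      ultimately show "B \<le> F t x + l * G t x + \<mu> * (\<beta> t * (H x - \<gamma>))"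
        using Ft y unfolding B'_def by linarith
    qed
  qed
  then show ?thesis by blast
qed

theorem theorem2p1:
  fixes L T :: real
    and \<phi> :: "real^'n \<Rightarrow> real^'n" and \<Phi> :: "real^'n \<Rightarrow> real"
    and F G :: "real \<Rightarrow> real^'n \<Rightarrow> real" and H :: "real^'n \<Rightarrow> real"
    and \<alpha> :: "real \<Rightarrow> real"
  assumes "L > 0" and "T > 0"
    and "\<phi> \<in> class_A L" and "is_potential L \<phi> \<Phi>"
    and "F \<in> class_B T" and "G \<in> class_B T" and "C1_on UNIV H"
    and a1: "\<exists>q>0.
        ((\<lambda>x. (INF t\<in>{0..T}. ereal (F t x)) / ereal (norm x powr q)) \<longlongrightarrow> \<infinity>) at_infinity \<and>
        Limsup at_infinity
          (\<lambda>x. ((SUP t\<in>{0..T}. ereal \<bar>G t x\<bar>) + ereal \<bar>H x\<bar>) / ereal (norm x powr q)) < \<infinity>"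
    and a2: "\<exists>\<gamma>::real. ereal \<gamma> \<in> {INF x. ereal (H x), SUP x. ereal (H x)} \<and>
        countable (H -` {\<gamma>}) \<and>
        (\<exists>v\<in>H -` {\<gamma>}. \<exists>w\<in>H -` {\<gamma>}.
           (LINT t|lebesgue_on {0..T}. G t v) \<noteq> (LINT t|lebesgue_on {0..T}. G t w))"
    and "\<alpha> \<in> Linfty T" and "constant_sign T \<alpha>"
    and "emeasure lebesgue {t\<in>{0..T}. \<alpha> t = 0} = 0"
  shows "\<exists>l m :: real.
      let P = (\<lambda>t x. F t x + l * G t x + m * \<alpha> t * H x) in
      \<exists>u\<^sub>1 u\<^sub>2 :: real \<Rightarrow> real^'n.
        (\<exists>t\<in>{0..T}. u\<^sub>1 t \<noteq> u\<^sub>2 t) \<and>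
        is_solution L T \<phi> P u\<^sub>1 \<and> is_global_min_on (energy T \<Phi> P) (K_set L T) u\<^sub>1 \<and>
        is_solution L T \<phi> P u\<^sub>2 \<and> is_global_min_on (energy T \<Phi> P) (K_set L T) u\<^sub>2"
proof -
  interpret relativistic_setting L T \<phi> \<Phi>
    using assms by unfold_locales auto
  obtain q where q: "q > 0"
    and qF: "((\<lambda>x. (INF t\<in>{0..T}. ereal (F t x)) / ereal (norm x powr q)) \<longlongrightarrow> \<infinity>) at_infinity"
    and qGH: "Limsup at_infinity
          (\<lambda>x. ((SUP t\<in>{0..T}. ereal \<bar>G t x\<bar>) + ereal \<bar>H x\<bar>) / ereal (norm x powr q)) < \<infinity>"
    using a1 by blast
  obtain \<gamma> where \<gamma>: "ereal \<gamma> \<in> {INF x. ereal (H x), SUP x. ereal (H x)}" "countable (H -` {\<gamma>})"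
    and neq: "\<exists>v\<in>H -` {\<gamma>}. \<exists>w\<in>H -` {\<gamma>}.
           (LINT t|lebesgue_on {0..T}. G t v) \<noteq> (LINT t|lebesgue_on {0..T}. G t w)"
    using a2 by blast
  obtain v w where vw: "v \<in> H -` {\<gamma>}" "w \<in> H -` {\<gamma>}"
    and less: "(LINT t|lebesgue_on {0..T}. G t v) < (LINT t|lebesgue_on {0..T}. G t w)"
    using neq by (metis linorder_neq_iff)
  \<comment> \<open>Signs \<open>\<sigma>\<close> and \<open>\<tau>\<close> are chosen so that \<open>\<sigma> (H - \<gamma>)\<close> and \<open>\<tau> \<alpha>\<close> are both nonnegative; the weight
    \<open>\<beta> = \<sigma> \<tau> \<alpha>\<close> then makes \<open>\<beta> (H - \<gamma>)\<close> a nonnegative penalty.\<close>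
  have Hsign: "\<exists>\<sigma>::real. (\<sigma> = -1 \<or> \<sigma> = 1) \<and> (\<forall>x. 0 \<le> \<sigma> * (H x - \<gamma>))"
  proof (cases "ereal \<gamma> = (INF x. ereal (H x))")
    case True
    have "\<gamma> \<le> H x" for x using INF_lower[of x UNIV "\<lambda>x. ereal (H x)"] True[symmetric] by simp
    then show ?thesis by (intro exI[of _ 1]) auto
  next
    case False
    then have *: "ereal \<gamma> = (SUP x. ereal (H x))" using \<gamma>(1) by simp
    have "H x \<le> \<gamma>" for x using SUP_upper[of x UNIV "\<lambda>x. ereal (H x)"] *[symmetric] by simp
    then show ?thesis by (intro exI[of _ "-1"]) auto
  qed
  then obtain \<sigma> where \<sigma>: "\<sigma> = -1 \<or> \<sigma> = 1" "\<And>x. 0 \<le> \<sigma> * (H x - \<gamma>)" by blast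
  obtain \<tau> :: real where \<tau>: "\<tau> = -1 \<or> \<tau> = 1" "AE t in lebesgue_on {0..T}. 0 \<le> \<tau> * \<alpha> t"
  proof (cases "AE t in lebesgue_on {0..T}. \<alpha> t \<ge> 0")
    case True then show thesis by (intro that[of 1]) auto
  next
    case False
    then have "AE t in lebesgue_on {0..T}. \<alpha> t \<le> 0"
      using \<open>constant_sign T \<alpha>\<close> by (simp add: constant_sign_def)
    then show thesis by (intro that[of "-1"]) auto
  qed
  define s where "s = \<sigma> * \<tau>"
  define \<beta> where "\<beta> t = s * \<alpha> t" for t
  have s: "\<bar>s\<bar> = 1" using \<sigma> \<tau> by (auto simp: s_def)
  have \<alpha>m: "\<alpha> \<in> borel_measurable (lebesgue_on {0..T})" using \<open>\<alpha> \<in> Linfty T\<close> by (simp add: Linfty_def)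
  obtain D where D: "AE t in lebesgue_on {0..T}. \<bar>\<alpha> t\<bar> \<le> D" using \<open>\<alpha> \<in> Linfty T\<close> by (auto simp: Linfty_def)
  have \<beta>D: "AE t in lebesgue_on {0..T}. \<bar>\<beta> t\<bar> \<le> D"
    using D by eventually_elim (simp add: \<beta>_def abs_mult s)
  have \<beta>L: "\<beta> \<in> Linfty T" using \<beta>D \<alpha>m by (auto simp: Linfty_def \<beta>_def[abs_def])
  have sign: "AE t in lebesgue_on {0..T}. \<forall>x. 0 \<le> \<beta> t * (H x - \<gamma>)"
    using \<tau>(2)
  proof eventually_elim
    case (elim t)
    have "0 \<le> (\<tau> * \<alpha> t) * (\<sigma> * (H x - \<gamma>))" for x using elim \<sigma>(2) by (rule mult_nonneg_nonneg)
    then show ?case by (simp add: \<beta>_def s_def mult_ac)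
  qed
  have nonzero: "AE t in lebesgue_on {0..T}. \<beta> t \<noteq> 0"
  proof -
    have "{t \<in> {0..T}. \<alpha> t = 0} = \<alpha> -` {0} \<inter> space (lebesgue_on {0..T})" by auto
    also have "\<dots> \<in> sets (lebesgue_on {0..T})" using \<alpha>m by (rule measurable_sets) auto
    finally have "{t \<in> {0..T}. \<alpha> t = 0} \<in> sets lebesgue" by (simp add: sets_restrict_space_iff)
    then have "negligible {t \<in> {0..T}. \<alpha> t = 0}"
      using assms(12) by (auto simp: negligible_iff_null_sets null_sets_def)
    then have "AE t in lebesgue_on {0..T}. \<alpha> t \<noteq> 0" unfolding AE_lebesgue_on_iff_negligible by blast
    then show ?thesis by eventually_elim (use s in \<open>auto simp: \<beta>_def\<close>)
  qed
  have coer: "\<exists>\<rho>. AE t in lebesgue_on {0..T}. \<forall>x l. \<rho> \<le> norm x \<longrightarrow> \<bar>l\<bar> \<le> \<Lambda> \<longrightarrow>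
     B \<le> F t x + l * G t x + \<mu> * (\<beta> t * (H x - \<gamma>))" if "0 \<le> \<Lambda>" for \<Lambda> B \<mu>
    by (rule perturbation_coercive[OF q growth_bounds(1)[OF \<open>T > 0\<close> qF qGH]
          growth_bounds(2)[OF \<open>T > 0\<close> qF qGH] \<beta>D that])
  obtain l \<mu> u1 u2 where ne: "\<exists>t\<in>{0..T}. u1 t \<noteq> u2 t"
    and min: "is_global_min_on (energy T \<Phi> (\<lambda>t x. F t x + l * G t x + \<mu> * (\<beta> t * (H x - \<gamma>)))) (K_set L T) u1"
      "is_global_min_on (energy T \<Phi> (\<lambda>t x. F t x + l * G t x + \<mu> * (\<beta> t * (H x - \<gamma>)))) (K_set L T) u2"
    by (rule two_minimizers[OF \<open>F \<in> class_B T\<close> \<open>G \<in> class_B T\<close> \<open>C1_on UNIV H\<close> \<beta>L sign nonzero coer \<gamma>(2) vw less])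
  define Q where "Q t x = F t x + l * G t x + \<mu> * (\<beta> t * (H x - \<gamma>))" for t x
  define P where "P t x = F t x + l * G t x + (\<mu> * s) * \<alpha> t * H x" for t x
  have admF: "admissible T F" and admG: "admissible T G" using assms by (auto intro: class_B_admissible)
  have admQ: "admissible T Q" unfolding Q_def[abs_def]
    by (intro admissible_add_cmult admF admG admissible_weight \<beta>L assms)
  have "admissible T (\<lambda>t x. F t x + l * G t x + (\<mu> * s) * (\<alpha> t * (H x - 0)))"
    by (intro admissible_add_cmult admF admG admissible_weight assms)
  then have admP: "admissible T P" by (simp add: P_def[abs_def] mult.assoc)
  \<comment> \<open>Subtracting \<open>\<gamma>\<close> from \<open>H\<close> shifts the functional by a constant only.\<close>
  have energyP: "energy T \<Phi> P u = energy T \<Phi> Q u + \<mu> * s * \<gamma> * (LINT t|lebesgue_on {0..T}. \<alpha> t)"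
    if u: "u \<in> K_set L T" for u
  proof -
    have \<alpha>I: "integrable (lebesgue_on {0..T}) \<alpha>"
      by (rule AE_bounded_integrable[OF \<alpha>m]) (use D in simp)
    have "P t (u t) = Q t (u t) + \<mu> * s * \<gamma> * \<alpha> t" for t
      by (simp add: P_def Q_def \<beta>_def algebra_simps)
    then have "(LINT t|lebesgue_on {0..T}. P t (u t))
        = (LINT t|lebesgue_on {0..T}. Q t (u t)) + \<mu> * s * \<gamma> * (LINT t|lebesgue_on {0..T}. \<alpha> t)"
      using admissible_integrable(1)[OF admQ K_continuous[OF u]] \<alpha>I by simp
    then show ?thesis using energy_eq[OF u admP] energy_eq[OF u admQ] by simp
  qed
  have minP: "is_global_min_on (energy T \<Phi> P) (K_set L T) u" if "is_global_min_on (energy T \<Phi> Q) (K_set L T) u" for u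
    using that energyP by (simp add: is_global_min_on_def)
  have "is_global_min_on (energy T \<Phi> P) (K_set L T) u1" "is_global_min_on (energy T \<Phi> P) (K_set L T) u2"
    using min unfolding Q_def[abs_def, symmetric] by (auto intro: minP)
  moreover from this have "is_solution L T \<phi> P u1" "is_solution L T \<phi> P u2"
    using minimizer_is_solution[OF admP] by auto
  ultimately show ?thesis
    using ne unfolding Let_def P_def[abs_def] by blast
qed

end
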